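(* Let $A$ be a Poisson algebra over $k$, with universal enveloping algebra $A^e$ and structure maps $m,h:A\to A^e$. Let $V(A,\Omega_A)$ be the enveloping algebra of the Lie-Rinehart algebra $(A,\Omega_A)$, and let $\alpha:A\to V(A,\Omega_A)$ and $\beta:A\to V(A,\Omega_A)$ be the canonical maps. Then $A^e\cong V(A,\Omega_A)$ as algebras. More precisely, there is a unique algebra isomorphism $\Lambda:V(A,\Omega_A)\to A^e$ such that $\Lambda\circ\alpha=m$ and $\Lambda\circ\beta=h$.
   Context: $k$ is a field. A Poisson algebra is a commutative $k$-algebra $A$ with a Lie bracket $\{\cdot,\cdot\}$ such that $\{a,bc\}=\{a,b\}c+b\{a,c\}$. Universal enveloping algebra: $A^e$ is the associative unital $k$-algebra generated by two copies $m_A=\{m_a:a\in A\}$ and $h_A=\{h_a:a\in A\}$ of the vector space $A$ ($a\mapsto m_a$ and $a\mapsto h_a$ being $k$-linear) subject to the relations, for all $x,y\in A$, $$m_{xy}=m_xm_y,\quad h_{\{x,y\}}=h_xh_y-h_yh_x,\quad h_{xy}=m_yh_x+m_xh_y,\quad m_{\{x,y\}}=h_xm_y-m_yh_x,\quad m_1=1.$$ The structure maps are $m:a\mapsto m_a$ and $h:a\mapsto h_a$. Lie-Rinehart algebra: a pair $(A,L)$ with $A$ a commutative $k$-algebra, $L$ a $k$-Lie algebra which is a left $A$-module, and an anchor map $\rho:L\to \mathrm{Der}_k(A)$ that is an $A$-module and Lie algebra morphism with $[\xi,a\zeta]=a[\xi,\zeta]+\rho(\xi)(a)\zeta$. For a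 Poisson algebra $A$, the module $\Omega_A$ of Kähler differentials of $A$ over $k$ makes $(A,\Omega_A)$ a Lie-Rinehart algebra with $[a\,df,b\,dg]=ab\,d\{f,g\}+a\{f,b\}\,dg-b\{g,a\}\,df$ and anchor $df\mapsto\{f,\cdot\}$. Enveloping algebra $V(A,L)$: let $\mathfrak h=A\rtimes L$ be the vector space $A\oplus L$ with bracket $[a+X,b+Y]=(\rho(X)(b)-\rho(Y)(a))+[X,Y]$ and its natural $A$-module structure. Let $U^+$ be the (non-unital) subalgebra of the enveloping algebra $U(\mathfrak h)$ generated by the image of $\mathfrak h$, write $z'$ for the image of $z\in\mathfrak h$, and let $P$ be the two-sided ideal of $U^+$ generated by all $(a\cdot z)'-a'z'$ with $a\in A$, $z\in\mathfrak h$. Then $V(A,L)=U^+/P$; it is a unital algebra whose identity is the class of $1_A'$. The map $\alpha$ is the composite $A\to A\rtimes\Omega_A\to V(A,\Omega_A)$, and $\beta$ is the composite $A\xrightarrow{d}\Omega_A\to A\rtimes\Omega_A\to V(A,\Omega_A)$. *)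

theory Defs
  imports "HOL-Algebra.QuotRing" "HOL-Algebra.Module" "HOL.Hull" "HOL-Library.FuncSet"
begin

section \<open>Lie algebras and Poisson algebras\<close>

text \<open>For a bare module or Lie algebra the fields \<open>mult\<close> and \<open>one\<close> inherited from
  \<^type>\<open>module\<close> carry no information; below they are filled with \<open>undefined\<close>.\<close>

record ('k, 'b) lie_alg = "('k, 'b) module" +
  lie :: "'b \<Rightarrow> 'b \<Rightarrow> 'b"

locale lie_algebra = module K g
  for K :: "('k, 'm) ring_scheme" (structure) and g :: "('k, 'b, 'n) lie_alg_scheme" (structure) +
  assumes lie_closed: "\<lbrakk>x \<in> carrier g; y \<in> carrier g\<rbrakk> \<Longrightarrow> lie g x y \<in> carrier g"
    and lie_add_left: "\<lbrakk>x \<in> carrier g; y \<in> carrier g; z \<in> carrier g\<rbrakk> \<Longrightarrow>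
          lie g (x \<oplus>\<^bsub>g\<^esub> y) z = lie g x z \<oplus>\<^bsub>g\<^esub> lie g y z"
    and lie_add_right: "\<lbrakk>x \<in> carrier g; y \<in> carrier g; z \<in> carrier g\<rbrakk> \<Longrightarrow>
          lie g x (y \<oplus>\<^bsub>g\<^esub> z) = lie g x y \<oplus>\<^bsub>g\<^esub> lie g x z"
    and lie_smult_left: "\<lbrakk>c \<in> carrier K; x \<in> carrier g; y \<in> carrier g\<rbrakk> \<Longrightarrow>
          lie g (c \<odot>\<^bsub>g\<^esub> x) y = c \<odot>\<^bsub>g\<^esub> lie g x y"
    and lie_smult_right: "\<lbrakk>c \<in> carrier K; x \<in> carrier g; y \<in> carrier g\<rbrakk> \<Longrightarrow>
          lie g x (c \<odot>\<^bsub>g\<^esub> y) = c \<odot>\<^bsub>g\<^esub> lie g x y"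
    and lie_self: "x \<in> carrier g \<Longrightarrow> lie g x x = \<zero>\<^bsub>g\<^esub>"
    and jacobi: "\<lbrakk>x \<in> carrier g; y \<in> carrier g; z \<in> carrier g\<rbrakk> \<Longrightarrow>
          lie g x (lie g y z) \<oplus>\<^bsub>g\<^esub> lie g y (lie g z x) \<oplus>\<^bsub>g\<^esub> lie g z (lie g x y) = \<zero>\<^bsub>g\<^esub>"

locale poisson_algebra = field K + algebra K A + lie_algebra K A
  for K :: "('k, 'm) ring_scheme" (structure) and A :: "('k, 'a, 'n) lie_alg_scheme" (structure) +
  assumes leibniz: "\<lbrakk>a \<in> carrier A; b \<in> carrier A; c \<in> carrier A\<rbrakk> \<Longrightarrow>
          lie A a (b \<otimes>\<^bsub>A\<^esub> c) = lie A a b \<otimes>\<^bsub>A\<^esub> c \<oplus>\<^bsub>A\<^esub> b \<otimes>\<^bsub>A\<^esub> lie A a c"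


section \<open>Free modules, free algebras, quotients\<close>

definition supp :: "('r, 'm) ring_scheme \<Rightarrow> ('x \<Rightarrow> 'r) \<Rightarrow> 'x set"
  where "supp R u = {x. u x \<noteq> \<zero>\<^bsub>R\<^esub>}"

definition delta :: "('r, 'm) ring_scheme \<Rightarrow> 'x \<Rightarrow> 'x \<Rightarrow> 'r"
  where "delta R x = (\<lambda>y. if y = x then \<one>\<^bsub>R\<^esub> else \<zero>\<^bsub>R\<^esub>)"

definition free_module :: "('r, 'm) ring_scheme \<Rightarrow> 'x set \<Rightarrow> ('r, 'x \<Rightarrow> 'r) module"
  where "free_module R X =
    \<lparr>carrier = {u. (\<forall>x. u x \<in> carrier R) \<and> finite (supp R u) \<and> supp R u \<subseteq> X},
     mult = undefined, one = undefined,
     zero = (\<lambda>_. \<zero>\<^bsub>R\<^esub>), add = (\<lambda>u v x. u x \<oplus>\<^bsub>R\<^esub> v x),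
     smult = (\<lambda>c u x. c \<otimes>\<^bsub>R\<^esub> u x)\<rparr>"

text \<open>The free unital associative algebra on \<open>X\<close>: the free module on the words over \<open>X\<close>, with
  multiplication extending concatenation of words.\<close>

definition free_algebra :: "('k, 'm) ring_scheme \<Rightarrow> 'x set \<Rightarrow> ('k, 'x list \<Rightarrow> 'k) module"
  where "free_algebra K X = (free_module K (lists X))
    \<lparr>mult := (\<lambda>p q w. \<Oplus>\<^bsub>K\<^esub>i\<in>{..length w}. p (take i w) \<otimes>\<^bsub>K\<^esub> q (drop i w)),
     one := delta K []\<rparr>"

text \<open>The library quotient \<open>B Quot I\<close>, equipped with the induced scalar multiplication. It is used
  for algebras (possibly non-unital) modulo ideals and for modules modulo submodules.\<close>

definition quot_alg :: "('k, 'b, 'n) module_scheme \<Rightarrow> 'b set \<Rightarrow> ('k, 'b set) module"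
  where "quot_alg B I =
    \<lparr>carrier = carrier (B Quot I), mult = mult (B Quot I), one = one (B Quot I),
     zero = zero (B Quot I), add = add (B Quot I),
     smult = (\<lambda>c X. \<Union>x\<in>X. I +>\<^bsub>B\<^esub> (c \<odot>\<^bsub>B\<^esub> x))\<rparr>"

definition algebra_iso ::
  "('k, 'm) ring_scheme \<Rightarrow> ('k, 'b, 'n) module_scheme \<Rightarrow> ('k, 'c, 'l) module_scheme \<Rightarrow> ('b \<Rightarrow> 'c) set"
  where "algebra_iso K B C = {\<phi> \<in> ring_iso B C.
    \<forall>c\<in>carrier K. \<forall>x\<in>carrier B. \<phi> (c \<odot>\<^bsub>B\<^esub> x) = c \<odot>\<^bsub>C\<^esub> \<phi> x}"


section \<open>The universal enveloping algebra of a Poisson algebra\<close>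

datatype 'a pgen = MGen 'a | HGen 'a

definition poisson_free ::
  "('k, 'm) ring_scheme \<Rightarrow> ('k, 'a, 'n) lie_alg_scheme \<Rightarrow> ('k, 'a pgen list \<Rightarrow> 'k) module"
  where "poisson_free K A = free_algebra K (MGen ` carrier A \<union> HGen ` carrier A)"

definition poisson_rels ::
  "('k, 'm) ring_scheme \<Rightarrow> ('k, 'a, 'n) lie_alg_scheme \<Rightarrow> ('a pgen list \<Rightarrow> 'k) set"
  where "poisson_rels K A =
   (let F = poisson_free K A; M = (\<lambda>a. delta K [MGen a]); H = (\<lambda>a. delta K [HGen a]) in
     {M (x \<oplus>\<^bsub>A\<^esub> y) \<ominus>\<^bsub>F\<^esub> (M x \<oplus>\<^bsub>F\<^esub> M y) | x y. x \<in> carrier A \<and> y \<in> carrier A}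
   \<union> {M (c \<odot>\<^bsub>A\<^esub> x) \<ominus>\<^bsub>F\<^esub> c \<odot>\<^bsub>F\<^esub> M x | c x. c \<in> carrier K \<and> x \<in> carrier A}
   \<union> {H (x \<oplus>\<^bsub>A\<^esub> y) \<ominus>\<^bsub>F\<^esub> (H x \<oplus>\<^bsub>F\<^esub> H y) | x y. x \<in> carrier A \<and> y \<in> carrier A}
   \<union> {H (c \<odot>\<^bsub>A\<^esub> x) \<ominus>\<^bsub>F\<^esub> c \<odot>\<^bsub>F\<^esub> H x | c x. c \<in> carrier K \<and> x \<in> carrier A}
   \<union> {M (x \<otimes>\<^bsub>A\<^esub> y) \<ominus>\<^bsub>F\<^esub> M x \<otimes>\<^bsub>F\<^esub> M y | x y. x \<in> carrier A \<and> y \<in> carrier A}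
   \<union> {H (lie A x y) \<ominus>\<^bsub>F\<^esub> (H x \<otimes>\<^bsub>F\<^esub> H y \<ominus>\<^bsub>F\<^esub> H y \<otimes>\<^bsub>F\<^esub> H x) | x y. x \<in> carrier A \<and> y \<in> carrier A}
   \<union> {H (x \<otimes>\<^bsub>A\<^esub> y) \<ominus>\<^bsub>F\<^esub> (M y \<otimes>\<^bsub>F\<^esub> H x \<oplus>\<^bsub>F\<^esub> M x \<otimes>\<^bsub>F\<^esub> H y) | x y. x \<in> carrier A \<and> y \<in> carrier A}
   \<union> {M (lie A x y) \<ominus>\<^bsub>F\<^esub> (H x \<otimes>\<^bsub>F\<^esub> M y \<ominus>\<^bsub>F\<^esub> M y \<otimes>\<^bsub>F\<^esub> H x) | x y. x \<in> carrier A \<and> y \<in> carrier A}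
   \<union> {M \<one>\<^bsub>A\<^esub> \<ominus>\<^bsub>F\<^esub> \<one>\<^bsub>F\<^esub>})"

definition poisson_ideal ::
  "('k, 'm) ring_scheme \<Rightarrow> ('k, 'a, 'n) lie_alg_scheme \<Rightarrow> ('a pgen list \<Rightarrow> 'k) set"
  where "poisson_ideal K A = Idl\<^bsub>poisson_free K A\<^esub> (poisson_rels K A)"

definition poisson_env ::
  "('k, 'm) ring_scheme \<Rightarrow> ('k, 'a, 'n) lie_alg_scheme \<Rightarrow> ('k, ('a pgen list \<Rightarrow> 'k) set) module"
  where "poisson_env K A = quot_alg (poisson_free K A) (poisson_ideal K A)"

definition m_map ::
  "('k, 'm) ring_scheme \<Rightarrow> ('k, 'a, 'n) lie_alg_scheme \<Rightarrow> 'a \<Rightarrow> ('a pgen list \<Rightarrow> 'k) set"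
  where "m_map K A a = poisson_ideal K A +>\<^bsub>poisson_free K A\<^esub> delta K [MGen a]"

definition h_map ::
  "('k, 'm) ring_scheme \<Rightarrow> ('k, 'a, 'n) lie_alg_scheme \<Rightarrow> 'a \<Rightarrow> ('a pgen list \<Rightarrow> 'k) set"
  where "h_map K A a = poisson_ideal K A +>\<^bsub>poisson_free K A\<^esub> delta K [HGen a]"


section \<open>The universal enveloping algebra of a Lie algebra\<close>

text \<open>Presented by the elements of \<open>g\<close> as generators; the linearity relations cut the free
  algebra on the set \<open>carrier g\<close> down to the tensor algebra of \<open>g\<close>.\<close>

definition lie_env_rels ::
  "('k, 'm) ring_scheme \<Rightarrow> ('k, 'b, 'n) lie_alg_scheme \<Rightarrow> ('b list \<Rightarrow> 'k) set"
  where "lie_env_rels K g =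
   (let F = free_algebra K (carrier g); e = (\<lambda>z. delta K [z]) in
     {e (x \<oplus>\<^bsub>g\<^esub> y) \<ominus>\<^bsub>F\<^esub> (e x \<oplus>\<^bsub>F\<^esub> e y) | x y. x \<in> carrier g \<and> y \<in> carrier g}
   \<union> {e (c \<odot>\<^bsub>g\<^esub> x) \<ominus>\<^bsub>F\<^esub> c \<odot>\<^bsub>F\<^esub> e x | c x. c \<in> carrier K \<and> x \<in> carrier g}
   \<union> {e x \<otimes>\<^bsub>F\<^esub> e y \<ominus>\<^bsub>F\<^esub> e y \<otimes>\<^bsub>F\<^esub> e x \<ominus>\<^bsub>F\<^esub> e (lie g x y) | x y. x \<in> carrier g \<and> y \<in> carrier g})"

definition lie_env_ideal ::
  "('k, 'm) ring_scheme \<Rightarrow> ('k, 'b, 'n) lie_alg_scheme \<Rightarrow> ('b list \<Rightarrow> 'k) set"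
  where "lie_env_ideal K g = Idl\<^bsub>free_algebra K (carrier g)\<^esub> (lie_env_rels K g)"

definition lie_env ::
  "('k, 'm) ring_scheme \<Rightarrow> ('k, 'b, 'n) lie_alg_scheme \<Rightarrow> ('k, ('b list \<Rightarrow> 'k) set) module"
  where "lie_env K g = quot_alg (free_algebra K (carrier g)) (lie_env_ideal K g)"

definition lie_env_incl ::
  "('k, 'm) ring_scheme \<Rightarrow> ('k, 'b, 'n) lie_alg_scheme \<Rightarrow> 'b \<Rightarrow> ('b list \<Rightarrow> 'k) set"
  where "lie_env_incl K g z = lie_env_ideal K g +>\<^bsub>free_algebra K (carrier g)\<^esub> delta K [z]"


section \<open>The enveloping algebra of a Lie-Rinehart algebra\<close>

text \<open>The data carried by \<open>L\<close> in a Lie-Rinehart algebra \<open>(A, L)\<close>: a Lie algebra over \<open>K\<close>, an action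
  of \<open>A\<close> on \<open>L\<close>, and the anchor.\<close>

record ('k, 'a, 'l) lr_alg = "('k, 'l) lie_alg" +
  act :: "'a \<Rightarrow> 'l \<Rightarrow> 'l"
  anchor :: "'l \<Rightarrow> 'a \<Rightarrow> 'a"

definition semidirect ::
  "('k, 'a, 'n) module_scheme \<Rightarrow> ('k, 'a, 'l, 'p) lr_alg_scheme \<Rightarrow> ('k, 'a \<times> 'l) lie_alg"
  where "semidirect A L =
    \<lparr>carrier = carrier A \<times> carrier L, mult = undefined, one = undefined,
     zero = (\<zero>\<^bsub>A\<^esub>, \<zero>\<^bsub>L\<^esub>),
     add = (\<lambda>(a, X) (b, Y). (a \<oplus>\<^bsub>A\<^esub> b, X \<oplus>\<^bsub>L\<^esub> Y)),
     smult = (\<lambda>c (a, X). (c \<odot>\<^bsub>A\<^esub> a, c \<odot>\<^bsub>L\<^esub> X)),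
     lie = (\<lambda>(a, X) (b, Y). (anchor L X b \<ominus>\<^bsub>A\<^esub> anchor L Y a, lie L X Y))\<rparr>"

definition semidirect_act ::
  "('k, 'a, 'n) module_scheme \<Rightarrow> ('k, 'a, 'l, 'p) lr_alg_scheme \<Rightarrow> 'a \<Rightarrow> 'a \<times> 'l \<Rightarrow> 'a \<times> 'l"
  where "semidirect_act A L a = (\<lambda>(b, X). (a \<otimes>\<^bsub>A\<^esub> b, act L a X))"

abbreviation lr_incl ::
  "('k, 'm) ring_scheme \<Rightarrow> ('k, 'a, 'n) module_scheme \<Rightarrow> ('k, 'a, 'l, 'p) lr_alg_scheme \<Rightarrow>
    'a \<times> 'l \<Rightarrow> (('a \<times> 'l) list \<Rightarrow> 'k) set"
  where "lr_incl K A L \<equiv> lie_env_incl K (semidirect A L)"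

text \<open>The non-unital subalgebra \<open>U\<^sup>+\<close>. There is no record for non-unital rings, so the field \<open>one\<close>
  holds \<open>1\<^sub>A'\<close>; it is not an identity of \<open>U\<^sup>+\<close>, but its class is the identity of the quotient
  defining \<open>V(A, L)\<close>.\<close>

definition lr_plus ::
  "('k, 'm) ring_scheme \<Rightarrow> ('k, 'a, 'n) module_scheme \<Rightarrow> ('k, 'a, 'l, 'p) lr_alg_scheme \<Rightarrow>
    ('k, (('a \<times> 'l) list \<Rightarrow> 'k) set) module"
  where "lr_plus K A L =
    (let U = lie_env K (semidirect A L) in U
      \<lparr>carrier := (\<lambda>S. submodule S K U \<and> (\<forall>x\<in>S. \<forall>y\<in>S. x \<otimes>\<^bsub>U\<^esub> y \<in> S))
         hull (lr_incl K A L ` carrier (semidirect A L)),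
       one := lr_incl K A L (\<one>\<^bsub>A\<^esub>, \<zero>\<^bsub>L\<^esub>)\<rparr>)"

definition lr_ideal ::
  "('k, 'm) ring_scheme \<Rightarrow> ('k, 'a, 'n) module_scheme \<Rightarrow> ('k, 'a, 'l, 'p) lr_alg_scheme \<Rightarrow>
    (('a \<times> 'l) list \<Rightarrow> 'k) set set"
  where "lr_ideal K A L =
    (let U = lr_plus K A L in
      (\<lambda>I. submodule I K U \<and> (\<forall>x\<in>I. \<forall>y\<in>carrier U. x \<otimes>\<^bsub>U\<^esub> y \<in> I \<and> y \<otimes>\<^bsub>U\<^esub> x \<in> I)) hull
      {lr_incl K A L (semidirect_act A L a z)
         \<ominus>\<^bsub>U\<^esub> lr_incl K A L (a, \<zero>\<^bsub>L\<^esub>) \<otimes>\<^bsub>U\<^esub> lr_incl K A L z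
        | a z. a \<in> carrier A \<and> z \<in> carrier (semidirect A L)})"

definition lr_env ::
  "('k, 'm) ring_scheme \<Rightarrow> ('k, 'a, 'n) module_scheme \<Rightarrow> ('k, 'a, 'l, 'p) lr_alg_scheme \<Rightarrow>
    ('k, (('a \<times> 'l) list \<Rightarrow> 'k) set set) module"
  where "lr_env K A L = quot_alg (lr_plus K A L) (lr_ideal K A L)"

definition lr_env_incl ::
  "('k, 'm) ring_scheme \<Rightarrow> ('k, 'a, 'n) module_scheme \<Rightarrow> ('k, 'a, 'l, 'p) lr_alg_scheme \<Rightarrow>
    'a \<times> 'l \<Rightarrow> (('a \<times> 'l) list \<Rightarrow> 'k) set set"
  where "lr_env_incl K A L z = lr_ideal K A L +>\<^bsub>lr_plus K A L\<^esub> lr_incl K A L z"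


section \<open>Kaehler differentials of a Poisson algebra\<close>

definition kahler_rels ::
  "('k, 'm) ring_scheme \<Rightarrow> ('k, 'a, 'n) module_scheme \<Rightarrow> ('a \<Rightarrow> 'a) set"
  where "kahler_rels K A =
   (let F = free_module A (carrier A) in
     {delta A (f \<oplus>\<^bsub>A\<^esub> g) \<ominus>\<^bsub>F\<^esub> (delta A f \<oplus>\<^bsub>F\<^esub> delta A g) | f g. f \<in> carrier A \<and> g \<in> carrier A}
   \<union> {delta A (c \<odot>\<^bsub>A\<^esub> f) \<ominus>\<^bsub>F\<^esub> (c \<odot>\<^bsub>A\<^esub> \<one>\<^bsub>A\<^esub>) \<odot>\<^bsub>F\<^esub> delta A f | c f. c \<in> carrier K \<and> f \<in> carrier A}
   \<union> {delta A (f \<otimes>\<^bsub>A\<^esub> g) \<ominus>\<^bsub>F\<^esub> (f \<odot>\<^bsub>F\<^esub> delta A g \<oplus>\<^bsub>F\<^esub> g \<odot>\<^bsub>F\<^esub> delta A f)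
        | f g. f \<in> carrier A \<and> g \<in> carrier A})"

definition kahler_sub ::
  "('k, 'm) ring_scheme \<Rightarrow> ('k, 'a, 'n) module_scheme \<Rightarrow> ('a \<Rightarrow> 'a) set"
  where "kahler_sub K A = (\<lambda>N. submodule N A (free_module A (carrier A))) hull (kahler_rels K A)"

definition kahler_module ::
  "('k, 'm) ring_scheme \<Rightarrow> ('k, 'a, 'n) module_scheme \<Rightarrow> ('a, ('a \<Rightarrow> 'a) set) module"
  where "kahler_module K A = quot_alg (free_module A (carrier A)) (kahler_sub K A)"

definition kahler_d ::
  "('k, 'm) ring_scheme \<Rightarrow> ('k, 'a, 'n) module_scheme \<Rightarrow> 'a \<Rightarrow> ('a \<Rightarrow> 'a) set"
  where "kahler_d K A f = kahler_sub K A +>\<^bsub>free_module A (carrier A)\<^esub> delta A f"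

text \<open>A representative \<open>u\<close> of \<open>X\<close> is an expression of \<open>X\<close> as the finite sum of the \<open>u f \<cdot> df\<close>,
  \<open>f \<in> supp A u\<close>. The bracket and the anchor are given on such sums by the biadditive extension of
  \<open>[a df, b dg] = ab d{f,g} + a{f,b} dg - b{g,a} df\<close> and the \<open>A\<close>-linear extension of
  \<open>df \<mapsto> {f,\<cdot>}\<close>; neither depends on the chosen representatives when \<open>A\<close> is a Poisson algebra.\<close>

definition kahler_rep :: "('a \<Rightarrow> 'a) set \<Rightarrow> 'a \<Rightarrow> 'a"
  where "kahler_rep X = (SOME u. u \<in> X)"

definition kahler_lie ::
  "('k, 'm) ring_scheme \<Rightarrow> ('k, 'a, 'n) lie_alg_scheme \<Rightarrow>
    ('a \<Rightarrow> 'a) set \<Rightarrow> ('a \<Rightarrow> 'a) set \<Rightarrow> ('a \<Rightarrow> 'a) set"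
  where "kahler_lie K A X Y =
   (let \<Omega> = kahler_module K A; d = kahler_d K A; u = kahler_rep X; v = kahler_rep Y in
     \<Oplus>\<^bsub>\<Omega>\<^esub>f\<in>supp A u. \<Oplus>\<^bsub>\<Omega>\<^esub>g\<in>supp A v.
       (u f \<otimes>\<^bsub>A\<^esub> v g) \<odot>\<^bsub>\<Omega>\<^esub> d (lie A f g)
       \<oplus>\<^bsub>\<Omega>\<^esub> (u f \<otimes>\<^bsub>A\<^esub> lie A f (v g)) \<odot>\<^bsub>\<Omega>\<^esub> d g
       \<ominus>\<^bsub>\<Omega>\<^esub> (v g \<otimes>\<^bsub>A\<^esub> lie A g (u f)) \<odot>\<^bsub>\<Omega>\<^esub> d f)"

definition kahler_anchor :: "('k, 'a, 'n) lie_alg_scheme \<Rightarrow> ('a \<Rightarrow> 'a) set \<Rightarrow> 'a \<Rightarrow> 'a"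
  where "kahler_anchor A X a =
   (let u = kahler_rep X in \<Oplus>\<^bsub>A\<^esub>f\<in>supp A u. u f \<otimes>\<^bsub>A\<^esub> lie A f a)"

definition kahler ::
  "('k, 'm) ring_scheme \<Rightarrow> ('k, 'a, 'n) lie_alg_scheme \<Rightarrow> ('k, 'a, ('a \<Rightarrow> 'a) set) lr_alg"
  where "kahler K A =
   (let \<Omega> = kahler_module K A in
    \<lparr>carrier = carrier \<Omega>, mult = undefined, one = undefined, zero = zero \<Omega>, add = add \<Omega>,
     smult = (\<lambda>c X. (c \<odot>\<^bsub>A\<^esub> \<one>\<^bsub>A\<^esub>) \<odot>\<^bsub>\<Omega>\<^esub> X),
     lie = kahler_lie K A,
     act = smult \<Omega>,
     anchor = kahler_anchor A\<rparr>)"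

definition alpha ::
  "('k, 'm) ring_scheme \<Rightarrow> ('k, 'a, 'n) lie_alg_scheme \<Rightarrow>
    'a \<Rightarrow> (('a \<times> ('a \<Rightarrow> 'a) set) list \<Rightarrow> 'k) set set"
  where "alpha K A a = lr_env_incl K A (kahler K A) (a, \<zero>\<^bsub>kahler K A\<^esub>)"

definition beta ::
  "('k, 'm) ring_scheme \<Rightarrow> ('k, 'a, 'n) lie_alg_scheme \<Rightarrow>
    'a \<Rightarrow> (('a \<times> ('a \<Rightarrow> 'a) set) list \<Rightarrow> 'k) set set"
  where "beta K A a = lr_env_incl K A (kahler K A) (\<zero>\<^bsub>A\<^esub>, kahler_d K A a)"

end

theory Submission
  imports Defs
begin

text \<open>
  Both algebras have the same universal property: homomorphisms into an algebra \<open>C\<close> correspond to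
  pairs of maps \<open>m, h : A \<rightarrow> C\<close> satisfying the defining relations of the Poisson enveloping algebra.
  For \<open>V(A, \<Omega>)\<close>, such a pair gives an additive map \<open>\<Omega> \<rightarrow> C\<close>, \<open>a df \<mapsto> m a \<cdot> h f\<close>, and its sum with \<open>m\<close>
  is a Lie homomorphism from the semidirect product into \<open>C\<close> that kills the relations of
  \<open>V(A, \<Omega>)\<close>; conversely \<open>\<alpha>\<close> and \<open>\<beta>\<close> satisfy the relations, and they generate \<open>V(A, \<Omega>)\<close>.
  The latter direction needs the bracket on \<open>\<Omega>\<close>, defined on chosen representatives, to be
  independent of that choice.
\<close>

section \<open>Algebras and their quotients\<close>

text \<open>The bracket of differentials is additive but not \<open>A\<close>-bilinear: pulling a
  coefficient out of one argument costs an anchor term. The universal property of a free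
  \<open>A\<close>-module therefore yields neither the bracket nor identities about it. The
  substitute is additivity in the coefficients: a map out of a free module is assembled from one
  additive function per generator, and two additive maps agree once they agree on all multiples of
  generators. Every identity about differentials thus becomes a calculation with \<open>a df\<close>
  and \<open>b dg\<close>, and the same device, over words, builds the free algebra.

  For a pair \<open>m\<close>, \<open>h\<close> into \<open>C\<close>, the algebra \<open>C\<close>
  is a left \<open>A\<close>-module through \<open>m\<close>, and the relation for
  \<open>h (xy)\<close> makes \<open>h\<close> a derivation into it, so \<open>h\<close> extends to
  the differentials. The two commutator relations allow every \<open>m\<close> to be moved to the
  left, and the corrections that arise are exactly the anchor and the bracket.

  The two homomorphisms are mutually inverse because each composite fixes a set of
  generators.\<close>

lemma (in abelian_group) minus_eq_zero_iff:
  assumes "x \<in> carrier G" "y \<in> carrier G"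
  shows "x \<ominus> y = \<zero> \<longleftrightarrow> x = y"
proof
  assume "x \<ominus> y = \<zero>"
  then show "x = y"
    using assms by (metis a_minus_def add.inv_closed add.inv_equality add.inv_inv)
qed (use assms in \<open>simp add: a_minus_def r_neg\<close>)

lemma (in abelian_group) minus_zero_right: "x \<in> carrier G \<Longrightarrow> x \<ominus> \<zero> = x"
  using r_neg[of \<zero>] by (simp add: a_minus_def)

text \<open>For comparing the two products in a commutator: \<open>p\<close> is their common part,
  \<open>q\<close> the surplus of the first and \<open>s\<close> that of the second, so the
  commutator has to be \<open>q \<ominus> s\<close>.\<close>

lemma (in abelian_group) diff_cancel:
  assumes "p \<in> carrier G" "q \<in> carrier G" "s \<in> carrier G"
  shows "(p \<oplus> s) \<oplus> (q \<ominus> s) = p \<oplus> q"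
proof -
  have "(p \<oplus> s) \<oplus> (q \<ominus> s) = (p \<oplus> q) \<oplus> (s \<oplus> \<ominus> s)"
    using assms by (simp only: minus_eq a_ac add.m_closed a_inv_closed)
  then show ?thesis using assms by (simp add: r_neg)
qed

text \<open>Passes between a commutator relation \<open>[x,y] = xy - yx\<close> and the exchange
  rule \<open>xy = yx + [x,y]\<close>, which is the form suited to rewriting.\<close>

lemma (in abelian_group) eq_minus_iff:
  assumes "p \<in> carrier G" "q \<in> carrier G" "z \<in> carrier G"
  shows "z = p \<ominus> q \<longleftrightarrow> p = q \<oplus> z"
proof
  assume "p = q \<oplus> z"
  then have "p \<ominus> q = z \<oplus> (q \<oplus> \<ominus> q)"
    using assms by (simp only: minus_eq a_ac add.m_closed a_inv_closed)
  then show "z = p \<ominus> q" using assms by (simp add: r_neg)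
next
  assume "z = p \<ominus> q"
  then have "q \<oplus> z = p \<oplus> (q \<oplus> \<ominus> q)"
    using assms by (simp only: minus_eq a_ac add.m_closed a_inv_closed)
  then show "p = q \<oplus> z" using assms by (simp add: r_neg)
qed

section \<open>Algebras with and without identity, homomorphisms, submodules\<close>

locale nonunital_algebra = module K B
  for K (structure) and B (structure) +
  assumes mult_closed: "\<lbrakk>x \<in> carrier B; y \<in> carrier B\<rbrakk> \<Longrightarrow> x \<otimes>\<^bsub>B\<^esub> y \<in> carrier B"
    and mult_assoc: "\<lbrakk>x \<in> carrier B; y \<in> carrier B; z \<in> carrier B\<rbrakk> \<Longrightarrow>
          (x \<otimes>\<^bsub>B\<^esub> y) \<otimes>\<^bsub>B\<^esub> z = x \<otimes>\<^bsub>B\<^esub> (y \<otimes>\<^bsub>B\<^esub> z)"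
    and mult_l_distr: "\<lbrakk>x \<in> carrier B; y \<in> carrier B; z \<in> carrier B\<rbrakk> \<Longrightarrow>
          (x \<oplus>\<^bsub>B\<^esub> y) \<otimes>\<^bsub>B\<^esub> z = x \<otimes>\<^bsub>B\<^esub> z \<oplus>\<^bsub>B\<^esub> y \<otimes>\<^bsub>B\<^esub> z"
    and mult_r_distr: "\<lbrakk>x \<in> carrier B; y \<in> carrier B; z \<in> carrier B\<rbrakk> \<Longrightarrow>
          z \<otimes>\<^bsub>B\<^esub> (x \<oplus>\<^bsub>B\<^esub> y) = z \<otimes>\<^bsub>B\<^esub> x \<oplus>\<^bsub>B\<^esub> z \<otimes>\<^bsub>B\<^esub> y"
    and mult_smult_l: "\<lbrakk>c \<in> carrier K; x \<in> carrier B; y \<in> carrier B\<rbrakk> \<Longrightarrow>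
          (c \<odot>\<^bsub>B\<^esub> x) \<otimes>\<^bsub>B\<^esub> y = c \<odot>\<^bsub>B\<^esub> (x \<otimes>\<^bsub>B\<^esub> y)"
    and mult_smult_r: "\<lbrakk>c \<in> carrier K; x \<in> carrier B; y \<in> carrier B\<rbrakk> \<Longrightarrow>
          x \<otimes>\<^bsub>B\<^esub> (c \<odot>\<^bsub>B\<^esub> y) = c \<odot>\<^bsub>B\<^esub> (x \<otimes>\<^bsub>B\<^esub> y)"

locale assoc_algebra = nonunital_algebra K B
  for K (structure) and B (structure) +
  assumes unit_closed: "\<one>\<^bsub>B\<^esub> \<in> carrier B"
    and unit_l: "x \<in> carrier B \<Longrightarrow> \<one>\<^bsub>B\<^esub> \<otimes>\<^bsub>B\<^esub> x = x"
    and unit_r: "x \<in> carrier B \<Longrightarrow> x \<otimes>\<^bsub>B\<^esub> \<one>\<^bsub>B\<^esub> = x"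

sublocale assoc_algebra \<subseteq> B: ring B
  by unfold_locales
    (auto simp: mult_assoc mult_closed unit_closed unit_l unit_r mult_l_distr mult_r_distr)

text \<open>Only the record fields of \<open>B\<close> are mentioned, so the notion applies even
  when the field \<open>one\<close> of \<open>B\<close> holds no identity. On
  \<open>U\<^sup>+\<close> it demands that \<open>1\<^sub>A'\<close> be sent to the identity of
  \<open>C\<close>.\<close>

definition algebra_hom ::
  "('k, 'm) ring_scheme \<Rightarrow> ('k, 'b, 'n) module_scheme \<Rightarrow> ('k, 'c, 'l) module_scheme \<Rightarrow> ('b \<Rightarrow> 'c) set"
  where "algebra_hom K B C = {\<phi> \<in> ring_hom B C.
    \<forall>c\<in>carrier K. \<forall>x\<in>carrier B. \<phi> (c \<odot>\<^bsub>B\<^esub> x) = c \<odot>\<^bsub>C\<^esub> \<phi> x}"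

lemma algebra_homI:
  assumes "\<And>x. x \<in> carrier B \<Longrightarrow> f x \<in> carrier C"
    and "\<And>x y. x \<in> carrier B \<Longrightarrow> y \<in> carrier B \<Longrightarrow> f (x \<oplus>\<^bsub>B\<^esub> y) = f x \<oplus>\<^bsub>C\<^esub> f y"
    and "\<And>x y. x \<in> carrier B \<Longrightarrow> y \<in> carrier B \<Longrightarrow> f (x \<otimes>\<^bsub>B\<^esub> y) = f x \<otimes>\<^bsub>C\<^esub> f y"
    and "f \<one>\<^bsub>B\<^esub> = \<one>\<^bsub>C\<^esub>"
    and "\<And>c x. c \<in> carrier K \<Longrightarrow> x \<in> carrier B \<Longrightarrow> f (c \<odot>\<^bsub>B\<^esub> x) = c \<odot>\<^bsub>C\<^esub> f x"
  shows "f \<in> algebra_hom K B C"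
  using assms by (auto simp: algebra_hom_def ring_hom_def)

lemma algebra_homD:
  assumes "f \<in> algebra_hom K B C"
  shows "x \<in> carrier B \<Longrightarrow> f x \<in> carrier C"
    and "x \<in> carrier B \<Longrightarrow> y \<in> carrier B \<Longrightarrow> f (x \<oplus>\<^bsub>B\<^esub> y) = f x \<oplus>\<^bsub>C\<^esub> f y"
    and "x \<in> carrier B \<Longrightarrow> y \<in> carrier B \<Longrightarrow> f (x \<otimes>\<^bsub>B\<^esub> y) = f x \<otimes>\<^bsub>C\<^esub> f y"
    and "f \<one>\<^bsub>B\<^esub> = \<one>\<^bsub>C\<^esub>"
    and "c \<in> carrier K \<Longrightarrow> x \<in> carrier B \<Longrightarrow> f (c \<odot>\<^bsub>B\<^esub> x) = c \<odot>\<^bsub>C\<^esub> f x"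
  using assms by (auto simp: algebra_hom_def ring_hom_def)

lemma algebra_hom_comp:
  assumes "f \<in> algebra_hom K B C" "g \<in> algebra_hom K C D"
  shows "(\<lambda>x. g (f x)) \<in> algebra_hom K B D"
  using algebra_homD[OF assms(1)] algebra_homD[OF assms(2)] by (intro algebra_homI) auto

lemma additive_zero_minus:
  assumes "abelian_group B" "abelian_group C"
    and cl: "\<And>x. x \<in> carrier B \<Longrightarrow> f x \<in> carrier C"
    and add: "\<And>x y. x \<in> carrier B \<Longrightarrow> y \<in> carrier B \<Longrightarrow> f (x \<oplus>\<^bsub>B\<^esub> y) = f x \<oplus>\<^bsub>C\<^esub> f y"
  shows "f \<zero>\<^bsub>B\<^esub> = \<zero>\<^bsub>C\<^esub>"
    and "x \<in> carrier B \<Longrightarrow> f (\<ominus>\<^bsub>B\<^esub> x) = \<ominus>\<^bsub>C\<^esub> f x"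
    and "x \<in> carrier B \<Longrightarrow> y \<in> carrier B \<Longrightarrow> f (x \<ominus>\<^bsub>B\<^esub> y) = f x \<ominus>\<^bsub>C\<^esub> f y"
proof -
  interpret B: abelian_group B by fact
  interpret C: abelian_group C by fact
  interpret abelian_group_hom B C f
    using assms by (intro abelian_group_homI group_hom.intro group_hom_axioms.intro B.a_group C.a_group)
      (auto simp: hom_def)
  show "f \<zero>\<^bsub>B\<^esub> = \<zero>\<^bsub>C\<^esub>" by simp
  show "x \<in> carrier B \<Longrightarrow> f (\<ominus>\<^bsub>B\<^esub> x) = \<ominus>\<^bsub>C\<^esub> f x" by simp
  show "x \<in> carrier B \<Longrightarrow> y \<in> carrier B \<Longrightarrow> f (x \<ominus>\<^bsub>B\<^esub> y) = f x \<ominus>\<^bsub>C\<^esub> f y"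
    by (simp add: a_minus_def)
qed

text \<open>The module axioms do not read the two fields changed here. This carries them from the
  free module to the free algebra, and from a submodule of the enveloping algebra to
  \<open>U\<^sup>+\<close> with its own \<open>one\<close>.\<close>

lemma module_update:
  assumes "module K M"
  shows "module K (M\<lparr>mult := p, one := e\<rparr>)"
proof -
  interpret module K M by fact
  show ?thesis
    using M.abelian_monoid_axioms M.abelian_group_axioms
    by (intro moduleI)
      (auto simp: smult_l_distr smult_r_distr smult_assoc1 abelian_group_def abelian_monoid_def
         abelian_group_axioms_def R.is_cring)
qed

text \<open>Negation is multiplication by the scalar \<open>\<ominus> \<one>\<close>, so closure
  under scalars covers it.\<close>

lemma submoduleI':
  assumes "module K M" "S \<subseteq> carrier M" "\<zero>\<^bsub>M\<^esub> \<in> S"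
    and "\<And>x y. x \<in> S \<Longrightarrow> y \<in> S \<Longrightarrow> x \<oplus>\<^bsub>M\<^esub> y \<in> S"
    and sm: "\<And>c x. c \<in> carrier K \<Longrightarrow> x \<in> S \<Longrightarrow> c \<odot>\<^bsub>M\<^esub> x \<in> S"
  shows "submodule S K M"
proof -
  interpret module K M by fact
  show ?thesis
  proof (rule submoduleI)
    fix a assume a: "a \<in> S"
    have "(\<ominus>\<^bsub>K\<^esub> \<one>\<^bsub>K\<^esub>) \<odot>\<^bsub>M\<^esub> a = \<ominus>\<^bsub>M\<^esub> a"
      using a assms(2) by (subst smult_l_minus) auto
    then show "\<ominus>\<^bsub>M\<^esub> a \<in> S" using sm[of "\<ominus>\<^bsub>K\<^esub> \<one>\<^bsub>K\<^esub>" a] a by simp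
  qed (use assms in auto)
qed

lemma submoduleD:
  assumes "module K M" "submodule S K M"
  shows "S \<subseteq> carrier M" "\<zero>\<^bsub>M\<^esub> \<in> S"
    and "x \<in> S \<Longrightarrow> y \<in> S \<Longrightarrow> x \<oplus>\<^bsub>M\<^esub> y \<in> S"
    and "c \<in> carrier K \<Longrightarrow> x \<in> S \<Longrightarrow> c \<odot>\<^bsub>M\<^esub> x \<in> S"
    and "x \<in> S \<Longrightarrow> y \<in> S \<Longrightarrow> x \<ominus>\<^bsub>M\<^esub> y \<in> S"
proof -
  interpret module K M by fact
  note E = submoduleE[OF assms(2)]
  show "S \<subseteq> carrier M" "\<zero>\<^bsub>M\<^esub> \<in> S"
    using E subgroup.one_closed[OF submodule.axioms(1)[OF assms(2)]] by auto
  show "x \<in> S \<Longrightarrow> y \<in> S \<Longrightarrow> x \<oplus>\<^bsub>M\<^esub> y \<in> S"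
    "c \<in> carrier K \<Longrightarrow> x \<in> S \<Longrightarrow> c \<odot>\<^bsub>M\<^esub> x \<in> S"
    "x \<in> S \<Longrightarrow> y \<in> S \<Longrightarrow> x \<ominus>\<^bsub>M\<^esub> y \<in> S"
    using E by (auto simp: a_minus_def)
qed

text \<open>Shows that the hulls in the definitions are again submodules: a hull is the intersection
  of all closed supersets, a family made nonempty by the whole carrier.\<close>

lemma submodule_Inter:
  assumes "module K M" "T \<noteq> {}" "\<And>S. S \<in> T \<Longrightarrow> submodule S K M"
  shows "submodule (\<Inter>T) K M"
proof -
  note D = submoduleD[OF assms(1) assms(3)]
  show ?thesis
  proof (rule submoduleI'[OF assms(1)])
    show "\<Inter>T \<subseteq> carrier M" using D(1) assms(2) by fast
  qed (simp_all add: D)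
qed

section \<open>Quotients by submodules and by two-sided ideals\<close>

locale quotient_module = module K B
  for K (structure) and B (structure) and I +
  assumes submodule_I: "submodule I K B"
begin

lemma I_sub: "abelian_subgroup I B"
  using submodule_I M.abelian_group_axioms
  by (intro abelian_subgroupI3 additive_subgroup.intro) (auto simp: submodule_def)

sublocale I: abelian_subgroup I B by (rule I_sub)

abbreviation Q where "Q \<equiv> quot_alg B I"

lemma I_smult: "c \<in> carrier K \<Longrightarrow> x \<in> I \<Longrightarrow> c \<odot>\<^bsub>B\<^esub> x \<in> I" and
  I_minus: "x \<in> I \<Longrightarrow> y \<in> I \<Longrightarrow> x \<ominus>\<^bsub>B\<^esub> y \<in> I"
  using submoduleD[OF module_axioms submodule_I] by auto

lemma coset_eq_iff:
  assumes "x \<in> carrier B" "y \<in> carrier B"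
  shows "I +>\<^bsub>B\<^esub> x = I +>\<^bsub>B\<^esub> y \<longleftrightarrow> x \<ominus>\<^bsub>B\<^esub> y \<in> I"
  using assms I.a_rcos_self
  by (metis a_minus_def I.a_rcos_module I.a_repr_independence')

lemma coset_zero: "I +>\<^bsub>B\<^esub> \<zero>\<^bsub>B\<^esub> = I"
  by (rule I.a_rcos_const) simp

lemma mem_coset:
  assumes "x \<in> carrier B" "y \<in> I +>\<^bsub>B\<^esub> x"
  shows "y \<in> carrier B" "I +>\<^bsub>B\<^esub> y = I +>\<^bsub>B\<^esub> x"
  using assms I.a_elemrcos_carrier I.a_repr_independence' by auto

lemma quot_carrier: "carrier Q = (\<lambda>x. I +>\<^bsub>B\<^esub> x) ` carrier B"
  by (auto simp: quot_alg_def FactRing_def A_RCOSETS_def')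

lemma quot_cases:
  assumes "X \<in> carrier Q"
  obtains x where "x \<in> carrier B" "X = I +>\<^bsub>B\<^esub> x"
  using assms by (auto simp: quot_carrier)

lemma coset_closed [simp]: "x \<in> carrier B \<Longrightarrow> I +>\<^bsub>B\<^esub> x \<in> carrier Q"
  by (auto simp: quot_carrier)

lemma quot_zero: "\<zero>\<^bsub>Q\<^esub> = I"
  by (simp add: quot_alg_def FactRing_def)

lemma quot_add: "x \<in> carrier B \<Longrightarrow> y \<in> carrier B \<Longrightarrow>
    (I +>\<^bsub>B\<^esub> x) \<oplus>\<^bsub>Q\<^esub> (I +>\<^bsub>B\<^esub> y) = I +>\<^bsub>B\<^esub> (x \<oplus>\<^bsub>B\<^esub> y)"
  by (simp add: quot_alg_def FactRing_def I.a_rcos_sum)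

text \<open>The union over representatives in \<open>quot_alg\<close> runs over one and the same
  coset, because \<open>I\<close> absorbs scalars, and therefore collapses to it.\<close>

lemma quot_smult:
  assumes "c \<in> carrier K" "x \<in> carrier B"
  shows "c \<odot>\<^bsub>Q\<^esub> (I +>\<^bsub>B\<^esub> x) = I +>\<^bsub>B\<^esub> (c \<odot>\<^bsub>B\<^esub> x)"
proof -
  have "I +>\<^bsub>B\<^esub> (c \<odot>\<^bsub>B\<^esub> y) = I +>\<^bsub>B\<^esub> (c \<odot>\<^bsub>B\<^esub> x)" if y: "y \<in> I +>\<^bsub>B\<^esub> x" for y
  proof -
    have yc: "y \<in> carrier B" and "y \<ominus>\<^bsub>B\<^esub> x \<in> I"
      using mem_coset[OF assms(2) y] coset_eq_iff assms by auto
    then have "c \<odot>\<^bsub>B\<^esub> y \<ominus>\<^bsub>B\<^esub> c \<odot>\<^bsub>B\<^esub> x \<in> I"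
      using I_smult[OF assms(1), of "y \<ominus>\<^bsub>B\<^esub> x"] assms
      by (simp add: a_minus_def smult_r_distr smult_r_minus)
    then show ?thesis using coset_eq_iff yc assms by auto
  qed
  then have "(\<Union>y\<in>I +>\<^bsub>B\<^esub> x. I +>\<^bsub>B\<^esub> (c \<odot>\<^bsub>B\<^esub> y)) = (\<Union>y\<in>I +>\<^bsub>B\<^esub> x. I +>\<^bsub>B\<^esub> (c \<odot>\<^bsub>B\<^esub> x))"
    by (intro SUP_cong refl)
  also have "\<dots> = I +>\<^bsub>B\<^esub> (c \<odot>\<^bsub>B\<^esub> x)"
    using I.a_rcos_self[OF assms(2)] by blast
  finally show ?thesis by (simp add: quot_alg_def)
qed

lemma quot_abelian_group: "abelian_group Q"
proof (rule abelian_groupI; (elim quot_cases)?)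
  show "\<exists>Y\<in>carrier Q. Y \<oplus>\<^bsub>Q\<^esub> X = \<zero>\<^bsub>Q\<^esub>" if "x \<in> carrier B" "X = I +>\<^bsub>B\<^esub> x" for X x
    using that by (intro bexI[of _ "I +>\<^bsub>B\<^esub> (\<ominus>\<^bsub>B\<^esub> x)"])
      (simp_all add: quot_add quot_zero M.l_neg coset_zero)
  show "\<zero>\<^bsub>Q\<^esub> \<in> carrier Q" using coset_closed[of "\<zero>\<^bsub>B\<^esub>"] by (simp add: coset_zero quot_zero)
  show "\<zero>\<^bsub>Q\<^esub> \<oplus>\<^bsub>Q\<^esub> X = X" if "x \<in> carrier B" "X = I +>\<^bsub>B\<^esub> x" for X x
    using that quot_add[of "\<zero>\<^bsub>B\<^esub>" x] by (simp add: coset_zero quot_zero)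
qed (simp_all add: quot_add M.a_ac)

lemma quot_module: "module K Q"
proof (rule moduleI)
  show "abelian_group Q" by (rule quot_abelian_group)
  show "cring K" by (rule R.is_cring)
  show "c \<odot>\<^bsub>Q\<^esub> X \<in> carrier Q" if "c \<in> carrier K" "X \<in> carrier Q" for c X
    using that by (elim quot_cases) (simp add: quot_smult)
  show "(a \<oplus> b) \<odot>\<^bsub>Q\<^esub> X = (a \<odot>\<^bsub>Q\<^esub> X) \<oplus>\<^bsub>Q\<^esub> (b \<odot>\<^bsub>Q\<^esub> X)"
    if "a \<in> carrier K" "b \<in> carrier K" "X \<in> carrier Q" for a b X
    using that by (elim quot_cases) (simp add: quot_smult quot_add smult_l_distr)
  show "a \<odot>\<^bsub>Q\<^esub> (X \<oplus>\<^bsub>Q\<^esub> Y) = (a \<odot>\<^bsub>Q\<^esub> X) \<oplus>\<^bsub>Q\<^esub> (a \<odot>\<^bsub>Q\<^esub> Y)"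
    if "a \<in> carrier K" "X \<in> carrier Q" "Y \<in> carrier Q" for a X Y
    using that by (elim quot_cases) (simp add: quot_smult quot_add smult_r_distr)
  show "(a \<otimes> b) \<odot>\<^bsub>Q\<^esub> X = a \<odot>\<^bsub>Q\<^esub> (b \<odot>\<^bsub>Q\<^esub> X)"
    if "a \<in> carrier K" "b \<in> carrier K" "X \<in> carrier Q" for a b X
    using that by (elim quot_cases) (simp add: quot_smult smult_assoc1)
  show "\<one> \<odot>\<^bsub>Q\<^esub> X = X" if "X \<in> carrier Q" for X
    using that by (elim quot_cases) (simp add: quot_smult)
qed

lemma quot_rep:
  assumes "x \<in> carrier B"
  shows "(SOME u. u \<in> I +>\<^bsub>B\<^esub> x) \<in> carrier B"
    and "I +>\<^bsub>B\<^esub> (SOME u. u \<in> I +>\<^bsub>B\<^esub> x) = I +>\<^bsub>B\<^esub> x"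
proof -
  have "(SOME u. u \<in> I +>\<^bsub>B\<^esub> x) \<in> I +>\<^bsub>B\<^esub> x"
    using I.a_rcos_self[OF assms] by (rule someI)
  then show "(SOME u. u \<in> I +>\<^bsub>B\<^esub> x) \<in> carrier B"
    "I +>\<^bsub>B\<^esub> (SOME u. u \<in> I +>\<^bsub>B\<^esub> x) = I +>\<^bsub>B\<^esub> x"
    using mem_coset[OF assms] by auto
qed

lemma quot_minus:
  assumes "x \<in> carrier B" "y \<in> carrier B"
  shows "I +>\<^bsub>B\<^esub> (x \<ominus>\<^bsub>B\<^esub> y) = (I +>\<^bsub>B\<^esub> x) \<ominus>\<^bsub>Q\<^esub> (I +>\<^bsub>B\<^esub> y)"
  by (rule additive_zero_minus(3)[OF M.abelian_group_axioms quot_abelian_group _ _ assms])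
    (auto simp: quot_add)

text \<open>An additive map that kills \<open>I\<close> is constant on cosets, so evaluating it at
  the element picked by \<open>SOME\<close> loses nothing. All maps on quotients are computed
  through this: the lifts of homomorphisms, and the bracket and the anchor, which are defined by
  \<open>kahler_rep\<close>.\<close>

lemma additive_lift:
  assumes "abelian_group C"
    and cl: "\<And>x. x \<in> carrier B \<Longrightarrow> f x \<in> carrier C"
    and add: "\<And>x y. x \<in> carrier B \<Longrightarrow> y \<in> carrier B \<Longrightarrow> f (x \<oplus>\<^bsub>B\<^esub> y) = f x \<oplus>\<^bsub>C\<^esub> f y"
    and null: "\<And>x. x \<in> I \<Longrightarrow> f x = \<zero>\<^bsub>C\<^esub>"
    and x: "x \<in> carrier B"
  shows "f (SOME u. u \<in> I +>\<^bsub>B\<^esub> x) = f x"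
proof -
  interpret C: abelian_group C by fact
  let ?u = "SOME u. u \<in> I +>\<^bsub>B\<^esub> x"
  note u = quot_rep[OF x]
  have "?u \<ominus>\<^bsub>B\<^esub> x \<in> I" using u x coset_eq_iff by auto
  then have "f ?u \<ominus>\<^bsub>C\<^esub> f x = \<zero>\<^bsub>C\<^esub>"
    using additive_zero_minus(3)[OF M.abelian_group_axioms assms(1) cl add u(1) x] null by auto
  then show ?thesis using C.minus_eq_zero_iff cl u x by blast
qed

end

text \<open>The field \<open>one\<close> only has to be an identity modulo the ideal, since \<open>1\<^sub>A'\<close> is not an identity
  of \<open>U\<^sup>+\<close>.\<close>

locale quotient_algebra = nonunital_algebra K B + quotient_module K B I
  for K (structure) and B (structure) and I +
  assumes ideal_l: "\<lbrakk>x \<in> carrier B; y \<in> I\<rbrakk> \<Longrightarrow> x \<otimes>\<^bsub>B\<^esub> y \<in> I"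
    and ideal_r: "\<lbrakk>x \<in> carrier B; y \<in> I\<rbrakk> \<Longrightarrow> y \<otimes>\<^bsub>B\<^esub> x \<in> I"
    and one_in: "\<one>\<^bsub>B\<^esub> \<in> carrier B"
    and one_l: "x \<in> carrier B \<Longrightarrow> \<one>\<^bsub>B\<^esub> \<otimes>\<^bsub>B\<^esub> x \<ominus>\<^bsub>B\<^esub> x \<in> I"
    and one_r: "x \<in> carrier B \<Longrightarrow> x \<otimes>\<^bsub>B\<^esub> \<one>\<^bsub>B\<^esub> \<ominus>\<^bsub>B\<^esub> x \<in> I"
begin

lemma mult_minus_r:
  assumes "x \<in> carrier B" "y \<in> carrier B" "z \<in> carrier B"
  shows "x \<otimes>\<^bsub>B\<^esub> (y \<ominus>\<^bsub>B\<^esub> z) = x \<otimes>\<^bsub>B\<^esub> y \<ominus>\<^bsub>B\<^esub> x \<otimes>\<^bsub>B\<^esub> z"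
  by (rule additive_zero_minus(3)[OF M.abelian_group_axioms M.abelian_group_axioms _ _ assms(2,3)])
    (auto simp: mult_closed mult_r_distr assms)

lemma mult_minus_l:
  assumes "x \<in> carrier B" "y \<in> carrier B" "z \<in> carrier B"
  shows "(y \<ominus>\<^bsub>B\<^esub> z) \<otimes>\<^bsub>B\<^esub> x = y \<otimes>\<^bsub>B\<^esub> x \<ominus>\<^bsub>B\<^esub> z \<otimes>\<^bsub>B\<^esub> x"
  by (rule additive_zero_minus(3)[OF M.abelian_group_axioms M.abelian_group_axioms,
        of "\<lambda>y. y \<otimes>\<^bsub>B\<^esub> x", OF _ _ assms(2,3)])
    (auto simp: mult_closed mult_l_distr assms)

lemma quot_mult:
  assumes "x \<in> carrier B" "y \<in> carrier B"
  shows "(I +>\<^bsub>B\<^esub> x) \<otimes>\<^bsub>Q\<^esub> (I +>\<^bsub>B\<^esub> y) = I +>\<^bsub>B\<^esub> (x \<otimes>\<^bsub>B\<^esub> y)"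
proof -
  have "I +>\<^bsub>B\<^esub> (a \<otimes>\<^bsub>B\<^esub> b) = I +>\<^bsub>B\<^esub> (x \<otimes>\<^bsub>B\<^esub> y)" if a: "a \<in> I +>\<^bsub>B\<^esub> x" and b: "b \<in> I +>\<^bsub>B\<^esub> y" for a b
  proof -
    note ac = mem_coset[OF assms(1) a] and bc = mem_coset[OF assms(2) b]
    \<comment> \<open>\<open>ab - xy\<close> is the sum of \<open>(a - x) b\<close> and
      \<open>x (b - y)\<close>, so the coset of \<open>x b\<close> links the cosets of the two
      products.\<close>
    have "(a \<ominus>\<^bsub>B\<^esub> x) \<otimes>\<^bsub>B\<^esub> b \<in> I" "x \<otimes>\<^bsub>B\<^esub> (b \<ominus>\<^bsub>B\<^esub> y) \<in> I"
      using ac bc assms coset_eq_iff ideal_l ideal_r by auto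
    then have "a \<otimes>\<^bsub>B\<^esub> b \<ominus>\<^bsub>B\<^esub> x \<otimes>\<^bsub>B\<^esub> b \<in> I" "x \<otimes>\<^bsub>B\<^esub> b \<ominus>\<^bsub>B\<^esub> x \<otimes>\<^bsub>B\<^esub> y \<in> I"
      using ac bc assms by (auto simp: mult_minus_l mult_minus_r)
    then show ?thesis using ac bc assms coset_eq_iff mult_closed by metis
  qed
  then have "(\<Union>a\<in>I +>\<^bsub>B\<^esub> x. \<Union>b\<in>I +>\<^bsub>B\<^esub> y. I +>\<^bsub>B\<^esub> (a \<otimes>\<^bsub>B\<^esub> b)) =
      (\<Union>a\<in>I +>\<^bsub>B\<^esub> x. \<Union>b\<in>I +>\<^bsub>B\<^esub> y. I +>\<^bsub>B\<^esub> (x \<otimes>\<^bsub>B\<^esub> y))"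
    by (intro SUP_cong refl)
  also have "\<dots> = I +>\<^bsub>B\<^esub> (x \<otimes>\<^bsub>B\<^esub> y)"
    using I.a_rcos_self[OF assms(1)] I.a_rcos_self[OF assms(2)] by blast
  finally show ?thesis by (simp add: quot_alg_def FactRing_def rcoset_mult_def)
qed

lemma quot_one: "\<one>\<^bsub>Q\<^esub> = I +>\<^bsub>B\<^esub> \<one>\<^bsub>B\<^esub>"
  by (simp add: quot_alg_def FactRing_def)

lemma quot_assoc_algebra: "assoc_algebra K Q"
proof -
  interpret Q: module K Q by (rule quot_module)
  show ?thesis
  proof (unfold_locales; (elim quot_cases)?)
    show "\<one>\<^bsub>Q\<^esub> \<in> carrier Q" by (simp add: quot_one one_in)
  qed (simp_all add: quot_mult quot_add quot_smult quot_one one_in mult_closed mult_assoc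
         mult_l_distr mult_r_distr mult_smult_l mult_smult_r coset_eq_iff one_l one_r)
qed

lemma coset_hom: "(\<lambda>x. I +>\<^bsub>B\<^esub> x) \<in> algebra_hom K B Q"
  by (rule algebra_homI) (auto simp: quot_mult quot_add quot_smult quot_one)

lemma quot_lift:
  assumes C: "assoc_algebra K C" and f: "f \<in> algebra_hom K B C"
    and null: "\<And>x. x \<in> I \<Longrightarrow> f x = \<zero>\<^bsub>C\<^esub>"
  shows "\<exists>g\<in>algebra_hom K Q C. \<forall>x\<in>carrier B. g (I +>\<^bsub>B\<^esub> x) = f x"
proof
  interpret C: assoc_algebra K C by fact
  note fD = algebra_homD[OF f]
  let ?g = "\<lambda>X. f (SOME u. u \<in> X)"
  have g: "?g (I +>\<^bsub>B\<^esub> x) = f x" if "x \<in> carrier B" for x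
    by (rule additive_lift[OF C.M.abelian_group_axioms]) (use fD null that in auto)
  show "\<forall>x\<in>carrier B. ?g (I +>\<^bsub>B\<^esub> x) = f x" using g by blast
  show "?g \<in> algebra_hom K Q C"
  proof (rule algebra_homI; (elim quot_cases)?)
    show "?g \<one>\<^bsub>Q\<^esub> = \<one>\<^bsub>C\<^esub>" by (simp add: quot_one one_in g fD(4))
  qed (simp_all add: quot_mult quot_add quot_smult mult_closed g fD(1,2,3,5))
qed

end

text \<open>A ring ideal of a unital algebra is closed under scalars because \<open>c x\<close>
  equals \<open>(c 1) x\<close>. The two conditions on \<open>one\<close> hold trivially here, the
  differences being zero.\<close>

lemma (in assoc_algebra) quotient_by_Idl:
  assumes "S \<subseteq> carrier B"
  shows "quotient_algebra K B (Idl\<^bsub>B\<^esub> S)"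
proof -
  interpret I: ideal "Idl\<^bsub>B\<^esub> S" B using B.genideal_ideal[OF assms] .
  have "submodule (Idl\<^bsub>B\<^esub> S) K B"
  proof (rule submoduleI'[OF module_axioms])
    fix c x assume c: "c \<in> carrier K" and x: "x \<in> Idl\<^bsub>B\<^esub> S"
    have "(c \<odot>\<^bsub>B\<^esub> \<one>\<^bsub>B\<^esub>) \<otimes>\<^bsub>B\<^esub> x = c \<odot>\<^bsub>B\<^esub> x"
      using c x by (simp add: mult_smult_l unit_closed)
    then show "c \<odot>\<^bsub>B\<^esub> x \<in> Idl\<^bsub>B\<^esub> S" using c x I.I_l_closed[of x "c \<odot>\<^bsub>B\<^esub> \<one>\<^bsub>B\<^esub>"] by (simp add: unit_closed)
  qed (use I.a_subset in auto)
  then show ?thesis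
  proof (intro quotient_algebra.intro quotient_module.intro quotient_module_axioms.intro
      quotient_algebra_axioms.intro nonunital_algebra_axioms module_axioms)
    show "\<one>\<^bsub>B\<^esub> \<otimes>\<^bsub>B\<^esub> x \<ominus>\<^bsub>B\<^esub> x \<in> Idl\<^bsub>B\<^esub> S" "x \<otimes>\<^bsub>B\<^esub> \<one>\<^bsub>B\<^esub> \<ominus>\<^bsub>B\<^esub> x \<in> Idl\<^bsub>B\<^esub> S"
      if "x \<in> carrier B" for x
      using that M.minus_eq_zero_iff[of x x] by (simp_all add: unit_l unit_r)
  qed (simp_all add: I.I_l_closed I.I_r_closed unit_closed)
qed

lemma Idl_null:
  assumes "assoc_algebra K B" "assoc_algebra K C" "f \<in> algebra_hom K B C"
    and "S \<subseteq> carrier B" "\<And>x. x \<in> S \<Longrightarrow> f x = \<zero>\<^bsub>C\<^esub>" and "x \<in> Idl\<^bsub>B\<^esub> S"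
  shows "f x = \<zero>\<^bsub>C\<^esub>"
proof -
  interpret B: assoc_algebra K B by fact
  interpret C: assoc_algebra K C by fact
  interpret f: ring_hom_ring B C f
    using assms(3) by (intro ring_hom_ringI2) (auto simp: algebra_hom_def B.B.ring_axioms C.B.ring_axioms)
  have "S \<subseteq> a_kernel B C f"
    using assms(4,5) unfolding a_kernel_def' by blast
  then have "Idl\<^bsub>B\<^esub> S \<subseteq> a_kernel B C f"
    by (rule B.B.genideal_minimal[OF f.kernel_is_ideal])
  then show ?thesis using assms(6) unfolding a_kernel_def' by blast
qed

section \<open>Free modules and free algebras\<close>

lemma free_module_mem:
  "u \<in> carrier (free_module R X) \<longleftrightarrow>
     (\<forall>x. u x \<in> carrier R) \<and> finite (supp R u) \<and> supp R u \<subseteq> X"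
  by (simp add: free_module_def)

lemma free_module_value: "u \<in> carrier (free_module R X) \<Longrightarrow> u x \<in> carrier R"
  by (simp add: free_module_mem)

lemma free_module_ops:
  "\<zero>\<^bsub>free_module R X\<^esub> = (\<lambda>_. \<zero>\<^bsub>R\<^esub>)"
  "u \<oplus>\<^bsub>free_module R X\<^esub> v = (\<lambda>x. u x \<oplus>\<^bsub>R\<^esub> v x)"
  "c \<odot>\<^bsub>free_module R X\<^esub> u = (\<lambda>x. c \<otimes>\<^bsub>R\<^esub> u x)"
  by (simp_all add: free_module_def)

lemma free_module_memI:
  assumes "\<And>x. u x \<in> carrier R" "supp R u \<subseteq> S" "finite S" "S \<subseteq> X"
  shows "u \<in> carrier (free_module R X)"
  unfolding free_module_mem using assms finite_subset[OF assms(2,3)] subset_trans[OF assms(2,4)]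
  by simp

lemma free_module_module:
  assumes "cring R"
  shows "module R (free_module R X)"
proof -
  interpret R: cring R by fact
  let ?F = "free_module R X"
  note val = free_module_value[of _ R X]
  have add: "u \<oplus>\<^bsub>?F\<^esub> v \<in> carrier ?F" if "u \<in> carrier ?F" "v \<in> carrier ?F" for u v
    unfolding free_module_ops using that
    by (intro free_module_memI[of _ _ "supp R u \<union> supp R v"])
      (auto simp: free_module_mem supp_def)
  have smult: "c \<odot>\<^bsub>?F\<^esub> u \<in> carrier ?F" if "c \<in> carrier R" "u \<in> carrier ?F" for c u
    unfolding free_module_ops using that
    by (intro free_module_memI[of _ _ "supp R u"]) (auto simp: free_module_mem supp_def)
  have zero: "\<zero>\<^bsub>?F\<^esub> \<in> carrier ?F"
    by (simp add: free_module_mem free_module_ops supp_def)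
  show ?thesis
  proof (rule moduleI)
    show "abelian_group ?F"
    proof (rule abelian_groupI)
      show "\<exists>v\<in>carrier ?F. v \<oplus>\<^bsub>?F\<^esub> u = \<zero>\<^bsub>?F\<^esub>" if "u \<in> carrier ?F" for u
        using smult[of "\<ominus>\<^bsub>R\<^esub> \<one>\<^bsub>R\<^esub>" u] that
        by (intro bexI[of _ "(\<ominus>\<^bsub>R\<^esub> \<one>\<^bsub>R\<^esub>) \<odot>\<^bsub>?F\<^esub> u"])
          (simp_all add: free_module_ops val R.l_minus R.l_neg)
    qed (simp_all add: add[unfolded free_module_ops] zero[unfolded free_module_ops]
        free_module_ops val R.a_ac)
    show "cring R" by fact
  qed (simp_all add: smult[unfolded free_module_ops] free_module_ops val R.l_distr R.r_distr R.m_assoc)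
qed

lemma delta_closed:
  assumes "cring R" "x \<in> X"
  shows "delta R x \<in> carrier (free_module R X)"
proof -
  interpret R: cring R by fact
  show ?thesis
    by (rule free_module_memI[of _ _ "{x}"]) (use assms(2) in \<open>auto simp: delta_def supp_def\<close>)
qed

lemma free_module_induct [consumes 2, case_names zero single add]:
  assumes "cring R" and u: "u \<in> carrier (free_module R X)"
    and zero: "P \<zero>\<^bsub>free_module R X\<^esub>"
    and single: "\<And>c x. c \<in> carrier R \<Longrightarrow> x \<in> X \<Longrightarrow> P (c \<odot>\<^bsub>free_module R X\<^esub> delta R x)"
    and add: "\<And>u v. u \<in> carrier (free_module R X) \<Longrightarrow> v \<in> carrier (free_module R X) \<Longrightarrow>
      P u \<Longrightarrow> P v \<Longrightarrow> P (u \<oplus>\<^bsub>free_module R X\<^esub> v)"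
  shows "P u"
proof -
  interpret R: cring R by fact
  interpret F: module R "free_module R X" by (rule free_module_module[OF assms(1)])
  let ?F = "free_module R X"
  \<comment> \<open>The induction is on a finite set containing the support, not on the support
    itself, so that deleting one coordinate leaves an element covered by the induction
    hypothesis.\<close>
  have main: "\<forall>u\<in>carrier ?F. supp R u \<subseteq> S \<longrightarrow> P u" if "finite S" for S
    using that
  proof induction
    case empty
    have "u = \<zero>\<^bsub>?F\<^esub>" if "supp R u \<subseteq> {}" for u
      using that by (auto simp: supp_def free_module_ops)
    then show ?case using zero by blast
  next
    case (insert x S)
    show ?case
    proof (intro ballI impI)
      fix u assume u: "u \<in> carrier ?F" and s: "supp R u \<subseteq> insert x S"
      show "P u"
      proof (cases "x \<in> supp R u")
        case False
        then show ?thesis using insert.IH u s by auto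
      next
        case True
        then have x: "x \<in> X" using u by (auto simp: free_module_mem)
        \<comment> \<open>Both bounds matter: the support of \<open>u\<close> keeps the new element
          in the free module on \<open>X\<close>, and \<open>S\<close> makes the induction
          hypothesis applicable.\<close>
        have sv: "supp R (u(x := \<zero>\<^bsub>R\<^esub>)) \<subseteq> supp R u \<inter> S"
          using s by (auto simp: supp_def)
        then have v: "u(x := \<zero>\<^bsub>R\<^esub>) \<in> carrier ?F"
          using u by (intro free_module_memI[OF _ sv]) (auto simp: free_module_mem)
        then have "P (u(x := \<zero>\<^bsub>R\<^esub>))" using insert.IH sv by auto
        moreover have "P (u x \<odot>\<^bsub>?F\<^esub> delta R x)"
          by (rule single[OF free_module_value[OF u] x])
        ultimately have "P (u(x := \<zero>\<^bsub>R\<^esub>) \<oplus>\<^bsub>?F\<^esub> u x \<odot>\<^bsub>?F\<^esub> delta R x)"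
          using v u x delta_closed[OF assms(1) x]
          by (intro add F.smult_closed) (simp_all add: free_module_value)
        moreover have "u(x := \<zero>\<^bsub>R\<^esub>) \<oplus>\<^bsub>?F\<^esub> u x \<odot>\<^bsub>?F\<^esub> delta R x = u"
          using u by (auto simp: delta_def fun_eq_iff free_module_ops free_module_value)
        ultimately show ?thesis by simp
      qed
    qed
  qed
  from main[of "supp R u"] u show ?thesis by (simp add: free_module_mem)
qed

section \<open>Additive extension from the generators of a free module\<close>

definition lift_sum ::
  "('r, 'm) ring_scheme \<Rightarrow> ('c, 'l) ring_scheme \<Rightarrow> ('x \<Rightarrow> 'r \<Rightarrow> 'c) \<Rightarrow> ('x \<Rightarrow> 'r) \<Rightarrow> 'c"
  where "lift_sum R M t u = (\<Oplus>\<^bsub>M\<^esub>x\<in>supp R u. t x (u x))"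

text \<open>With \<open>t x c = c \<odot> b x\<close> the sum is the linear extension of
  \<open>b\<close>. The coefficient enters through an arbitrary additive function so that
  \<open>[a df, -]\<close>, which is not linear in \<open>a\<close>, fits as well. The target
  \<open>M\<close> is only an abelian group.\<close>

locale additive_family = R: cring R + M: abelian_group M
  for R (structure) and X and M (structure) and t +
  assumes t_closed: "\<lbrakk>x \<in> X; c \<in> carrier R\<rbrakk> \<Longrightarrow> t x c \<in> carrier M"
    and t_add: "\<lbrakk>x \<in> X; c \<in> carrier R; d \<in> carrier R\<rbrakk> \<Longrightarrow> t x (c \<oplus>\<^bsub>R\<^esub> d) = t x c \<oplus>\<^bsub>M\<^esub> t x d"
begin

lemma t_zero: "x \<in> X \<Longrightarrow> t x \<zero>\<^bsub>R\<^esub> = \<zero>\<^bsub>M\<^esub>"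
  by (rule additive_zero_minus(1)[OF R.abelian_group_axioms M.abelian_group_axioms])
    (auto simp: t_closed t_add)

text \<open>Coefficients may cancel in a sum of two elements, so supports do not add up; a common
  larger index set is what makes the sums comparable.\<close>

lemma lift_sum_superset:
  assumes "u \<in> carrier (free_module R X)" "finite S" "supp R u \<subseteq> S" "S \<subseteq> X"
  shows "lift_sum R M t u = (\<Oplus>\<^bsub>M\<^esub>x\<in>S. t x (u x))"
  unfolding lift_sum_def
  using assms by (intro M.add.finprod_mono_neutral_cong_left)
    (auto simp: supp_def t_zero free_module_value intro!: t_closed)

lemma lift_sum_closed:
  assumes "u \<in> carrier (free_module R X)"
  shows "lift_sum R M t u \<in> carrier M"
  unfolding lift_sum_def using assms by (intro M.finsum_closed) (auto simp: free_module_mem intro!: t_closed)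

lemma lift_sum_add:
  assumes u: "u \<in> carrier (free_module R X)" and v: "v \<in> carrier (free_module R X)"
  shows "lift_sum R M t (u \<oplus>\<^bsub>free_module R X\<^esub> v) = lift_sum R M t u \<oplus>\<^bsub>M\<^esub> lift_sum R M t v"
proof -
  interpret F: module R "free_module R X" by (rule free_module_module[OF R.is_cring])
  let ?S = "supp R u \<union> supp R v" and ?w = "u \<oplus>\<^bsub>free_module R X\<^esub> v"
  have S: "finite ?S" "?S \<subseteq> X" using u v by (auto simp: free_module_mem)
  have cl: "t x (u x) \<in> carrier M" "t x (v x) \<in> carrier M" if "x \<in> ?S" for x
    using that S u v by (auto simp: free_module_value intro!: t_closed)
  have sub: "supp R ?w \<subseteq> ?S" by (auto simp: supp_def free_module_ops)
  have "lift_sum R M t ?w = (\<Oplus>\<^bsub>M\<^esub>x\<in>?S. t x (?w x))"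
    using F.M.add.m_closed[OF u v] S sub by (intro lift_sum_superset) auto
  also have "\<dots> = (\<Oplus>\<^bsub>M\<^esub>x\<in>?S. t x (u x) \<oplus>\<^bsub>M\<^esub> t x (v x))"
    using u v S cl
    by (intro M.finsum_cong') (auto simp: free_module_ops free_module_value t_add)
  also have "\<dots> = (\<Oplus>\<^bsub>M\<^esub>x\<in>?S. t x (u x)) \<oplus>\<^bsub>M\<^esub> (\<Oplus>\<^bsub>M\<^esub>x\<in>?S. t x (v x))"
    using cl by (intro M.finsum_addf) auto
  also have "\<dots> = lift_sum R M t u \<oplus>\<^bsub>M\<^esub> lift_sum R M t v"
    using lift_sum_superset[OF u S(1) _ S(2)] lift_sum_superset[OF v S(1) _ S(2)] by simp
  finally show ?thesis .
qed

lemma lift_sum_zero: "lift_sum R M t \<zero>\<^bsub>free_module R X\<^esub> = \<zero>\<^bsub>M\<^esub>"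
  by (simp add: lift_sum_def supp_def free_module_ops)

lemma lift_sum_single:
  assumes x: "x \<in> X" and c: "c \<in> carrier R"
  shows "lift_sum R M t (c \<odot>\<^bsub>free_module R X\<^esub> delta R x) = t x c"
proof -
  interpret F: module R "free_module R X" by (rule free_module_module[OF R.is_cring])
  let ?w = "c \<odot>\<^bsub>free_module R X\<^esub> delta R x"
  have "?w \<in> carrier (free_module R X)"
    by (intro F.smult_closed c delta_closed x R.is_cring)
  moreover have "supp R ?w \<subseteq> {x}" using c by (auto simp: supp_def delta_def free_module_ops)
  ultimately have "lift_sum R M t ?w = (\<Oplus>\<^bsub>M\<^esub>y\<in>{x}. t y (?w y))"
    using x by (intro lift_sum_superset) auto
  also have "\<dots> = t x c" using x c by (simp add: delta_def t_closed free_module_ops)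
  finally show ?thesis .
qed

lemma lift_sum_delta: "x \<in> X \<Longrightarrow> lift_sum R M t (delta R x) = t x \<one>\<^bsub>R\<^esub>"
  using lift_sum_single[of x "\<one>\<^bsub>R\<^esub>"]
    module.smult_one[OF free_module_module[OF R.is_cring, of X] delta_closed[OF R.is_cring]]
  by simp

lemma lift_sum_minus:
  assumes "u \<in> carrier (free_module R X)" and "v \<in> carrier (free_module R X)"
  shows "lift_sum R M t (u \<ominus>\<^bsub>free_module R X\<^esub> v) = lift_sum R M t u \<ominus>\<^bsub>M\<^esub> lift_sum R M t v"
proof -
  interpret F: module R "free_module R X" by (rule free_module_module[OF R.is_cring])
  show ?thesis
    by (rule additive_zero_minus(3)[OF F.M.abelian_group_axioms M.abelian_group_axioms _ _ assms])
      (use lift_sum_closed lift_sum_add in blast)+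
qed

text \<open>Since \<open>M\<close> carries no action of \<open>R\<close>, the operator
  \<open>g\<close> plays the part of \<open>a\<close>. It will be a scalar multiplication,
  multiplication by \<open>a\<close> in \<open>A\<close>, or left multiplication by
  \<open>m a\<close> in \<open>C\<close>.\<close>

lemma lift_sum_smult:
  assumes u: "u \<in> carrier (free_module R X)" and a: "a \<in> carrier R"
    and g: "\<And>y. y \<in> carrier M \<Longrightarrow> g y \<in> carrier M"
      "\<And>y z. y \<in> carrier M \<Longrightarrow> z \<in> carrier M \<Longrightarrow> g (y \<oplus>\<^bsub>M\<^esub> z) = g y \<oplus>\<^bsub>M\<^esub> g z"
      "\<And>x c. x \<in> X \<Longrightarrow> c \<in> carrier R \<Longrightarrow> t x (a \<otimes>\<^bsub>R\<^esub> c) = g (t x c)"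
  shows "lift_sum R M t (a \<odot>\<^bsub>free_module R X\<^esub> u) = g (lift_sum R M t u)"
proof -
  interpret F: module R "free_module R X" by (rule free_module_module[OF R.is_cring])
  show ?thesis
  using R.is_cring u
  proof (induction u rule: free_module_induct)
    case zero
    have "g \<zero>\<^bsub>M\<^esub> = \<zero>\<^bsub>M\<^esub>"
      by (rule additive_zero_minus(1)[OF M.abelian_group_axioms M.abelian_group_axioms])
        (use g in auto)
    moreover have "a \<odot>\<^bsub>free_module R X\<^esub> \<zero>\<^bsub>free_module R X\<^esub> = \<zero>\<^bsub>free_module R X\<^esub>"
      using a by (rule F.smult_r_null)
    ultimately show ?case by (simp only: lift_sum_zero)
  next
    case (single c x)
    have "a \<odot>\<^bsub>free_module R X\<^esub> (c \<odot>\<^bsub>free_module R X\<^esub> delta R x) =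
        (a \<otimes>\<^bsub>R\<^esub> c) \<odot>\<^bsub>free_module R X\<^esub> delta R x"
      using F.smult_assoc1[OF a single(1) delta_closed[OF R.is_cring single(2)]] by (rule sym)
    then show ?case using single a g(3) by (simp only: lift_sum_single R.m_closed)
  next
    case (add u v)
    then show ?case
      using a g(2) F.smult_closed
      by (simp only: F.smult_r_distr lift_sum_add lift_sum_closed)
  qed
qed

end

section \<open>Convolution of functions on words\<close>

definition conv :: "('k, 'm) ring_scheme \<Rightarrow> ('x list \<Rightarrow> 'k) \<Rightarrow> ('x list \<Rightarrow> 'k) \<Rightarrow> 'x list \<Rightarrow> 'k"
  where "conv K p q w = (\<Oplus>\<^bsub>K\<^esub>i\<in>{..length w}. p (take i w) \<otimes>\<^bsub>K\<^esub> q (drop i w))"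

context cring
begin

lemma conv_closed:
  assumes "\<And>w. p w \<in> carrier R" "\<And>w. q w \<in> carrier R"
  shows "conv R p q w \<in> carrier R"
  unfolding conv_def using assms by (intro finsum_closed) auto

lemma conv_Nil:
  assumes "\<And>w. p w \<in> carrier R" "\<And>w. q w \<in> carrier R"
  shows "conv R p q [] = p [] \<otimes> q []"
  using assms by (simp add: conv_def)

text \<open>Peeling off the first letter makes the convolution recursive in the word, with a modified left
  factor; this replaces the reindexing of a double sum in the proof of associativity.\<close>

lemma conv_Cons:
  assumes "\<And>w. p w \<in> carrier R" "\<And>w. q w \<in> carrier R"
  shows "conv R p q (a # w) = conv R (\<lambda>v. p (a # v)) q w \<oplus> p [] \<otimes> q (a # w)"
  unfolding conv_def using assms by (simp add: finsum_Suc2 del: finsum_Suc)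

lemma conv_add_left:
  assumes "\<And>w. p w \<in> carrier R" "\<And>w. p' w \<in> carrier R" "\<And>w. q w \<in> carrier R"
  shows "conv R (\<lambda>v. p v \<oplus> p' v) q w = conv R p q w \<oplus> conv R p' q w"
  unfolding conv_def using assms by (simp add: l_distr finsum_addf Pi_def)

lemma conv_add_right:
  assumes "\<And>w. p w \<in> carrier R" "\<And>w. q w \<in> carrier R" "\<And>w. q' w \<in> carrier R"
  shows "conv R p (\<lambda>v. q v \<oplus> q' v) w = conv R p q w \<oplus> conv R p q' w"
  unfolding conv_def using assms by (simp add: r_distr finsum_addf Pi_def)

lemma conv_smult_left:
  assumes "\<And>w. p w \<in> carrier R" "\<And>w. q w \<in> carrier R" "c \<in> carrier R"
  shows "conv R (\<lambda>v. c \<otimes> p v) q w = c \<otimes> conv R p q w"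
  unfolding conv_def using assms by (simp add: m_assoc finsum_rdistr Pi_def)

lemma conv_smult_right:
  assumes "\<And>w. p w \<in> carrier R" "\<And>w. q w \<in> carrier R" "c \<in> carrier R"
  shows "conv R p (\<lambda>v. c \<otimes> q v) w = c \<otimes> conv R p q w"
  unfolding conv_def using assms by (simp add: m_lcomm finsum_rdistr Pi_def)

lemma conv_zero_left:
  assumes "\<And>w. q w \<in> carrier R"
  shows "conv R (\<lambda>_. \<zero>) q w = \<zero>"
  unfolding conv_def using assms by (simp add: finsum_zero)

text \<open>The left factor has to vary in the induction, since peeling off the letter
  \<open>a\<close> replaces \<open>p\<close> by \<open>\<lambda>v. p (a # v)\<close>. The splitting
  with empty left part contributes only the scalar \<open>p []\<close>, which can be pulled out of
  the remaining convolution.\<close>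

lemma conv_assoc:
  assumes p: "\<And>w. p w \<in> carrier R" and q: "\<And>w. q w \<in> carrier R" and r: "\<And>w. r w \<in> carrier R"
  shows "conv R (conv R p q) r w = conv R p (conv R q r) w"
  using p
proof (induction w arbitrary: p)
  case Nil
  then show ?case using q r by (simp add: conv_Nil conv_closed m_assoc)
next
  case (Cons a w)
  have "conv R (conv R p q) r (a # w) =
      conv R (\<lambda>v. conv R (\<lambda>v. p (a # v)) q v \<oplus> p [] \<otimes> q (a # v)) r w \<oplus> (p [] \<otimes> q []) \<otimes> r (a # w)"
    using Cons.prems q r by (simp add: conv_Cons conv_Nil conv_closed)
  also have "\<dots> = (conv R (conv R (\<lambda>v. p (a # v)) q) r w \<oplus> p [] \<otimes> conv R (\<lambda>v. q (a # v)) r w)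
      \<oplus> (p [] \<otimes> q []) \<otimes> r (a # w)"
    using Cons.prems q r by (simp add: conv_add_left conv_smult_left conv_closed)
  also have "conv R (conv R (\<lambda>v. p (a # v)) q) r w = conv R (\<lambda>v. p (a # v)) (conv R q r) w"
    by (rule Cons.IH) (rule Cons.prems)
  also have "(conv R (\<lambda>v. p (a # v)) (conv R q r) w \<oplus> p [] \<otimes> conv R (\<lambda>v. q (a # v)) r w)
      \<oplus> (p [] \<otimes> q []) \<otimes> r (a # w) =
      conv R (\<lambda>v. p (a # v)) (conv R q r) w
      \<oplus> p [] \<otimes> (conv R (\<lambda>v. q (a # v)) r w \<oplus> q [] \<otimes> r (a # w))"
    using Cons.prems q r by (simp add: r_distr a_assoc m_assoc conv_closed)
  also have "\<dots> = conv R p (conv R q r) (a # w)"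
    using Cons.prems q r by (simp add: conv_Cons conv_closed)
  finally show ?case .
qed

lemma delta_in_carrier [simp]: "delta R x y \<in> carrier R"
  by (simp add: delta_def)

lemma conv_one_left:
  assumes "\<And>w. q w \<in> carrier R"
  shows "conv R (delta R []) q w = q w"
proof (cases w)
  case Nil
  then show ?thesis using assms by (simp add: conv_Nil) (simp add: delta_def)
next
  case (Cons a v)
  have "conv R (\<lambda>v. delta R [] (a # v)) q v = \<zero>"
    using conv_zero_left[of q v] assms by (simp add: delta_def)
  then show ?thesis using assms Cons by (simp add: conv_Cons) (simp add: delta_def)
qed

lemma conv_one_right:
  assumes "\<And>w. p w \<in> carrier R"
  shows "conv R p (delta R []) w = p w"
  using assms
proof (induction w arbitrary: p)
  case Nil
  then show ?case by (simp add: conv_Nil) (simp add: delta_def)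
next
  case (Cons a w)
  then show ?case by (simp add: conv_Cons) (simp add: delta_def)
qed

text \<open>Peeling a letter off a point mass at \<open>a # v\<close> leaves the point mass at
  \<open>v\<close> if the letter is \<open>a\<close>, and zero otherwise.\<close>

lemma conv_delta: "conv R (delta R v) (delta R w) u = delta R (v @ w) u"
proof (induction v arbitrary: u)
  case Nil
  then show ?case by (simp add: conv_one_left)
next
  case (Cons a v)
  show ?case
  proof (cases u)
    case Nil
    then show ?thesis by (simp add: conv_Nil) (simp add: delta_def)
  next
    case u: (Cons b u')
    have "conv R (\<lambda>t. delta R (a # v) (b # t)) (delta R w) u' = delta R (a # v @ w) (b # u')"
    proof (cases "a = b")
      case True
      then have "(\<lambda>t. delta R (a # v) (b # t)) = delta R v" by (auto simp: delta_def)
      then show ?thesis using Cons.IH[of u'] True by (simp add: delta_def)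
    next
      case False
      then have "(\<lambda>t. delta R (a # v) (b # t)) = (\<lambda>_. \<zero>)" by (auto simp: delta_def)
      then show ?thesis using False by (simp add: conv_zero_left) (simp add: delta_def)
    qed
    moreover have "delta R (a # v) [] = \<zero>" by (simp add: delta_def)
    ultimately show ?thesis by (simp add: u conv_Cons)
  qed
qed

end

section \<open>The free algebra on a set\<close>

lemma free_algebra_simps:
  "carrier (free_algebra K X) = carrier (free_module K (lists X))"
  "\<zero>\<^bsub>free_algebra K X\<^esub> = \<zero>\<^bsub>free_module K (lists X)\<^esub>"
  "\<one>\<^bsub>free_algebra K X\<^esub> = delta K []"
  "add (free_algebra K X) = add (free_module K (lists X))"
  "smult (free_algebra K X) = smult (free_module K (lists X))"
  "p \<otimes>\<^bsub>free_algebra K X\<^esub> q = conv K p q"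
  by (simp_all add: free_algebra_def conv_def fun_eq_iff)

lemma free_algebra_assoc_algebra:
  assumes "cring K"
  shows "assoc_algebra K (free_algebra K X)"
proof -
  interpret K: cring K by fact
  interpret module K "free_algebra K X"
    unfolding free_algebra_def by (intro module_update free_module_module assms)
  let ?C = "carrier (free_module K (lists X))"
  have mult: "conv K p q \<in> ?C" if p: "p \<in> ?C" and q: "q \<in> ?C" for p q
  proof -
    \<comment> \<open>Only concatenations of a word from one support with a word from the other can
      receive a nonzero coefficient. This gives both the finiteness of the support and its
      containment in the words over \<open>X\<close>.\<close>
    have sub: "supp K (conv K p q) \<subseteq> (\<lambda>(u, v). u @ v) ` (supp K p \<times> supp K q)"
    proof
      fix w assume w: "w \<in> supp K (conv K p q)"
      have "\<exists>i\<le>length w. p (take i w) \<otimes>\<^bsub>K\<^esub> q (drop i w) \<noteq> \<zero>\<^bsub>K\<^esub>"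
      proof (rule ccontr)
        assume "\<not> ?thesis"
        then have "conv K p q w = (\<Oplus>\<^bsub>K\<^esub>i\<in>{..length w}. \<zero>\<^bsub>K\<^esub>)"
          unfolding conv_def by (intro K.finsum_cong') auto
        then show False using w by (simp add: supp_def K.finsum_zero)
      qed
      then obtain i where "p (take i w) \<otimes>\<^bsub>K\<^esub> q (drop i w) \<noteq> \<zero>\<^bsub>K\<^esub>" by blast
      then have "take i w \<in> supp K p" "drop i w \<in> supp K q"
        using p q by (auto simp: supp_def free_module_value)
      then have "(take i w, drop i w) \<in> supp K p \<times> supp K q" by simp
      then show "w \<in> (\<lambda>(u, v). u @ v) ` (supp K p \<times> supp K q)"
        by (rule rev_image_eqI) simp
    qed
    moreover have "(\<lambda>(u, v). u @ v) ` (supp K p \<times> supp K q) \<subseteq> lists X"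
      using p q by (auto simp: free_module_mem subset_iff in_lists_conv_set)
    ultimately show ?thesis
      using p q K.conv_closed[of p q]
      by (intro free_module_memI[OF _ sub]) (simp_all add: free_module_mem)
  qed
  have one: "delta K [] \<in> ?C" by (rule delta_closed[OF assms]) simp
  note val = free_module_value[of _ K "lists X"]
  show ?thesis
    by (intro assoc_algebra.intro nonunital_algebra.intro nonunital_algebra_axioms.intro
        assoc_algebra_axioms.intro module_axioms)
      (simp_all add: free_algebra_simps mult one free_module_ops val fun_eq_iff K.conv_assoc
        K.conv_add_left K.conv_add_right K.conv_smult_left K.conv_smult_right
        K.conv_one_left K.conv_one_right)
qed

section \<open>Equality of additive and biadditive maps on free modules\<close>

lemma additive_ext:
  assumes R: "cring R" and M: "abelian_group M"
    and f: "\<And>u. u \<in> carrier (free_module R X) \<Longrightarrow> f u \<in> carrier M"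
      "\<And>u v. u \<in> carrier (free_module R X) \<Longrightarrow> v \<in> carrier (free_module R X) \<Longrightarrow>
        f (u \<oplus>\<^bsub>free_module R X\<^esub> v) = f u \<oplus>\<^bsub>M\<^esub> f v"
    and g: "\<And>u. u \<in> carrier (free_module R X) \<Longrightarrow> g u \<in> carrier M"
      "\<And>u v. u \<in> carrier (free_module R X) \<Longrightarrow> v \<in> carrier (free_module R X) \<Longrightarrow>
        g (u \<oplus>\<^bsub>free_module R X\<^esub> v) = g u \<oplus>\<^bsub>M\<^esub> g v"
    and single: "\<And>c x. c \<in> carrier R \<Longrightarrow> x \<in> X \<Longrightarrow>
      f (c \<odot>\<^bsub>free_module R X\<^esub> delta R x) = g (c \<odot>\<^bsub>free_module R X\<^esub> delta R x)"
    and u: "u \<in> carrier (free_module R X)"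
  shows "f u = g u"
proof -
  interpret F: module R "free_module R X" by (rule free_module_module[OF R])
  have f0: "f \<zero>\<^bsub>free_module R X\<^esub> = \<zero>\<^bsub>M\<^esub>"
    by (rule additive_zero_minus(1)[OF F.M.abelian_group_axioms M, of f]) (simp_all add: f)
  have g0: "g \<zero>\<^bsub>free_module R X\<^esub> = \<zero>\<^bsub>M\<^esub>"
    by (rule additive_zero_minus(1)[OF F.M.abelian_group_axioms M, of g]) (simp_all add: g)
  from R u show ?thesis
    by (induction u rule: free_module_induct) (simp_all add: f0 g0 single f(2) g(2))
qed

text \<open>\<open>additive_ext\<close> is used twice: in the first argument with the second fixed,
  which reduces to a multiple of one generator on the left, and then in the second argument against
  that multiple.\<close>

lemma biadditive_ext:
  fixes R (structure)
  defines "F \<equiv> \<lambda>X. free_module R X"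
  assumes R: "cring R" and M: "abelian_group M"
    and f: "\<And>u v. u \<in> carrier (F X) \<Longrightarrow> v \<in> carrier (F Y) \<Longrightarrow> f u v \<in> carrier M"
      "\<And>u u' v. u \<in> carrier (F X) \<Longrightarrow> u' \<in> carrier (F X) \<Longrightarrow> v \<in> carrier (F Y) \<Longrightarrow>
        f (u \<oplus>\<^bsub>F X\<^esub> u') v = f u v \<oplus>\<^bsub>M\<^esub> f u' v"
      "\<And>u v v'. u \<in> carrier (F X) \<Longrightarrow> v \<in> carrier (F Y) \<Longrightarrow> v' \<in> carrier (F Y) \<Longrightarrow>
        f u (v \<oplus>\<^bsub>F Y\<^esub> v') = f u v \<oplus>\<^bsub>M\<^esub> f u v'"
    and g: "\<And>u v. u \<in> carrier (F X) \<Longrightarrow> v \<in> carrier (F Y) \<Longrightarrow> g u v \<in> carrier M"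
      "\<And>u u' v. u \<in> carrier (F X) \<Longrightarrow> u' \<in> carrier (F X) \<Longrightarrow> v \<in> carrier (F Y) \<Longrightarrow>
        g (u \<oplus>\<^bsub>F X\<^esub> u') v = g u v \<oplus>\<^bsub>M\<^esub> g u' v"
      "\<And>u v v'. u \<in> carrier (F X) \<Longrightarrow> v \<in> carrier (F Y) \<Longrightarrow> v' \<in> carrier (F Y) \<Longrightarrow>
        g u (v \<oplus>\<^bsub>F Y\<^esub> v') = g u v \<oplus>\<^bsub>M\<^esub> g u v'"
    and single: "\<And>a x b y. a \<in> carrier R \<Longrightarrow> x \<in> X \<Longrightarrow> b \<in> carrier R \<Longrightarrow> y \<in> Y \<Longrightarrow>
      f (a \<odot>\<^bsub>F X\<^esub> delta R x) (b \<odot>\<^bsub>F Y\<^esub> delta R y) = g (a \<odot>\<^bsub>F X\<^esub> delta R x) (b \<odot>\<^bsub>F Y\<^esub> delta R y)"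
    and u: "u \<in> carrier (F X)" and v: "v \<in> carrier (F Y)"
  shows "f u v = g u v"
proof (rule additive_ext[OF R M, of X "\<lambda>u. f u v" "\<lambda>u. g u v"])
  fix a x assume a: "a \<in> carrier R" and x: "x \<in> X"
  let ?w = "a \<odot>\<^bsub>free_module R X\<^esub> delta R x"
  have w: "?w \<in> carrier (free_module R X)"
    using module.smult_closed[OF free_module_module[OF R] a delta_closed[OF R x]] .
  show "f ?w v = g ?w v"
    by (rule additive_ext[OF R M, of Y "\<lambda>v. f ?w v" "\<lambda>v. g ?w v"])
      (use w f g single a x v in \<open>simp_all add: F_def\<close>)
qed (use f g u v in \<open>simp_all add: F_def\<close>)

section \<open>Universal property of the free algebra\<close>

lemma free_algebra_induct [consumes 2, case_names zero single add]:
  fixes K (structure)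
  defines "F \<equiv> \<lambda>X. free_algebra K X"
  assumes "cring K" and "u \<in> carrier (F X)"
    and "P \<zero>\<^bsub>F X\<^esub>"
    and "\<And>c w. c \<in> carrier K \<Longrightarrow> w \<in> lists X \<Longrightarrow> P (c \<odot>\<^bsub>F X\<^esub> delta K w)"
    and "\<And>u v. u \<in> carrier (F X) \<Longrightarrow> v \<in> carrier (F X) \<Longrightarrow> P u \<Longrightarrow> P v \<Longrightarrow> P (u \<oplus>\<^bsub>F X\<^esub> v)"
  shows "P u"
  using assms(2,3)[unfolded F_def free_algebra_simps]
  by (induction u rule: free_module_induct) (use assms(4-) in \<open>simp_all add: F_def free_algebra_simps\<close>)

lemma free_algebra_delta:
  assumes "cring K" "w \<in> lists X"
  shows "delta K w \<in> carrier (free_algebra K X)"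
  using delta_closed[OF assms] by (simp add: free_algebra_simps)

lemma free_algebra_delta_Cons:
  assumes "cring K"
  shows "delta K (x # w) = delta K [x] \<otimes>\<^bsub>free_algebra K X\<^esub> delta K w"
  using cring.conv_delta[OF assms, of "[x]" w] by (simp add: free_algebra_simps fun_eq_iff)

lemma free_algebra_hom_eq:
  assumes K: "cring K" and C: "assoc_algebra K C"
    and f: "f \<in> algebra_hom K (free_algebra K X) C" and g: "g \<in> algebra_hom K (free_algebra K X) C"
    and eq: "\<And>x. x \<in> X \<Longrightarrow> f (delta K [x]) = g (delta K [x])"
    and u: "u \<in> carrier (free_algebra K X)"
  shows "f u = g u"
proof -
  let ?F = "free_algebra K X"
  interpret F: assoc_algebra K ?F by (rule free_algebra_assoc_algebra[OF K])
  interpret C: assoc_algebra K C by fact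
  note f = algebra_homD[OF f] and g = algebra_homD[OF g]
  have words: "f (delta K w) = g (delta K w)" if "w \<in> lists X" for w
    using that
  proof induction
    case Nil
    then show ?case using f(4) g(4) by (simp add: free_algebra_simps)
  next
    case (Cons x w)
    then show ?case
      using free_algebra_delta[OF K, of "[x]" X] free_algebra_delta[OF K, of w X]
      by (subst (1 2) free_algebra_delta_Cons[OF K, where X = X]) (simp add: f(3) g(3) eq)
  qed
  have "f \<zero>\<^bsub>?F\<^esub> = \<zero>\<^bsub>C\<^esub>" "g \<zero>\<^bsub>?F\<^esub> = \<zero>\<^bsub>C\<^esub>"
    using additive_zero_minus(1)[OF F.M.abelian_group_axioms C.M.abelian_group_axioms] f(1,2) g(1,2)
    by blast+
  with K u show ?thesis
    by (induction u rule: free_algebra_induct)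
      (simp_all add: f(2,5) g(2,5) words free_algebra_delta[OF K])
qed

text \<open>The linear extension of \<open>W\<close>, the product of the values of
  \<open>\<phi>\<close> along a word. Multiplicativity is \<open>W_append\<close> on pairs of words;
  it spreads first to arbitrary right factors with a word on the left, then to arbitrary left
  factors.\<close>

lemma free_algebra_lift:
  assumes K: "cring K" and C: "assoc_algebra K C"
    and \<phi>: "\<And>x. x \<in> X \<Longrightarrow> \<phi> x \<in> carrier C"
  shows "\<exists>f\<in>algebra_hom K (free_algebra K X) C. \<forall>x\<in>X. f (delta K [x]) = \<phi> x"
proof -
  let ?F = "free_algebra K X"
  interpret F: assoc_algebra K ?F by (rule free_algebra_assoc_algebra[OF K])
  interpret C: assoc_algebra K C by fact
  define W where "W = (\<lambda>w. foldr (\<lambda>x y. \<phi> x \<otimes>\<^bsub>C\<^esub> y) w \<one>\<^bsub>C\<^esub>)"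
  have W [simp]: "W w \<in> carrier C" if "w \<in> lists X" for w
    using that by induction (simp_all add: W_def \<phi>)
  have W_append: "W (v @ w) = W v \<otimes>\<^bsub>C\<^esub> W w" if "v \<in> lists X" "w \<in> lists X" for v w
    using that
  proof induction
    case Nil
    then show ?case using W[of w] by (simp add: W_def)
  next
    case (Cons x v)
    then show ?case using W[of w] W[of v] \<phi>[of x] by (simp add: W_def C.B.m_assoc)
  qed
  interpret T: additive_family K "lists X" C "\<lambda>w c. c \<odot>\<^bsub>C\<^esub> W w"
    by (intro additive_family.intro additive_family_axioms.intro K C.M.abelian_group_axioms)
      (simp_all add: C.smult_l_distr)
  define f where "f = lift_sum K C (\<lambda>w c. c \<odot>\<^bsub>C\<^esub> W w)"
  have cl: "f u \<in> carrier C" if "u \<in> carrier ?F" for u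
    using T.lift_sum_closed that by (simp add: f_def free_algebra_simps)
  have f_add: "f (u \<oplus>\<^bsub>?F\<^esub> v) = f u \<oplus>\<^bsub>C\<^esub> f v" if "u \<in> carrier ?F" "v \<in> carrier ?F" for u v
    using T.lift_sum_add that by (simp add: f_def free_algebra_simps)
  have single: "f (c \<odot>\<^bsub>?F\<^esub> delta K w) = c \<odot>\<^bsub>C\<^esub> W w" if "c \<in> carrier K" "w \<in> lists X" for c w
    using T.lift_sum_single that by (simp add: f_def free_algebra_simps)
  have smult: "f (c \<odot>\<^bsub>?F\<^esub> u) = c \<odot>\<^bsub>C\<^esub> f u" if "c \<in> carrier K" "u \<in> carrier ?F" for c u
    using T.lift_sum_smult[of u c "\<lambda>y. c \<odot>\<^bsub>C\<^esub> y"] that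
    by (simp add: f_def free_algebra_simps C.smult_r_distr C.smult_assoc1)
  have delta: "f (delta K w) = W w" if "w \<in> lists X" for w
    using single[of "\<one>\<^bsub>K\<^esub>" w] free_algebra_delta[OF K that] that by simp
  have f_zero: "f \<zero>\<^bsub>?F\<^esub> = \<zero>\<^bsub>C\<^esub>"
    using T.lift_sum_zero by (simp add: f_def free_algebra_simps)
  have mult_delta: "f (delta K v \<otimes>\<^bsub>?F\<^esub> u) = f (delta K v) \<otimes>\<^bsub>C\<^esub> f u"
    if v: "v \<in> lists X" and u: "u \<in> carrier ?F" for u v
    using K u
  proof (induction u rule: free_algebra_induct)
    case zero
    then show ?case using v by (simp add: free_algebra_delta[OF K] f_zero cl)
  next
    case (single c w)
    have "delta K v \<otimes>\<^bsub>?F\<^esub> delta K w = delta K (v @ w)"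
      using cring.conv_delta[OF K, of v w] by (simp add: free_algebra_simps fun_eq_iff)
    then show ?case using v single
      by (simp add: free_algebra_delta[OF K] F.mult_smult_r C.mult_smult_r smult delta W_append)
  next
    case (add u' v')
    then show ?case using v
      by (simp add: free_algebra_delta[OF K] F.B.r_distr C.B.r_distr f_add cl)
  qed
  have mult: "f (v \<otimes>\<^bsub>?F\<^esub> u) = f v \<otimes>\<^bsub>C\<^esub> f u" if v: "v \<in> carrier ?F" and u: "u \<in> carrier ?F" for u v
    using K v
  proof (induction v rule: free_algebra_induct)
    case zero
    then show ?case using u by (simp add: f_zero cl)
  next
    case (single c w)
    then show ?case using u
      by (simp add: free_algebra_delta[OF K] F.mult_smult_l C.mult_smult_l smult mult_delta cl)
  next
    case (add u' v')
    then show ?case using u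
      by (simp add: F.B.l_distr C.B.l_distr f_add cl)
  qed
  have one: "f \<one>\<^bsub>?F\<^esub> = \<one>\<^bsub>C\<^esub>"
    using delta[of "[]"] by (simp add: free_algebra_simps W_def)
  have "f \<in> algebra_hom K ?F C"
    by (intro algebra_homI cl f_add mult one smult)
  moreover have "f (delta K [x]) = \<phi> x" if "x \<in> X" for x
    using delta[of "[x]"] \<phi>[OF that] that by (simp add: W_def)
  ultimately show ?thesis by blast
qed

section \<open>The Poisson enveloping algebra\<close>

text \<open>Both enveloping algebras instantiate this locale, so each can serve as the target
  \<open>C\<close> of a homomorphism lifted from the other.\<close>

locale poisson_rep = poisson_algebra K A + C: assoc_algebra K C
  for K (structure) and A (structure) and C (structure) and m and h +
  assumes m_cl: "a \<in> carrier A \<Longrightarrow> m a \<in> carrier C"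
    and h_cl: "a \<in> carrier A \<Longrightarrow> h a \<in> carrier C"
    and m_add: "\<lbrakk>x \<in> carrier A; y \<in> carrier A\<rbrakk> \<Longrightarrow> m (x \<oplus>\<^bsub>A\<^esub> y) = m x \<oplus>\<^bsub>C\<^esub> m y"
    and m_smult: "\<lbrakk>c \<in> carrier K; x \<in> carrier A\<rbrakk> \<Longrightarrow> m (c \<odot>\<^bsub>A\<^esub> x) = c \<odot>\<^bsub>C\<^esub> m x"
    and h_add: "\<lbrakk>x \<in> carrier A; y \<in> carrier A\<rbrakk> \<Longrightarrow> h (x \<oplus>\<^bsub>A\<^esub> y) = h x \<oplus>\<^bsub>C\<^esub> h y"
    and h_smult: "\<lbrakk>c \<in> carrier K; x \<in> carrier A\<rbrakk> \<Longrightarrow> h (c \<odot>\<^bsub>A\<^esub> x) = c \<odot>\<^bsub>C\<^esub> h x"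
    and m_mult: "\<lbrakk>x \<in> carrier A; y \<in> carrier A\<rbrakk> \<Longrightarrow> m (x \<otimes>\<^bsub>A\<^esub> y) = m x \<otimes>\<^bsub>C\<^esub> m y"
    and h_lie: "\<lbrakk>x \<in> carrier A; y \<in> carrier A\<rbrakk> \<Longrightarrow>
          h (lie A x y) = h x \<otimes>\<^bsub>C\<^esub> h y \<ominus>\<^bsub>C\<^esub> h y \<otimes>\<^bsub>C\<^esub> h x"
    and h_mult: "\<lbrakk>x \<in> carrier A; y \<in> carrier A\<rbrakk> \<Longrightarrow>
          h (x \<otimes>\<^bsub>A\<^esub> y) = m y \<otimes>\<^bsub>C\<^esub> h x \<oplus>\<^bsub>C\<^esub> m x \<otimes>\<^bsub>C\<^esub> h y"
    and m_lie: "\<lbrakk>x \<in> carrier A; y \<in> carrier A\<rbrakk> \<Longrightarrow>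
          m (lie A x y) = h x \<otimes>\<^bsub>C\<^esub> m y \<ominus>\<^bsub>C\<^esub> m y \<otimes>\<^bsub>C\<^esub> h x"
    and m_one: "m \<one>\<^bsub>A\<^esub> = \<one>\<^bsub>C\<^esub>"

lemma poisson_rels_intros:
  fixes K (structure) and A (structure)
  defines "F \<equiv> poisson_free K A" and "M \<equiv> \<lambda>a. delta K [MGen a]" and "H \<equiv> \<lambda>a. delta K [HGen a]"
  shows
    "\<lbrakk>x \<in> carrier A; y \<in> carrier A\<rbrakk> \<Longrightarrow> M (x \<oplus>\<^bsub>A\<^esub> y) \<ominus>\<^bsub>F\<^esub> (M x \<oplus>\<^bsub>F\<^esub> M y) \<in> poisson_rels K A"
    "\<lbrakk>c \<in> carrier K; x \<in> carrier A\<rbrakk> \<Longrightarrow> M (c \<odot>\<^bsub>A\<^esub> x) \<ominus>\<^bsub>F\<^esub> c \<odot>\<^bsub>F\<^esub> M x \<in> poisson_rels K A"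
    "\<lbrakk>x \<in> carrier A; y \<in> carrier A\<rbrakk> \<Longrightarrow> H (x \<oplus>\<^bsub>A\<^esub> y) \<ominus>\<^bsub>F\<^esub> (H x \<oplus>\<^bsub>F\<^esub> H y) \<in> poisson_rels K A"
    "\<lbrakk>c \<in> carrier K; x \<in> carrier A\<rbrakk> \<Longrightarrow> H (c \<odot>\<^bsub>A\<^esub> x) \<ominus>\<^bsub>F\<^esub> c \<odot>\<^bsub>F\<^esub> H x \<in> poisson_rels K A"
    "\<lbrakk>x \<in> carrier A; y \<in> carrier A\<rbrakk> \<Longrightarrow> M (x \<otimes>\<^bsub>A\<^esub> y) \<ominus>\<^bsub>F\<^esub> M x \<otimes>\<^bsub>F\<^esub> M y \<in> poisson_rels K A"
    "\<lbrakk>x \<in> carrier A; y \<in> carrier A\<rbrakk> \<Longrightarrow>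
       H (lie A x y) \<ominus>\<^bsub>F\<^esub> (H x \<otimes>\<^bsub>F\<^esub> H y \<ominus>\<^bsub>F\<^esub> H y \<otimes>\<^bsub>F\<^esub> H x) \<in> poisson_rels K A"
    "\<lbrakk>x \<in> carrier A; y \<in> carrier A\<rbrakk> \<Longrightarrow>
       H (x \<otimes>\<^bsub>A\<^esub> y) \<ominus>\<^bsub>F\<^esub> (M y \<otimes>\<^bsub>F\<^esub> H x \<oplus>\<^bsub>F\<^esub> M x \<otimes>\<^bsub>F\<^esub> H y) \<in> poisson_rels K A"
    "\<lbrakk>x \<in> carrier A; y \<in> carrier A\<rbrakk> \<Longrightarrow>
       M (lie A x y) \<ominus>\<^bsub>F\<^esub> (H x \<otimes>\<^bsub>F\<^esub> M y \<ominus>\<^bsub>F\<^esub> M y \<otimes>\<^bsub>F\<^esub> H x) \<in> poisson_rels K A"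
    "M \<one>\<^bsub>A\<^esub> \<ominus>\<^bsub>F\<^esub> \<one>\<^bsub>F\<^esub> \<in> poisson_rels K A"
  unfolding poisson_rels_def Let_def F_def M_def H_def by blast+

context poisson_algebra
begin

declare lie_closed [simp]

lemma poisson_free_algebra: "assoc_algebra K (poisson_free K A)"
  unfolding poisson_free_def by (rule free_algebra_assoc_algebra[OF R_cring])

lemma poisson_gens:
  assumes "a \<in> carrier A"
  shows "delta K [MGen a] \<in> carrier (poisson_free K A)"
    "delta K [HGen a] \<in> carrier (poisson_free K A)"
  unfolding poisson_free_def using assms by (auto intro!: free_algebra_delta R_cring)

lemma poisson_rels_carrier: "poisson_rels K A \<subseteq> carrier (poisson_free K A)"
proof
  interpret F: assoc_algebra K "poisson_free K A" by (rule poisson_free_algebra)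
  fix r assume "r \<in> poisson_rels K A"
  then show "r \<in> carrier (poisson_free K A)"
    unfolding poisson_rels_def Let_def
    by (elim UnE CollectE exE conjE singletonE) (simp_all add: poisson_gens)
qed

lemma poisson_quotient: "quotient_algebra K (poisson_free K A) (poisson_ideal K A)"
proof -
  interpret F: assoc_algebra K "poisson_free K A" by (rule poisson_free_algebra)
  show ?thesis unfolding poisson_ideal_def by (rule F.quotient_by_Idl[OF poisson_rels_carrier])
qed

lemma poisson_env_hom:
  "(\<lambda>u. poisson_ideal K A +>\<^bsub>poisson_free K A\<^esub> u)
     \<in> algebra_hom K (poisson_free K A) (poisson_env K A)"
  unfolding poisson_env_def by (rule quotient_algebra.coset_hom[OF poisson_quotient])

lemma poisson_env_assoc_algebra: "assoc_algebra K (poisson_env K A)"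
  unfolding poisson_env_def by (rule quotient_algebra.quot_assoc_algebra[OF poisson_quotient])

lemma poisson_env_rep: "poisson_rep K A (poisson_env K A) (m_map K A) (h_map K A)"
proof -
  let ?F = "poisson_free K A" and ?I = "poisson_ideal K A" and ?E = "poisson_env K A"
  interpret F: assoc_algebra K ?F by (rule poisson_free_algebra)
  interpret Q: quotient_algebra K ?F ?I by (rule poisson_quotient)
  interpret E: assoc_algebra K ?E by (rule poisson_env_assoc_algebra)
  note hom = algebra_homD[OF poisson_env_hom]
  have fm: "?I +>\<^bsub>?F\<^esub> (u \<ominus>\<^bsub>?F\<^esub> v) = (?I +>\<^bsub>?F\<^esub> u) \<ominus>\<^bsub>?E\<^esub> (?I +>\<^bsub>?F\<^esub> v)"
    if "u \<in> carrier ?F" "v \<in> carrier ?F" for u v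
    using Q.quot_minus[OF that] by (simp add: poisson_env_def)
  have rel: "?I +>\<^bsub>?F\<^esub> u = ?I +>\<^bsub>?F\<^esub> v"
    if "u \<ominus>\<^bsub>?F\<^esub> v \<in> poisson_rels K A" "u \<in> carrier ?F" "v \<in> carrier ?F" for u v
    using that Q.coset_eq_iff F.B.genideal_self[OF poisson_rels_carrier]
    by (auto simp: poisson_ideal_def)
  \<comment> \<open>Every relation is written as a difference \<open>u \<ominus> v\<close>; through
    \<open>rel\<close> each membership statement turns into an equality of cosets, one for each
    equation of \<open>poisson_rep\<close>.\<close>
  note R = poisson_rels_intros[THEN rel]
  show ?thesis
    unfolding m_map_def h_map_def
    by (intro poisson_rep.intro poisson_rep_axioms.intro poisson_algebra_axioms
        poisson_env_assoc_algebra)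
      (simp_all add: R poisson_gens hom fm)
qed

lemma poisson_env_lift:
  assumes "poisson_rep K A C m h"
  shows "\<exists>f\<in>algebra_hom K (poisson_env K A) C.
    \<forall>a\<in>carrier A. f (m_map K A a) = m a \<and> f (h_map K A a) = h a"
proof -
  let ?F = "poisson_free K A" and ?I = "poisson_ideal K A"
  interpret C: poisson_rep K A C m h by fact
  interpret F: assoc_algebra K ?F by (rule poisson_free_algebra)
  interpret Q: quotient_algebra K ?F ?I by (rule poisson_quotient)
  let ?\<phi> = "\<lambda>x. case x of MGen a \<Rightarrow> m a | HGen a \<Rightarrow> h a"
  have "\<exists>f\<in>algebra_hom K ?F C.
      \<forall>x\<in>MGen ` carrier A \<union> HGen ` carrier A. f (delta K [x]) = ?\<phi> x"
    unfolding poisson_free_def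
    by (rule free_algebra_lift[OF R_cring C.C.assoc_algebra_axioms])
      (auto simp: C.m_cl C.h_cl)
  then obtain f where f: "f \<in> algebra_hom K ?F C"
    and fx: "\<And>a. a \<in> carrier A \<Longrightarrow> f (delta K [MGen a]) = m a"
      "\<And>a. a \<in> carrier A \<Longrightarrow> f (delta K [HGen a]) = h a"
    by auto
  note fD = algebra_homD[OF f]
  have fm: "f (u \<ominus>\<^bsub>?F\<^esub> v) = f u \<ominus>\<^bsub>C\<^esub> f v" if "u \<in> carrier ?F" "v \<in> carrier ?F" for u v
    by (rule additive_zero_minus(3)[OF F.M.abelian_group_axioms C.C.M.abelian_group_axioms])
      (use fD(1,2) that in auto)
  have "f r = \<zero>\<^bsub>C\<^esub>" if "r \<in> poisson_rels K A" for r
    using that unfolding poisson_rels_def Let_def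
    by (elim UnE CollectE exE conjE singletonE)
      (simp_all add: poisson_gens fm fD fx C.m_cl C.h_cl C.m_add C.m_smult C.h_add C.h_smult C.m_mult
        C.h_lie C.h_mult C.m_lie C.m_one C.C.M.minus_eq_zero_iff)
  then have "f x = \<zero>\<^bsub>C\<^esub>" if "x \<in> ?I" for x
    using Idl_null[OF F.assoc_algebra_axioms C.C.assoc_algebra_axioms f poisson_rels_carrier] that
    unfolding poisson_ideal_def by blast
  then obtain g where "g \<in> algebra_hom K (poisson_env K A) C"
    "\<And>x. x \<in> carrier ?F \<Longrightarrow> g (?I +>\<^bsub>?F\<^esub> x) = f x"
    using Q.quot_lift[OF C.C.assoc_algebra_axioms f] unfolding poisson_env_def by blast
  then show ?thesis
    unfolding m_map_def h_map_def using fx poisson_gens by (intro bexI[of _ g]) auto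
qed

lemma poisson_env_hom_eq:
  assumes C: "assoc_algebra K C"
    and f: "f \<in> algebra_hom K (poisson_env K A) C" and g: "g \<in> algebra_hom K (poisson_env K A) C"
    and eq: "\<And>a. a \<in> carrier A \<Longrightarrow> f (m_map K A a) = g (m_map K A a)"
      "\<And>a. a \<in> carrier A \<Longrightarrow> f (h_map K A a) = g (h_map K A a)"
    and x: "x \<in> carrier (poisson_env K A)"
  shows "f x = g x"
proof -
  let ?F = "poisson_free K A" and ?I = "poisson_ideal K A"
  interpret Q: quotient_algebra K ?F ?I by (rule poisson_quotient)
  have "f (?I +>\<^bsub>?F\<^esub> u) = g (?I +>\<^bsub>?F\<^esub> u)" if "u \<in> carrier ?F" for u
  proof (rule free_algebra_hom_eq[OF R_cring C])
    show "(\<lambda>u. f (?I +>\<^bsub>?F\<^esub> u)) \<in> algebra_hom K (free_algebra K (MGen ` carrier A \<union> HGen ` carrier A)) C"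
      "(\<lambda>u. g (?I +>\<^bsub>?F\<^esub> u)) \<in> algebra_hom K (free_algebra K (MGen ` carrier A \<union> HGen ` carrier A)) C"
      using algebra_hom_comp[OF poisson_env_hom f] algebra_hom_comp[OF poisson_env_hom g]
      by (simp_all add: poisson_free_def)
  qed (use that eq in \<open>auto simp: poisson_free_def m_map_def h_map_def\<close>)
  then show ?thesis using x by (auto simp: poisson_env_def Q.quot_carrier)
qed

end

section \<open>The bracket of Kaehler differentials\<close>

context poisson_algebra
begin

lemma lie_skew:
  assumes "x \<in> carrier A" "y \<in> carrier A"
  shows "lie A x y = \<ominus>\<^bsub>A\<^esub> lie A y x"
proof -
  have "\<zero>\<^bsub>A\<^esub> = lie A (x \<oplus>\<^bsub>A\<^esub> y) (x \<oplus>\<^bsub>A\<^esub> y)" using assms by (simp add: lie_self)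
  also have "\<dots> = lie A x y \<oplus>\<^bsub>A\<^esub> lie A y x"
    using assms by (simp add: lie_add_left lie_add_right lie_self[of x] lie_self[of y] a_comm)
  finally show ?thesis using assms by (simp add: minus_equality)
qed

lemma leibniz_left:
  assumes "x \<in> carrier A" "y \<in> carrier A" "z \<in> carrier A"
  shows "lie A (x \<otimes>\<^bsub>A\<^esub> y) z = lie A x z \<otimes>\<^bsub>A\<^esub> y \<oplus>\<^bsub>A\<^esub> x \<otimes>\<^bsub>A\<^esub> lie A y z"
  using assms lie_skew[of "x \<otimes>\<^bsub>A\<^esub> y" z] lie_skew[of x z] lie_skew[of y z]
  by (simp add: leibniz l_minus r_minus minus_add)

lemma lie_one [simp]:
  assumes "x \<in> carrier A"
  shows "lie A x \<one>\<^bsub>A\<^esub> = \<zero>\<^bsub>A\<^esub>"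
proof -
  have "lie A x \<one>\<^bsub>A\<^esub> = lie A x \<one>\<^bsub>A\<^esub> \<oplus>\<^bsub>A\<^esub> lie A x \<one>\<^bsub>A\<^esub>"
    using leibniz[of x "\<one>\<^bsub>A\<^esub>" "\<one>\<^bsub>A\<^esub>"] assms by simp
  then show ?thesis using assms by (metis lie_closed one_closed M.add.r_cancel_one')
qed

lemma scalar_mult:
  assumes "c \<in> carrier K" "x \<in> carrier A"
  shows "(c \<odot>\<^bsub>A\<^esub> \<one>\<^bsub>A\<^esub>) \<otimes>\<^bsub>A\<^esub> x = c \<odot>\<^bsub>A\<^esub> x"
  using assms by (simp add: smult_assoc2)

lemma lie_scalar [simp]: "c \<in> carrier K \<Longrightarrow> x \<in> carrier A \<Longrightarrow> lie A x (c \<odot>\<^bsub>A\<^esub> \<one>\<^bsub>A\<^esub>) = \<zero>\<^bsub>A\<^esub>"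
  by (simp add: lie_smult_right)

abbreviation \<F>\<^sub>A where "\<F>\<^sub>A \<equiv> free_module A (carrier A)"
abbreviation \<N> where "\<N> \<equiv> kahler_sub K A"
abbreviation \<Omega> where "\<Omega> \<equiv> kahler_module K A"
abbreviation \<dd> where "\<dd> \<equiv> kahler_d K A"

lemma kahler_free_module: "module A \<F>\<^sub>A"
  by (rule free_module_module[OF M_cring])

lemma delta_kahler_free [simp]: "f \<in> carrier A \<Longrightarrow> delta A f \<in> carrier \<F>\<^sub>A"
  by (rule delta_closed[OF M_cring])

lemma kahler_rels_intros:
  "\<lbrakk>f \<in> carrier A; g \<in> carrier A\<rbrakk> \<Longrightarrow>
     delta A (f \<oplus>\<^bsub>A\<^esub> g) \<ominus>\<^bsub>\<F>\<^sub>A\<^esub> (delta A f \<oplus>\<^bsub>\<F>\<^sub>A\<^esub> delta A g) \<in> kahler_rels K A"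
  "\<lbrakk>c \<in> carrier K; f \<in> carrier A\<rbrakk> \<Longrightarrow>
     delta A (c \<odot>\<^bsub>A\<^esub> f) \<ominus>\<^bsub>\<F>\<^sub>A\<^esub> (c \<odot>\<^bsub>A\<^esub> \<one>\<^bsub>A\<^esub>) \<odot>\<^bsub>\<F>\<^sub>A\<^esub> delta A f \<in> kahler_rels K A"
  "\<lbrakk>f \<in> carrier A; g \<in> carrier A\<rbrakk> \<Longrightarrow>
     delta A (f \<otimes>\<^bsub>A\<^esub> g) \<ominus>\<^bsub>\<F>\<^sub>A\<^esub> (f \<odot>\<^bsub>\<F>\<^sub>A\<^esub> delta A g \<oplus>\<^bsub>\<F>\<^sub>A\<^esub> g \<odot>\<^bsub>\<F>\<^sub>A\<^esub> delta A f) \<in> kahler_rels K A"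
  unfolding kahler_rels_def Let_def by blast+

lemma kahler_rels_cases:
  assumes "r \<in> kahler_rels K A"
  obtains f g where "f \<in> carrier A" "g \<in> carrier A"
      "r = delta A (f \<oplus>\<^bsub>A\<^esub> g) \<ominus>\<^bsub>\<F>\<^sub>A\<^esub> (delta A f \<oplus>\<^bsub>\<F>\<^sub>A\<^esub> delta A g)"
  | c f where "c \<in> carrier K" "f \<in> carrier A"
      "r = delta A (c \<odot>\<^bsub>A\<^esub> f) \<ominus>\<^bsub>\<F>\<^sub>A\<^esub> (c \<odot>\<^bsub>A\<^esub> \<one>\<^bsub>A\<^esub>) \<odot>\<^bsub>\<F>\<^sub>A\<^esub> delta A f"
  | f g where "f \<in> carrier A" "g \<in> carrier A"
      "r = delta A (f \<otimes>\<^bsub>A\<^esub> g) \<ominus>\<^bsub>\<F>\<^sub>A\<^esub> (f \<odot>\<^bsub>\<F>\<^sub>A\<^esub> delta A g \<oplus>\<^bsub>\<F>\<^sub>A\<^esub> g \<odot>\<^bsub>\<F>\<^sub>A\<^esub> delta A f)"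
  using assms unfolding kahler_rels_def Let_def by blast

lemma kahler_rels_carrier: "kahler_rels K A \<subseteq> carrier \<F>\<^sub>A"
proof
  interpret F: module A \<F>\<^sub>A by (rule kahler_free_module)
  fix r assume "r \<in> kahler_rels K A"
  then show "r \<in> carrier \<F>\<^sub>A"
    by (cases rule: kahler_rels_cases) simp_all
qed

lemma kahler_sub_submodule: "submodule \<N> A \<F>\<^sub>A"
  unfolding kahler_sub_def hull_def
  using module.carrier_is_submodule[OF kahler_free_module] kahler_rels_carrier
  by (intro submodule_Inter[OF kahler_free_module]) auto

lemma kahler_quotient: "quotient_module A \<F>\<^sub>A \<N>"
  by (intro quotient_module.intro quotient_module_axioms.intro kahler_free_module kahler_sub_submodule)

text \<open>The elements of \<open>\<N>\<close> that \<open>f\<close> kills form a submodule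
  containing the relations, hence exhaust \<open>\<N>\<close>. Stability under \<open>a\<close> is
  asked only at elements of \<open>\<N>\<close> that \<open>f\<close> already kills. This is weaker
  than \<open>A\<close>-linearity, which the bracket does not have.\<close>

lemma kahler_sub_null:
  assumes M: "abelian_group M"
    and f: "\<And>u. u \<in> carrier \<F>\<^sub>A \<Longrightarrow> f u \<in> carrier M"
      "\<And>u v. u \<in> carrier \<F>\<^sub>A \<Longrightarrow> v \<in> carrier \<F>\<^sub>A \<Longrightarrow> f (u \<oplus>\<^bsub>\<F>\<^sub>A\<^esub> v) = f u \<oplus>\<^bsub>M\<^esub> f v"
      "\<And>a u. a \<in> carrier A \<Longrightarrow> u \<in> \<N> \<Longrightarrow> f u = \<zero>\<^bsub>M\<^esub> \<Longrightarrow> f (a \<odot>\<^bsub>\<F>\<^sub>A\<^esub> u) = \<zero>\<^bsub>M\<^esub>"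
    and rel: "\<And>r. r \<in> kahler_rels K A \<Longrightarrow> f r = \<zero>\<^bsub>M\<^esub>"
    and u: "u \<in> \<N>"
  shows "f u = \<zero>\<^bsub>M\<^esub>"
proof -
  interpret F: module A \<F>\<^sub>A by (rule kahler_free_module)
  interpret M: abelian_group M by fact
  note D = submoduleD[OF kahler_free_module kahler_sub_submodule]
  let ?S = "{u \<in> \<N>. f u = \<zero>\<^bsub>M\<^esub>}"
  have "f \<zero>\<^bsub>\<F>\<^sub>A\<^esub> = \<zero>\<^bsub>M\<^esub>"
    by (rule additive_zero_minus(1)[OF F.M.abelian_group_axioms M, of f]) (simp_all add: f(1,2))
  have "submodule ?S A \<F>\<^sub>A"
  proof (rule submoduleI'[OF kahler_free_module])
    show "\<zero>\<^bsub>\<F>\<^sub>A\<^esub> \<in> ?S"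
      using \<open>f \<zero>\<^bsub>\<F>\<^sub>A\<^esub> = \<zero>\<^bsub>M\<^esub>\<close> D(2) by simp
  next
    show "x \<oplus>\<^bsub>\<F>\<^sub>A\<^esub> y \<in> ?S" if "x \<in> ?S" "y \<in> ?S" for x y
      using that D(1,3) f(2)[of x y] by auto
  qed (use D f(3) in auto)
  moreover have "kahler_rels K A \<subseteq> ?S"
    using rel hull_inc[of _ "kahler_rels K A"] unfolding kahler_sub_def by blast
  ultimately have "\<N> \<subseteq> ?S"
    unfolding kahler_sub_def by (rule hull_minimal[rotated])
  then show ?thesis using u by blast
qed

end

section \<open>Classes of differentials and the bracket of \<open>a df\<close> with
  \<open>b dg\<close>\<close>

context poisson_algebra
begin

interpretation F: quotient_module A \<F>\<^sub>A \<N> by (rule kahler_quotient)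

lemma kahler_module_module: "module A \<Omega>"
  unfolding kahler_module_def by (rule F.quot_module)

interpretation Om: module A \<Omega> by (rule kahler_module_module)

abbreviation cls where "cls u \<equiv> \<N> +>\<^bsub>\<F>\<^sub>A\<^esub> u"

lemma cls_ops:
  "u \<in> carrier \<F>\<^sub>A \<Longrightarrow> cls u \<in> carrier \<Omega>"
  "u \<in> carrier \<F>\<^sub>A \<Longrightarrow> v \<in> carrier \<F>\<^sub>A \<Longrightarrow> cls (u \<oplus>\<^bsub>\<F>\<^sub>A\<^esub> v) = cls u \<oplus>\<^bsub>\<Omega>\<^esub> cls v"
  "a \<in> carrier A \<Longrightarrow> u \<in> carrier \<F>\<^sub>A \<Longrightarrow> cls (a \<odot>\<^bsub>\<F>\<^sub>A\<^esub> u) = a \<odot>\<^bsub>\<Omega>\<^esub> cls u"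
  "\<zero>\<^bsub>\<Omega>\<^esub> = \<N>"
  by (simp_all add: kahler_module_def F.quot_add F.quot_smult F.quot_zero)

lemma kahler_module_cases:
  assumes "X \<in> carrier \<Omega>"
  obtains u where "u \<in> carrier \<F>\<^sub>A" "X = cls u"
  using assms F.quot_carrier unfolding kahler_module_def by blast

lemma cls_rel:
  assumes "u \<ominus>\<^bsub>\<F>\<^sub>A\<^esub> v \<in> kahler_rels K A" "u \<in> carrier \<F>\<^sub>A" "v \<in> carrier \<F>\<^sub>A"
  shows "cls u = cls v"
  using F.coset_eq_iff[OF assms(2,3)] hull_inc[OF assms(1)] unfolding kahler_sub_def by blast

lemma d_ops:
  "f \<in> carrier A \<Longrightarrow> \<dd> f \<in> carrier \<Omega>"
  "f \<in> carrier A \<Longrightarrow> g \<in> carrier A \<Longrightarrow> \<dd> (f \<oplus>\<^bsub>A\<^esub> g) = \<dd> f \<oplus>\<^bsub>\<Omega>\<^esub> \<dd> g"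
  "c \<in> carrier K \<Longrightarrow> f \<in> carrier A \<Longrightarrow> \<dd> (c \<odot>\<^bsub>A\<^esub> f) = (c \<odot>\<^bsub>A\<^esub> \<one>\<^bsub>A\<^esub>) \<odot>\<^bsub>\<Omega>\<^esub> \<dd> f"
  "f \<in> carrier A \<Longrightarrow> g \<in> carrier A \<Longrightarrow> \<dd> (f \<otimes>\<^bsub>A\<^esub> g) = f \<odot>\<^bsub>\<Omega>\<^esub> \<dd> g \<oplus>\<^bsub>\<Omega>\<^esub> g \<odot>\<^bsub>\<Omega>\<^esub> \<dd> f"
  unfolding kahler_d_def by (simp_all add: kahler_rels_intros[THEN cls_rel] cls_ops(1-3))

lemma d_minus: "f \<in> carrier A \<Longrightarrow> \<dd> (\<ominus>\<^bsub>A\<^esub> f) = \<ominus>\<^bsub>\<Omega>\<^esub> \<dd> f"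
  using additive_zero_minus(2)[OF M.abelian_group_axioms Om.M.abelian_group_axioms d_ops(1,2)] .

text \<open>The value of \<open>[a df, b dg]\<close>. Each generator precedes its coefficient, so
  that \<open>basic_bracket f a\<close> is directly a family \<open>t\<close> for
  \<open>lift_sum\<close> in the second argument.\<close>

definition basic_bracket where
  "basic_bracket f a g b = (a \<otimes>\<^bsub>A\<^esub> b) \<odot>\<^bsub>\<Omega>\<^esub> \<dd> (lie A f g) \<oplus>\<^bsub>\<Omega>\<^esub> (a \<otimes>\<^bsub>A\<^esub> lie A f b) \<odot>\<^bsub>\<Omega>\<^esub> \<dd> g
     \<ominus>\<^bsub>\<Omega>\<^esub> (b \<otimes>\<^bsub>A\<^esub> lie A g a) \<odot>\<^bsub>\<Omega>\<^esub> \<dd> f"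

lemma basic_bracket_closed:
  "\<lbrakk>f \<in> carrier A; a \<in> carrier A; g \<in> carrier A; b \<in> carrier A\<rbrakk> \<Longrightarrow> basic_bracket f a g b \<in> carrier \<Omega>"
  by (simp add: basic_bracket_def d_ops)

lemma basic_bracket_add_right:
  "\<lbrakk>f \<in> carrier A; a \<in> carrier A; g \<in> carrier A; b \<in> carrier A; b' \<in> carrier A\<rbrakk> \<Longrightarrow>
     basic_bracket f a g (b \<oplus>\<^bsub>A\<^esub> b') = basic_bracket f a g b \<oplus>\<^bsub>\<Omega>\<^esub> basic_bracket f a g b'"
  by (simp add: basic_bracket_def d_ops lie_add_right r_distr l_distr Om.smult_l_distr Om.M.minus_eq
      Om.M.minus_add Om.M.a_ac)

text \<open>Antisymmetry halves the work: what is proved about one argument carries over to the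
  other, here for additivity and later for the vanishing on \<open>\<N>\<close>.\<close>

lemma basic_bracket_skew:
  "\<lbrakk>f \<in> carrier A; a \<in> carrier A; g \<in> carrier A; b \<in> carrier A\<rbrakk> \<Longrightarrow>
     basic_bracket f a g b = \<ominus>\<^bsub>\<Omega>\<^esub> basic_bracket g b f a"
  using lie_skew[of g f]
  by (simp add: basic_bracket_def d_ops d_minus Om.M.minus_eq Om.M.minus_add Om.smult_r_minus m_comm[of b a]
      Om.M.a_ac)

lemma basic_bracket_add_left:
  "\<lbrakk>f \<in> carrier A; a \<in> carrier A; a' \<in> carrier A; g \<in> carrier A; b \<in> carrier A\<rbrakk> \<Longrightarrow>
     basic_bracket f (a \<oplus>\<^bsub>A\<^esub> a') g b = basic_bracket f a g b \<oplus>\<^bsub>\<Omega>\<^esub> basic_bracket f a' g b"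
  by (simp add: basic_bracket_skew[of f _ g b] basic_bracket_add_right basic_bracket_closed Om.M.minus_add)

text \<open>The product rule splits \<open>{g, ac}\<close> in the last term of the bracket. The
  extra summand is \<open>b {g,a}\<close>, the anchor of \<open>b dg\<close> applied to
  \<open>a\<close>, times \<open>c df\<close>.\<close>

lemma basic_bracket_smult:
  "\<lbrakk>f \<in> carrier A; a \<in> carrier A; c \<in> carrier A; g \<in> carrier A; b \<in> carrier A\<rbrakk> \<Longrightarrow>
     basic_bracket f (a \<otimes>\<^bsub>A\<^esub> c) g b =
       a \<odot>\<^bsub>\<Omega>\<^esub> basic_bracket f c g b \<ominus>\<^bsub>\<Omega>\<^esub> (b \<otimes>\<^bsub>A\<^esub> lie A g a) \<odot>\<^bsub>\<Omega>\<^esub> (c \<odot>\<^bsub>\<Omega>\<^esub> \<dd> f)"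
  by (simp add: basic_bracket_def d_ops leibniz r_distr Om.smult_l_distr Om.smult_r_distr
      Om.smult_assoc1[symmetric] Om.smult_r_minus Om.M.minus_eq Om.M.minus_add m_ac Om.M.a_ac)

text \<open>\<open>d {fg,h}\<close> expands into four terms. Two give the leading terms of the
  brackets on the right; the other two, \<open>b {f,h} dg\<close> and \<open>b {g,h} df\<close>, are
  by antisymmetry their last terms, while the last term on the left vanishes because
  \<open>{h,1} = 0\<close>. With the next two lemmas this covers the three kinds of Kaehler
  relations paired with \<open>b dh\<close>.\<close>

lemma basic_bracket_mult:
  "\<lbrakk>f \<in> carrier A; g \<in> carrier A; h \<in> carrier A; b \<in> carrier A\<rbrakk> \<Longrightarrow>
     basic_bracket (f \<otimes>\<^bsub>A\<^esub> g) \<one>\<^bsub>A\<^esub> h b = basic_bracket g f h b \<oplus>\<^bsub>\<Omega>\<^esub> basic_bracket f g h b"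
  using lie_skew[of h f] lie_skew[of h g]
  by (simp add: basic_bracket_def d_ops leibniz_left r_minus Om.smult_l_distr Om.smult_r_distr
      Om.smult_assoc1[symmetric] Om.smult_l_minus Om.M.minus_eq m_ac Om.M.a_ac)

lemma basic_bracket_scalar:
  "\<lbrakk>c \<in> carrier K; f \<in> carrier A; h \<in> carrier A; b \<in> carrier A\<rbrakk> \<Longrightarrow>
     basic_bracket (c \<odot>\<^bsub>A\<^esub> f) \<one>\<^bsub>A\<^esub> h b = basic_bracket f (c \<odot>\<^bsub>A\<^esub> \<one>\<^bsub>A\<^esub>) h b"
  using scalar_mult[of c "lie A f b"]
  by (simp add: basic_bracket_def d_ops(1) d_ops(3) lie_smult_left Om.smult_assoc1[symmetric]
      m_comm[of _ "c \<odot>\<^bsub>A\<^esub> \<one>\<^bsub>A\<^esub>"] del: scalar_mult)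

lemma basic_bracket_sum:
  "\<lbrakk>f \<in> carrier A; g \<in> carrier A; h \<in> carrier A; b \<in> carrier A\<rbrakk> \<Longrightarrow>
     basic_bracket (f \<oplus>\<^bsub>A\<^esub> g) \<one>\<^bsub>A\<^esub> h b = basic_bracket f \<one>\<^bsub>A\<^esub> h b \<oplus>\<^bsub>\<Omega>\<^esub> basic_bracket g \<one>\<^bsub>A\<^esub> h b"
  by (simp add: basic_bracket_def d_ops lie_add_left Om.smult_l_distr Om.smult_r_distr Om.M.minus_eq
      Om.M.a_ac)

lemma basic_bracket_one:
  "\<lbrakk>f \<in> carrier A; g \<in> carrier A\<rbrakk> \<Longrightarrow> basic_bracket f \<one>\<^bsub>A\<^esub> g \<one>\<^bsub>A\<^esub> = \<dd> (lie A f g)"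
  by (simp add: basic_bracket_def d_ops Om.M.minus_zero_right)

section \<open>The bracket extended to the free module\<close>

lemma basic_bracket_family:
  assumes "f \<in> carrier A" "a \<in> carrier A"
  shows "additive_family A (carrier A) \<Omega> (basic_bracket f a)"
  by (intro additive_family.intro additive_family_axioms.intro M_cring Om.M.abelian_group_axioms)
    (simp_all add: basic_bracket_closed basic_bracket_add_right assms)

text \<open>The inner sum is itself additive in the outer coefficient \<open>a\<close>, which is
  checked on multiples of generators in \<open>v\<close>. Hence the double sum of
  \<open>kahler_lie\<close> is an additive extension nested in another one.\<close>

lemma basic_bracket_sum_family:
  assumes "v \<in> carrier \<F>\<^sub>A"
  shows "additive_family A (carrier A) \<Omega> (\<lambda>f a. lift_sum A \<Omega> (basic_bracket f a) v)"
proof (intro additive_family.intro additive_family_axioms.intro M_cring Om.M.abelian_group_axioms)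
  note I = additive_family.lift_sum_closed[OF basic_bracket_family]
    additive_family.lift_sum_add[OF basic_bracket_family]
    additive_family.lift_sum_single[OF basic_bracket_family]
  fix f a assume fa: "f \<in> carrier A" "a \<in> carrier A"
  show "lift_sum A \<Omega> (basic_bracket f a) v \<in> carrier \<Omega>" by (rule I(1)[OF fa assms])
  fix a' assume a': "a' \<in> carrier A"
  show "lift_sum A \<Omega> (basic_bracket f (a \<oplus>\<^bsub>A\<^esub> a')) v =
      lift_sum A \<Omega> (basic_bracket f a) v \<oplus>\<^bsub>\<Omega>\<^esub> lift_sum A \<Omega> (basic_bracket f a') v"
    by (rule additive_ext[OF M_cring Om.M.abelian_group_axioms _ _ _ _ _ assms])
      (use fa a' in \<open>simp_all add: I basic_bracket_add_left Om.M.a_ac\<close>)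
qed

text \<open>The double sum of \<open>kahler_lie\<close> for arbitrary expressions \<open>u\<close>
  and \<open>v\<close> in place of chosen representatives, nested in the same order so that the two
  agree by unfolding.\<close>

definition bracket where
  "bracket u v = lift_sum A \<Omega> (\<lambda>f a. lift_sum A \<Omega> (basic_bracket f a) v) u"

lemma kahler_lie_bracket: "kahler_lie K A X Y = bracket (kahler_rep X) (kahler_rep Y)"
  by (simp add: kahler_lie_def Let_def bracket_def lift_sum_def basic_bracket_def)

lemma bracket_closed: "u \<in> carrier \<F>\<^sub>A \<Longrightarrow> v \<in> carrier \<F>\<^sub>A \<Longrightarrow> bracket u v \<in> carrier \<Omega>"
  unfolding bracket_def by (rule additive_family.lift_sum_closed[OF basic_bracket_sum_family])

lemma bracket_add_left:
  "u \<in> carrier \<F>\<^sub>A \<Longrightarrow> u' \<in> carrier \<F>\<^sub>A \<Longrightarrow> v \<in> carrier \<F>\<^sub>A \<Longrightarrow>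
     bracket (u \<oplus>\<^bsub>\<F>\<^sub>A\<^esub> u') v = bracket u v \<oplus>\<^bsub>\<Omega>\<^esub> bracket u' v"
  unfolding bracket_def by (rule additive_family.lift_sum_add[OF basic_bracket_sum_family])

lemma bracket_single_left:
  "f \<in> carrier A \<Longrightarrow> a \<in> carrier A \<Longrightarrow> v \<in> carrier \<F>\<^sub>A \<Longrightarrow>
     bracket (a \<odot>\<^bsub>\<F>\<^sub>A\<^esub> delta A f) v = lift_sum A \<Omega> (basic_bracket f a) v"
  unfolding bracket_def by (rule additive_family.lift_sum_single[OF basic_bracket_sum_family])

lemma bracket_single:
  "f \<in> carrier A \<Longrightarrow> a \<in> carrier A \<Longrightarrow> g \<in> carrier A \<Longrightarrow> b \<in> carrier A \<Longrightarrow>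
     bracket (a \<odot>\<^bsub>\<F>\<^sub>A\<^esub> delta A f) (b \<odot>\<^bsub>\<F>\<^sub>A\<^esub> delta A g) = basic_bracket f a g b"
  by (simp add: bracket_single_left additive_family.lift_sum_single[OF basic_bracket_family])

lemma bracket_delta:
  assumes "f \<in> carrier A" "g \<in> carrier A" "b \<in> carrier A"
  shows "bracket (delta A f) (b \<odot>\<^bsub>\<F>\<^sub>A\<^esub> delta A g) = basic_bracket f \<one>\<^bsub>A\<^esub> g b"
  using bracket_single[of f "\<one>\<^bsub>A\<^esub>" g b] assms by simp

lemma bracket_add_right:
  assumes "u \<in> carrier \<F>\<^sub>A" and v: "v \<in> carrier \<F>\<^sub>A" "v' \<in> carrier \<F>\<^sub>A"
  shows "bracket u (v \<oplus>\<^bsub>\<F>\<^sub>A\<^esub> v') = bracket u v \<oplus>\<^bsub>\<Omega>\<^esub> bracket u v'"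
  by (rule additive_ext[OF M_cring Om.M.abelian_group_axioms _ _ _ _ _ assms(1)])
    (use v in \<open>simp_all add: bracket_closed bracket_add_left Om.M.a_ac bracket_single_left
      additive_family.lift_sum_add[OF basic_bracket_family]\<close>)

lemma bracket_skew:
  assumes "u \<in> carrier \<F>\<^sub>A" "v \<in> carrier \<F>\<^sub>A"
  shows "bracket u v = \<ominus>\<^bsub>\<Omega>\<^esub> bracket v u"
  by (rule biadditive_ext[OF M_cring Om.M.abelian_group_axioms _ _ _ _ _ _ _ assms])
    (simp_all add: bracket_closed bracket_add_left bracket_add_right Om.M.minus_add bracket_single
      basic_bracket_skew[symmetric])

section \<open>The anchor, and independence of representatives\<close>

definition anchor_sum where
  "anchor_sum u c = lift_sum A A (\<lambda>f a. a \<otimes>\<^bsub>A\<^esub> lie A f c) u"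

lemma kahler_anchor_sum: "kahler_anchor A X c = anchor_sum (kahler_rep X) c"
  by (simp add: kahler_anchor_def Let_def anchor_sum_def lift_sum_def)

lemma anchor_sum_family:
  "c \<in> carrier A \<Longrightarrow> additive_family A (carrier A) A (\<lambda>f a. a \<otimes>\<^bsub>A\<^esub> lie A f c)"
  by (intro additive_family.intro additive_family_axioms.intro M_cring M.abelian_group_axioms)
    (simp_all add: l_distr)

lemma anchor_sum_ops:
  assumes "c \<in> carrier A"
  shows "u \<in> carrier \<F>\<^sub>A \<Longrightarrow> anchor_sum u c \<in> carrier A"
    "u \<in> carrier \<F>\<^sub>A \<Longrightarrow> v \<in> carrier \<F>\<^sub>A \<Longrightarrow> anchor_sum (u \<oplus>\<^bsub>\<F>\<^sub>A\<^esub> v) c = anchor_sum u c \<oplus>\<^bsub>A\<^esub> anchor_sum v c"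
    "u \<in> carrier \<F>\<^sub>A \<Longrightarrow> v \<in> carrier \<F>\<^sub>A \<Longrightarrow> anchor_sum (u \<ominus>\<^bsub>\<F>\<^sub>A\<^esub> v) c = anchor_sum u c \<ominus>\<^bsub>A\<^esub> anchor_sum v c"
    "f \<in> carrier A \<Longrightarrow> a \<in> carrier A \<Longrightarrow> anchor_sum (a \<odot>\<^bsub>\<F>\<^sub>A\<^esub> delta A f) c = a \<otimes>\<^bsub>A\<^esub> lie A f c"
    "f \<in> carrier A \<Longrightarrow> anchor_sum (delta A f) c = lie A f c"
    "a \<in> carrier A \<Longrightarrow> u \<in> carrier \<F>\<^sub>A \<Longrightarrow> anchor_sum (a \<odot>\<^bsub>\<F>\<^sub>A\<^esub> u) c = a \<otimes>\<^bsub>A\<^esub> anchor_sum u c"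
proof -
  interpret T: additive_family A "carrier A" A "\<lambda>f a. a \<otimes>\<^bsub>A\<^esub> lie A f c"
    by (rule anchor_sum_family[OF assms])
  show "u \<in> carrier \<F>\<^sub>A \<Longrightarrow> anchor_sum u c \<in> carrier A"
    "u \<in> carrier \<F>\<^sub>A \<Longrightarrow> v \<in> carrier \<F>\<^sub>A \<Longrightarrow> anchor_sum (u \<oplus>\<^bsub>\<F>\<^sub>A\<^esub> v) c = anchor_sum u c \<oplus>\<^bsub>A\<^esub> anchor_sum v c"
    "u \<in> carrier \<F>\<^sub>A \<Longrightarrow> v \<in> carrier \<F>\<^sub>A \<Longrightarrow> anchor_sum (u \<ominus>\<^bsub>\<F>\<^sub>A\<^esub> v) c = anchor_sum u c \<ominus>\<^bsub>A\<^esub> anchor_sum v c"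
    "f \<in> carrier A \<Longrightarrow> a \<in> carrier A \<Longrightarrow> anchor_sum (a \<odot>\<^bsub>\<F>\<^sub>A\<^esub> delta A f) c = a \<otimes>\<^bsub>A\<^esub> lie A f c"
    unfolding anchor_sum_def
    by (rule T.lift_sum_closed T.lift_sum_add T.lift_sum_minus T.lift_sum_single; assumption)+
  show "f \<in> carrier A \<Longrightarrow> anchor_sum (delta A f) c = lie A f c"
    using T.lift_sum_delta[of f] assms by (simp add: anchor_sum_def)
  show "a \<in> carrier A \<Longrightarrow> u \<in> carrier \<F>\<^sub>A \<Longrightarrow> anchor_sum (a \<odot>\<^bsub>\<F>\<^sub>A\<^esub> u) c = a \<otimes>\<^bsub>A\<^esub> anchor_sum u c"
    unfolding anchor_sum_def by (rule T.lift_sum_smult) (simp_all add: r_distr m_assoc assms)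
qed

text \<open>For fixed \<open>c\<close> the map \<open>{-, c}\<close> is a \<open>K\<close>-linear
  derivation of \<open>A\<close>, so its \<open>A\<close>-linear extension kills the Kaehler
  relations.\<close>

lemma anchor_sum_null:
  assumes "u \<in> \<N>" and c: "c \<in> carrier A"
  shows "anchor_sum u c = \<zero>\<^bsub>A\<^esub>"
proof (rule kahler_sub_null[OF M.abelian_group_axioms _ _ _ _ assms(1)])
  show "anchor_sum (a \<odot>\<^bsub>\<F>\<^sub>A\<^esub> u) c = \<zero>\<^bsub>A\<^esub>" if "a \<in> carrier A" "u \<in> \<N>" "anchor_sum u c = \<zero>\<^bsub>A\<^esub>" for a u
    using that c F.I.a_subset by (simp add: anchor_sum_ops)
  show "anchor_sum r c = \<zero>\<^bsub>A\<^esub>" if "r \<in> kahler_rels K A" for r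
    using that
    by (cases rule: kahler_rels_cases)
      (simp_all add: anchor_sum_ops c lie_add_left lie_smult_left leibniz_left scalar_mult
        M.minus_eq_zero_iff m_comm[of "lie A _ c"] a_comm)
qed (simp_all add: anchor_sum_ops c)

lemma kahler_anchor_cls:
  assumes "u \<in> carrier \<F>\<^sub>A" "c \<in> carrier A"
  shows "kahler_anchor A (cls u) c = anchor_sum u c"
  unfolding kahler_anchor_sum kahler_rep_def
  by (rule F.additive_lift[OF M.abelian_group_axioms, of "\<lambda>u. anchor_sum u c"])
    (simp_all add: assms anchor_sum_ops anchor_sum_null)

text \<open>The Lie-Rinehart identity, read in the left argument by antisymmetry and already valid
  on the free module: there the correction is a multiple of the class of \<open>u\<close>.\<close>

lemma bracket_smult:
  assumes "a \<in> carrier A" "u \<in> carrier \<F>\<^sub>A" "v \<in> carrier \<F>\<^sub>A"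
  shows "bracket (a \<odot>\<^bsub>\<F>\<^sub>A\<^esub> u) v = a \<odot>\<^bsub>\<Omega>\<^esub> bracket u v \<ominus>\<^bsub>\<Omega>\<^esub> anchor_sum v a \<odot>\<^bsub>\<Omega>\<^esub> cls u"
proof (rule biadditive_ext[OF M_cring Om.M.abelian_group_axioms _ _ _ _ _ _ _ assms(2,3)])
  fix c f b g assume "c \<in> carrier A" "f \<in> carrier A" "b \<in> carrier A" "g \<in> carrier A"
  then show "bracket (a \<odot>\<^bsub>\<F>\<^sub>A\<^esub> (c \<odot>\<^bsub>\<F>\<^sub>A\<^esub> delta A f)) (b \<odot>\<^bsub>\<F>\<^sub>A\<^esub> delta A g) =
      a \<odot>\<^bsub>\<Omega>\<^esub> bracket (c \<odot>\<^bsub>\<F>\<^sub>A\<^esub> delta A f) (b \<odot>\<^bsub>\<F>\<^sub>A\<^esub> delta A g)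
      \<ominus>\<^bsub>\<Omega>\<^esub> anchor_sum (b \<odot>\<^bsub>\<F>\<^sub>A\<^esub> delta A g) a \<odot>\<^bsub>\<Omega>\<^esub> cls (c \<odot>\<^bsub>\<F>\<^sub>A\<^esub> delta A f)"
    using assms(1)
    by (simp add: F.smult_assoc1[symmetric] bracket_single basic_bracket_smult anchor_sum_ops
        cls_ops kahler_d_def)
qed (use assms(1) in \<open>simp_all add: bracket_closed bracket_add_left bracket_add_right anchor_sum_ops cls_ops
    F.smult_r_distr Om.smult_r_distr Om.smult_l_distr Om.M.minus_eq Om.M.minus_add Om.M.a_ac\<close>)

lemma bracket_minus_left:
  assumes "u \<in> carrier \<F>\<^sub>A" "u' \<in> carrier \<F>\<^sub>A" "v \<in> carrier \<F>\<^sub>A"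
  shows "bracket (u \<ominus>\<^bsub>\<F>\<^sub>A\<^esub> u') v = bracket u v \<ominus>\<^bsub>\<Omega>\<^esub> bracket u' v"
  by (rule additive_zero_minus(3)[OF F.M.abelian_group_axioms Om.M.abelian_group_axioms,
        of "\<lambda>u. bracket u v"])
    (simp_all add: bracket_closed bracket_add_left assms)

text \<open>The elements of \<open>\<N>\<close> on which the bracket vanishes form a submodule, because the defect of
  \<open>A\<close>-linearity in \<open>bracket_smult\<close> is a multiple of the class of \<open>u\<close>.\<close>

lemma bracket_null_left:
  assumes u: "u \<in> \<N>" and v: "v \<in> carrier \<F>\<^sub>A"
  shows "bracket u v = \<zero>\<^bsub>\<Omega>\<^esub>"
proof (rule kahler_sub_null[OF Om.M.abelian_group_axioms _ _ _ _ u])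
  show "bracket (a \<odot>\<^bsub>\<F>\<^sub>A\<^esub> u) v = \<zero>\<^bsub>\<Omega>\<^esub>" if "a \<in> carrier A" "u \<in> \<N>" "bracket u v = \<zero>\<^bsub>\<Omega>\<^esub>" for a u
  proof -
    have "cls u = \<zero>\<^bsub>\<Omega>\<^esub>" using that F.I.a_rcos_const cls_ops(4) by simp
    then show ?thesis using that v F.I.a_subset
      by (simp add: bracket_smult anchor_sum_ops Om.M.minus_eq_zero_iff)
  qed
  show "bracket r v = \<zero>\<^bsub>\<Omega>\<^esub>" if r: "r \<in> kahler_rels K A" for r
  \<comment> \<open>For a fixed relation \<open>r\<close> the bracket is additive in the other
    argument, so it suffices to pair \<open>r\<close> with the forms \<open>b dh\<close>.\<close>
  proof (rule additive_ext[OF M_cring Om.M.abelian_group_axioms _ _ _ _ _ v])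
    have rc: "r \<in> carrier \<F>\<^sub>A" using r kahler_rels_carrier by blast
    show "bracket r u \<in> carrier \<Omega>" if "u \<in> carrier \<F>\<^sub>A" for u
      using rc that by (rule bracket_closed)
    show "bracket r (u \<oplus>\<^bsub>\<F>\<^sub>A\<^esub> u') = bracket r u \<oplus>\<^bsub>\<Omega>\<^esub> bracket r u'"
      if "u \<in> carrier \<F>\<^sub>A" "u' \<in> carrier \<F>\<^sub>A" for u u'
      using rc that by (rule bracket_add_right)
    show "bracket r (b \<odot>\<^bsub>\<F>\<^sub>A\<^esub> delta A h) = \<zero>\<^bsub>\<Omega>\<^esub>" if "b \<in> carrier A" "h \<in> carrier A" for b h
      using r that
      by (cases rule: kahler_rels_cases)
        (simp_all add: bracket_minus_left bracket_add_left bracket_delta bracket_single basic_bracket_closed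
          basic_bracket_sum basic_bracket_scalar basic_bracket_mult Om.M.minus_eq_zero_iff)
  qed simp_all
qed (simp_all add: bracket_closed bracket_add_left v)

lemma bracket_null_right:
  assumes "u \<in> carrier \<F>\<^sub>A" "v \<in> \<N>"
  shows "bracket u v = \<zero>\<^bsub>\<Omega>\<^esub>"
  using bracket_skew[of u v] bracket_null_left[of v u] assms F.I.a_subset Om.M.add.inv_one
  by (metis F.I.a_Hcarr bracket_closed Om.M.minus_equality Om.M.r_zero Om.M.zero_closed)

text \<open>The chosen representatives are exchanged one at a time: first the right one, with the
  chosen left one kept fixed, and then the left one against \<open>v\<close>. This is why the
  bracket has to vanish on \<open>\<N>\<close> in each argument.\<close>

lemma kahler_lie_cls:
  assumes u: "u \<in> carrier \<F>\<^sub>A" and v: "v \<in> carrier \<F>\<^sub>A"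
  shows "kahler_lie K A (cls u) (cls v) = bracket u v"
proof -
  note r = F.quot_rep[OF u]
  have "kahler_lie K A (cls u) (cls v) = bracket (SOME u'. u' \<in> cls u) v"
    unfolding kahler_lie_bracket kahler_rep_def
    by (rule F.additive_lift[OF Om.M.abelian_group_axioms])
      (simp_all add: v r bracket_closed bracket_add_right bracket_null_right)
  also have "\<dots> = bracket u v"
    by (rule F.additive_lift[OF Om.M.abelian_group_axioms,
        of "\<lambda>u. bracket u v"])
      (simp_all add: u v bracket_closed bracket_add_left bracket_null_left)
  finally show ?thesis .
qed

lemma kahler_lie_closed:
  "X \<in> carrier \<Omega> \<Longrightarrow> Y \<in> carrier \<Omega> \<Longrightarrow> kahler_lie K A X Y \<in> carrier \<Omega>"
  by (elim kahler_module_cases) (simp add: kahler_lie_cls bracket_closed)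

lemma kahler_anchor_closed:
  "X \<in> carrier \<Omega> \<Longrightarrow> c \<in> carrier A \<Longrightarrow> kahler_anchor A X c \<in> carrier A"
  by (elim kahler_module_cases) (simp add: kahler_anchor_cls anchor_sum_ops)

lemma kahler_lie_zero:
  assumes "X \<in> carrier \<Omega>"
  shows "kahler_lie K A X \<zero>\<^bsub>\<Omega>\<^esub> = \<zero>\<^bsub>\<Omega>\<^esub>"
proof -
  obtain u where u: "u \<in> carrier \<F>\<^sub>A" "X = cls u" using assms by (rule kahler_module_cases)
  have "kahler_lie K A X \<zero>\<^bsub>\<Omega>\<^esub> = bracket u \<zero>\<^bsub>\<F>\<^sub>A\<^esub>"
    using kahler_lie_cls[OF u(1), of "\<zero>\<^bsub>\<F>\<^sub>A\<^esub>"] u(2) by (simp add: F.coset_zero cls_ops(4))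
  then show ?thesis using u by (simp add: bracket_null_right)
qed

lemma kahler_anchor_zero:
  assumes "c \<in> carrier A"
  shows "kahler_anchor A \<zero>\<^bsub>\<Omega>\<^esub> c = \<zero>\<^bsub>A\<^esub>"
  using kahler_anchor_cls[of "\<zero>\<^bsub>\<F>\<^sub>A\<^esub>" c] anchor_sum_null[of "\<zero>\<^bsub>\<F>\<^sub>A\<^esub>" c] assms
  by (simp add: F.coset_zero cls_ops(4))

lemma kahler_anchor_one:
  assumes "X \<in> carrier \<Omega>"
  shows "kahler_anchor A X \<one>\<^bsub>A\<^esub> = \<zero>\<^bsub>A\<^esub>"
proof -
  obtain u where u: "u \<in> carrier \<F>\<^sub>A" "X = cls u" using assms by (rule kahler_module_cases)
  have "anchor_sum u \<one>\<^bsub>A\<^esub> = \<zero>\<^bsub>A\<^esub>"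
    by (rule additive_ext[OF M_cring M.abelian_group_axioms _ _ _ _ _ u(1)])
      (simp_all add: anchor_sum_ops)
  then show ?thesis using u by (simp add: kahler_anchor_cls)
qed

lemma kahler_anchor_d:
  "f \<in> carrier A \<Longrightarrow> c \<in> carrier A \<Longrightarrow> kahler_anchor A (\<dd> f) c = lie A f c"
  unfolding kahler_d_def by (simp add: kahler_anchor_cls anchor_sum_ops)

lemma kahler_lie_d:
  assumes "f \<in> carrier A" "g \<in> carrier A"
  shows "kahler_lie K A (\<dd> f) (\<dd> g) = \<dd> (lie A f g)"
  unfolding kahler_d_def
  using assms bracket_single[of f "\<one>\<^bsub>A\<^esub>" g "\<one>\<^bsub>A\<^esub>"] basic_bracket_one[of f g]
  by (simp add: kahler_lie_cls kahler_d_def)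

end

section \<open>The enveloping algebra of a Lie algebra\<close>

text \<open>The relations of \<open>lie_env\<close> name sums, scalar multiples and brackets of
  generators; closure makes these generators again, so that the relations lie in the free
  algebra.\<close>

locale lie_operations = K: cring K
  for K (structure) and g (structure) +
  assumes add_closed: "\<lbrakk>x \<in> carrier g; y \<in> carrier g\<rbrakk> \<Longrightarrow> x \<oplus>\<^bsub>g\<^esub> y \<in> carrier g"
    and smult_closed: "\<lbrakk>c \<in> carrier K; x \<in> carrier g\<rbrakk> \<Longrightarrow> c \<odot>\<^bsub>g\<^esub> x \<in> carrier g"
    and lie_closed: "\<lbrakk>x \<in> carrier g; y \<in> carrier g\<rbrakk> \<Longrightarrow> lie g x y \<in> carrier g"
begin

lemmas ops_closed = add_closed smult_closed lie_closed

abbreviation F where "F \<equiv> free_algebra K (carrier g)"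
abbreviation \<U> where "\<U> \<equiv> lie_env K g"
abbreviation incl where "incl \<equiv> lie_env_incl K g"

lemma lie_env_rels_intros:
  "\<lbrakk>x \<in> carrier g; y \<in> carrier g\<rbrakk> \<Longrightarrow>
     delta K [x \<oplus>\<^bsub>g\<^esub> y] \<ominus>\<^bsub>F\<^esub> (delta K [x] \<oplus>\<^bsub>F\<^esub> delta K [y]) \<in> lie_env_rels K g"
  "\<lbrakk>c \<in> carrier K; x \<in> carrier g\<rbrakk> \<Longrightarrow>
     delta K [c \<odot>\<^bsub>g\<^esub> x] \<ominus>\<^bsub>F\<^esub> c \<odot>\<^bsub>F\<^esub> delta K [x] \<in> lie_env_rels K g"
  "\<lbrakk>x \<in> carrier g; y \<in> carrier g\<rbrakk> \<Longrightarrow>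
     delta K [x] \<otimes>\<^bsub>F\<^esub> delta K [y] \<ominus>\<^bsub>F\<^esub> delta K [y] \<otimes>\<^bsub>F\<^esub> delta K [x] \<ominus>\<^bsub>F\<^esub> delta K [lie g x y]
       \<in> lie_env_rels K g"
  unfolding lie_env_rels_def Let_def by blast+

lemma lie_env_rels_cases:
  assumes "r \<in> lie_env_rels K g"
  obtains x y where "x \<in> carrier g" "y \<in> carrier g"
     "r = delta K [x \<oplus>\<^bsub>g\<^esub> y] \<ominus>\<^bsub>F\<^esub> (delta K [x] \<oplus>\<^bsub>F\<^esub> delta K [y])"
  | c x where "c \<in> carrier K" "x \<in> carrier g"
     "r = delta K [c \<odot>\<^bsub>g\<^esub> x] \<ominus>\<^bsub>F\<^esub> c \<odot>\<^bsub>F\<^esub> delta K [x]"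
  | x y where "x \<in> carrier g" "y \<in> carrier g"
     "r = delta K [x] \<otimes>\<^bsub>F\<^esub> delta K [y] \<ominus>\<^bsub>F\<^esub> delta K [y] \<otimes>\<^bsub>F\<^esub> delta K [x]
       \<ominus>\<^bsub>F\<^esub> delta K [lie g x y]"
  using assms unfolding lie_env_rels_def Let_def by blast

lemma lie_free_algebra: "assoc_algebra K F"
  by (rule free_algebra_assoc_algebra[OF K.cring_axioms])

lemma lie_free_gens: "x \<in> carrier g \<Longrightarrow> delta K [x] \<in> carrier F"
  by (rule free_algebra_delta[OF K.cring_axioms]) simp

lemma lie_env_rels_carrier: "lie_env_rels K g \<subseteq> carrier F"
proof
  interpret F: assoc_algebra K F by (rule lie_free_algebra)
  fix r assume "r \<in> lie_env_rels K g"
  then show "r \<in> carrier F"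
    by (cases rule: lie_env_rels_cases) (simp_all add: lie_free_gens ops_closed F.M.minus_closed)
qed

lemma lie_env_quotient: "quotient_algebra K F (lie_env_ideal K g)"
  unfolding lie_env_ideal_def
  by (rule assoc_algebra.quotient_by_Idl[OF lie_free_algebra lie_env_rels_carrier])

lemma lie_env_algebra: "assoc_algebra K \<U>"
  unfolding lie_env_def by (rule quotient_algebra.quot_assoc_algebra[OF lie_env_quotient])

text \<open>The bracket relation is kept free of subtraction. Sum and product of
  \<open>U\<^sup>+\<close> are literally those of \<open>\<U>\<close>, but \<open>\<ominus>\<close>
  depends on the carrier of its structure; in this form the relation passes to
  \<open>U\<^sup>+\<close> unchanged.\<close>

lemma incl_ops:
  "x \<in> carrier g \<Longrightarrow> incl x \<in> carrier \<U>"
  "\<lbrakk>x \<in> carrier g; y \<in> carrier g\<rbrakk> \<Longrightarrow> incl (x \<oplus>\<^bsub>g\<^esub> y) = incl x \<oplus>\<^bsub>\<U>\<^esub> incl y"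
  "\<lbrakk>c \<in> carrier K; x \<in> carrier g\<rbrakk> \<Longrightarrow> incl (c \<odot>\<^bsub>g\<^esub> x) = c \<odot>\<^bsub>\<U>\<^esub> incl x"
  "\<lbrakk>x \<in> carrier g; y \<in> carrier g\<rbrakk> \<Longrightarrow>
     incl x \<otimes>\<^bsub>\<U>\<^esub> incl y = incl y \<otimes>\<^bsub>\<U>\<^esub> incl x \<oplus>\<^bsub>\<U>\<^esub> incl (lie g x y)"
proof -
  let ?I = "lie_env_ideal K g"
  interpret F: assoc_algebra K F by (rule lie_free_algebra)
  interpret Q: quotient_algebra K F ?I by (rule lie_env_quotient)
  interpret U: assoc_algebra K \<U> by (rule lie_env_algebra)
  have rel: "?I +>\<^bsub>F\<^esub> u = ?I +>\<^bsub>F\<^esub> v"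
    if "u \<ominus>\<^bsub>F\<^esub> v \<in> lie_env_rels K g" "u \<in> carrier F" "v \<in> carrier F" for u v
    using that Q.coset_eq_iff F.B.genideal_self[OF lie_env_rels_carrier]
    by (auto simp: lie_env_ideal_def)
  note hom = algebra_homD[OF Q.coset_hom, folded lie_env_def]
  have fm: "?I +>\<^bsub>F\<^esub> (u \<ominus>\<^bsub>F\<^esub> v) = (?I +>\<^bsub>F\<^esub> u) \<ominus>\<^bsub>\<U>\<^esub> (?I +>\<^bsub>F\<^esub> v)"
    if "u \<in> carrier F" "v \<in> carrier F" for u v
    using Q.quot_minus[OF that] by (simp add: lie_env_def)
  note R = lie_env_rels_intros[THEN rel]
  show cl: "incl x \<in> carrier \<U>" if "x \<in> carrier g" for x
    unfolding lie_env_incl_def using that by (intro hom lie_free_gens)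
  show "\<lbrakk>x \<in> carrier g; y \<in> carrier g\<rbrakk> \<Longrightarrow> incl (x \<oplus>\<^bsub>g\<^esub> y) = incl x \<oplus>\<^bsub>\<U>\<^esub> incl y"
    "\<lbrakk>c \<in> carrier K; x \<in> carrier g\<rbrakk> \<Longrightarrow> incl (c \<odot>\<^bsub>g\<^esub> x) = c \<odot>\<^bsub>\<U>\<^esub> incl x"
    unfolding lie_env_incl_def by (simp_all add: R lie_free_gens ops_closed hom)
  show "incl x \<otimes>\<^bsub>\<U>\<^esub> incl y = incl y \<otimes>\<^bsub>\<U>\<^esub> incl x \<oplus>\<^bsub>\<U>\<^esub> incl (lie g x y)"
    if xy: "x \<in> carrier g" "y \<in> carrier g"
  proof -
    have "incl (lie g x y) = incl x \<otimes>\<^bsub>\<U>\<^esub> incl y \<ominus>\<^bsub>\<U>\<^esub> incl y \<otimes>\<^bsub>\<U>\<^esub> incl x"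
      unfolding lie_env_incl_def using xy R(3)[OF xy]
      by (simp add: lie_free_gens ops_closed hom fm F.M.minus_closed)
    then show ?thesis using xy cl U.M.eq_minus_iff by (simp add: ops_closed)
  qed
qed

lemma lie_env_lift:
  assumes C: "assoc_algebra K C"
    and \<psi>: "\<And>x. x \<in> carrier g \<Longrightarrow> \<psi> x \<in> carrier C"
      "\<And>x y. x \<in> carrier g \<Longrightarrow> y \<in> carrier g \<Longrightarrow> \<psi> (x \<oplus>\<^bsub>g\<^esub> y) = \<psi> x \<oplus>\<^bsub>C\<^esub> \<psi> y"
      "\<And>c x. c \<in> carrier K \<Longrightarrow> x \<in> carrier g \<Longrightarrow> \<psi> (c \<odot>\<^bsub>g\<^esub> x) = c \<odot>\<^bsub>C\<^esub> \<psi> x"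
      "\<And>x y. x \<in> carrier g \<Longrightarrow> y \<in> carrier g \<Longrightarrow>
        \<psi> x \<otimes>\<^bsub>C\<^esub> \<psi> y = \<psi> y \<otimes>\<^bsub>C\<^esub> \<psi> x \<oplus>\<^bsub>C\<^esub> \<psi> (lie g x y)"
  shows "\<exists>f\<in>algebra_hom K \<U> C. \<forall>x\<in>carrier g. f (incl x) = \<psi> x"
proof -
  let ?I = "lie_env_ideal K g"
  interpret F: assoc_algebra K F by (rule lie_free_algebra)
  interpret Q: quotient_algebra K F ?I by (rule lie_env_quotient)
  interpret C: assoc_algebra K C by fact
  obtain f where f: "f \<in> algebra_hom K F C" and fx: "\<And>x. x \<in> carrier g \<Longrightarrow> f (delta K [x]) = \<psi> x"
    using free_algebra_lift[OF K.cring_axioms C, of "carrier g" \<psi>] \<psi>(1) by blast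
  note fD = algebra_homD[OF f]
  have fm: "f (u \<ominus>\<^bsub>F\<^esub> v) = f u \<ominus>\<^bsub>C\<^esub> f v" if "u \<in> carrier F" "v \<in> carrier F" for u v
    by (rule additive_zero_minus(3)[OF F.M.abelian_group_axioms C.M.abelian_group_axioms])
      (use fD(1,2) that in auto)
  have comm: "\<psi> x \<otimes>\<^bsub>C\<^esub> \<psi> y \<ominus>\<^bsub>C\<^esub> \<psi> y \<otimes>\<^bsub>C\<^esub> \<psi> x = \<psi> (lie g x y)"
    if "x \<in> carrier g" "y \<in> carrier g" for x y
    by (rule sym, rule C.M.eq_minus_iff[THEN iffD2, OF _ _ _ \<psi>(4)])
      (simp_all add: that \<psi>(1) ops_closed)
  have "f r = \<zero>\<^bsub>C\<^esub>" if "r \<in> lie_env_rels K g" for r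
    using that
    by (cases rule: lie_env_rels_cases)
      (simp_all add: fm fD lie_free_gens ops_closed fx \<psi>(1-3) comm C.M.minus_eq_zero_iff F.M.minus_closed)
  then have "f x = \<zero>\<^bsub>C\<^esub>" if "x \<in> ?I" for x
    using Idl_null[OF lie_free_algebra C f lie_env_rels_carrier] that
    unfolding lie_env_ideal_def by blast
  then obtain h where "h \<in> algebra_hom K \<U> C" "\<And>x. x \<in> carrier F \<Longrightarrow> h (?I +>\<^bsub>F\<^esub> x) = f x"
    using Q.quot_lift[OF C f] unfolding lie_env_def by blast
  then show ?thesis
    unfolding lie_env_incl_def using fx lie_free_gens by (intro bexI[of _ h]) auto
qed

end

section \<open>The enveloping algebra of the Lie-Rinehart algebra\<close>

context poisson_algebra
begin

lemma kahler_simps: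
  "carrier (kahler K A) = carrier \<Omega>"
  "\<zero>\<^bsub>kahler K A\<^esub> = \<zero>\<^bsub>\<Omega>\<^esub>"
  "add (kahler K A) = add \<Omega>"
  "c \<odot>\<^bsub>kahler K A\<^esub> X = (c \<odot>\<^bsub>A\<^esub> \<one>\<^bsub>A\<^esub>) \<odot>\<^bsub>\<Omega>\<^esub> X"
  "lie (kahler K A) = kahler_lie K A"
  "act (kahler K A) = smult \<Omega>"
  "anchor (kahler K A) = kahler_anchor A"
  by (simp_all add: kahler_def Let_def)

abbreviation \<hh> where "\<hh> \<equiv> semidirect A (kahler K A)"
abbreviation sact where "sact \<equiv> semidirect_act A (kahler K A)"

lemma semidirect_simps:
  "carrier \<hh> = carrier A \<times> carrier \<Omega>"
  "\<zero>\<^bsub>\<hh>\<^esub> = (\<zero>\<^bsub>A\<^esub>, \<zero>\<^bsub>\<Omega>\<^esub>)"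
  "(a, X) \<oplus>\<^bsub>\<hh>\<^esub> (b, Y) = (a \<oplus>\<^bsub>A\<^esub> b, X \<oplus>\<^bsub>\<Omega>\<^esub> Y)"
  "c \<odot>\<^bsub>\<hh>\<^esub> (a, X) = (c \<odot>\<^bsub>A\<^esub> a, (c \<odot>\<^bsub>A\<^esub> \<one>\<^bsub>A\<^esub>) \<odot>\<^bsub>\<Omega>\<^esub> X)"
  "lie \<hh> (a, X) (b, Y) = (kahler_anchor A X b \<ominus>\<^bsub>A\<^esub> kahler_anchor A Y a, kahler_lie K A X Y)"
  "sact a (b, X) = (a \<otimes>\<^bsub>A\<^esub> b, a \<odot>\<^bsub>\<Omega>\<^esub> X)"
  by (simp_all add: semidirect_def semidirect_act_def kahler_simps)

lemma semidirect_closed: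
  "x \<in> carrier \<hh> \<Longrightarrow> y \<in> carrier \<hh> \<Longrightarrow> x \<oplus>\<^bsub>\<hh>\<^esub> y \<in> carrier \<hh>"
  "c \<in> carrier K \<Longrightarrow> x \<in> carrier \<hh> \<Longrightarrow> c \<odot>\<^bsub>\<hh>\<^esub> x \<in> carrier \<hh>"
  "x \<in> carrier \<hh> \<Longrightarrow> y \<in> carrier \<hh> \<Longrightarrow> lie \<hh> x y \<in> carrier \<hh>"
  "a \<in> carrier A \<Longrightarrow> x \<in> carrier \<hh> \<Longrightarrow> sact a x \<in> carrier \<hh>"
proof -
  interpret Om: module A \<Omega> by (rule kahler_module_module)
  show "x \<in> carrier \<hh> \<Longrightarrow> y \<in> carrier \<hh> \<Longrightarrow> x \<oplus>\<^bsub>\<hh>\<^esub> y \<in> carrier \<hh>"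
    "c \<in> carrier K \<Longrightarrow> x \<in> carrier \<hh> \<Longrightarrow> c \<odot>\<^bsub>\<hh>\<^esub> x \<in> carrier \<hh>"
    "x \<in> carrier \<hh> \<Longrightarrow> y \<in> carrier \<hh> \<Longrightarrow> lie \<hh> x y \<in> carrier \<hh>"
    "a \<in> carrier A \<Longrightarrow> x \<in> carrier \<hh> \<Longrightarrow> sact a x \<in> carrier \<hh>"
    by (cases x; cases y; simp add: semidirect_simps kahler_anchor_closed kahler_lie_closed)+
qed

end

sublocale poisson_algebra \<subseteq> H: lie_operations K "semidirect A (kahler K A)"
  by (intro lie_operations.intro lie_operations_axioms.intro R_cring)
    (fact semidirect_closed)+

section \<open>The non-unital subalgebra generated by the semidirect product\<close>

context poisson_algebra
begin

abbreviation \<U> where "\<U> \<equiv> lie_env K \<hh>"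
abbreviation incl where "incl \<equiv> lie_env_incl K \<hh>"
abbreviation \<U>\<^sub>p where "\<U>\<^sub>p \<equiv> lr_plus K A (kahler K A)"

definition subalg where
  "subalg S \<longleftrightarrow> submodule S K \<U> \<and> (\<forall>x\<in>S. \<forall>y\<in>S. x \<otimes>\<^bsub>\<U>\<^esub> y \<in> S)"

lemma lr_plus_simps:
  "carrier \<U>\<^sub>p = subalg hull (incl ` carrier \<hh>)"
  "x \<oplus>\<^bsub>\<U>\<^sub>p\<^esub> y = x \<oplus>\<^bsub>\<U>\<^esub> y"
  "x \<otimes>\<^bsub>\<U>\<^sub>p\<^esub> y = x \<otimes>\<^bsub>\<U>\<^esub> y"
  "\<zero>\<^bsub>\<U>\<^sub>p\<^esub> = \<zero>\<^bsub>\<U>\<^esub>"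
  "\<one>\<^bsub>\<U>\<^sub>p\<^esub> = incl (\<one>\<^bsub>A\<^esub>, \<zero>\<^bsub>\<Omega>\<^esub>)"
  "c \<odot>\<^bsub>\<U>\<^sub>p\<^esub> x = c \<odot>\<^bsub>\<U>\<^esub> x"
  by (simp_all add: lr_plus_def Let_def kahler_simps subalg_def[abs_def])

lemma lr_plus_subalg: "subalg (carrier \<U>\<^sub>p)"
proof -
  interpret U: assoc_algebra K \<U> by (rule H.lie_env_algebra)
  have "carrier \<U> \<in> {t. subalg t \<and> incl ` carrier \<hh> \<subseteq> t}"
    using U.carrier_is_submodule by (auto simp: subalg_def H.incl_ops)
  then show ?thesis
    unfolding lr_plus_simps hull_def subalg_def
    by (intro conjI submodule_Inter[OF U.module_axioms]) auto
qed

lemma incl_lr_plus: "x \<in> carrier \<hh> \<Longrightarrow> incl x \<in> carrier \<U>\<^sub>p"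
  unfolding lr_plus_simps by (rule hull_inc) simp

lemma lr_plus_subset: "carrier \<U>\<^sub>p \<subseteq> carrier \<U>"
  using lr_plus_subalg
    submoduleD(1)[OF nonunital_algebra.axioms(1)[OF assoc_algebra.axioms(1)[OF H.lie_env_algebra]]]
  by (simp add: subalg_def)

lemma lr_plus_algebra: "nonunital_algebra K \<U>\<^sub>p"
proof -
  interpret U: assoc_algebra K \<U> by (rule H.lie_env_algebra)
  have S: "submodule (carrier \<U>\<^sub>p) K \<U>" using lr_plus_subalg by (simp add: subalg_def)
  \<comment> \<open>The field \<open>mult\<close> is overwritten by itself, just to match
    \<open>module_update\<close>; the field that really changes is \<open>one\<close>.\<close>
  have "module K ((\<U>\<lparr>carrier := carrier \<U>\<^sub>p\<rparr>)\<lparr>mult := mult \<U>, one := \<one>\<^bsub>\<U>\<^sub>p\<^esub>\<rparr>)"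
    by (intro module_update submodule.submodule_is_module[OF S] U.module_axioms)
  also have "(\<U>\<lparr>carrier := carrier \<U>\<^sub>p\<rparr>)\<lparr>mult := mult \<U>, one := \<one>\<^bsub>\<U>\<^sub>p\<^esub>\<rparr> = \<U>\<^sub>p"
    by (simp add: lr_plus_def Let_def)
  finally have "module K \<U>\<^sub>p" .
  moreover have "x \<in> carrier \<U>" if "x \<in> carrier \<U>\<^sub>p" for x
    using that lr_plus_subset by blast
  ultimately show ?thesis
    using lr_plus_subalg
    by (intro nonunital_algebra.intro nonunital_algebra_axioms.intro)
      (simp_all add: lr_plus_simps(2-) subalg_def U.mult_assoc U.mult_l_distr U.mult_r_distr
        U.mult_smult_l U.mult_smult_r)
qed

text \<open>Minimality of the hull. There is no case for the identity of \<open>\<U>\<close>, as the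
  subalgebra is generated without it.\<close>

lemma lr_plus_induct [consumes 1, case_names incl zero add smult mult]:
  assumes "u \<in> carrier \<U>\<^sub>p"
    and "\<And>x. x \<in> carrier \<hh> \<Longrightarrow> P (incl x)"
    and "P \<zero>\<^bsub>\<U>\<^sub>p\<^esub>"
    and "\<And>u v. \<lbrakk>u \<in> carrier \<U>\<^sub>p; v \<in> carrier \<U>\<^sub>p; P u; P v\<rbrakk> \<Longrightarrow> P (u \<oplus>\<^bsub>\<U>\<^sub>p\<^esub> v)"
    and "\<And>c u. \<lbrakk>c \<in> carrier K; u \<in> carrier \<U>\<^sub>p; P u\<rbrakk> \<Longrightarrow> P (c \<odot>\<^bsub>\<U>\<^sub>p\<^esub> u)"
    and "\<And>u v. \<lbrakk>u \<in> carrier \<U>\<^sub>p; v \<in> carrier \<U>\<^sub>p; P u; P v\<rbrakk> \<Longrightarrow> P (u \<otimes>\<^bsub>\<U>\<^sub>p\<^esub> v)"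
  shows "P u"
proof -
  interpret U: assoc_algebra K \<U> by (rule H.lie_env_algebra)
  interpret Up: nonunital_algebra K \<U>\<^sub>p by (rule lr_plus_algebra)
  let ?S = "{u \<in> carrier \<U>\<^sub>p. P u}"
  have "submodule ?S K \<U>"
    by (rule submoduleI'[OF U.module_axioms])
      (use lr_plus_subset Up.M.zero_closed Up.M.add.m_closed Up.smult_closed assms(3-5)
        in \<open>auto simp: lr_plus_simps(2-)\<close>)
  then have "subalg ?S"
    using Up.mult_closed assms(6) by (auto simp: subalg_def lr_plus_simps(2-))
  moreover have "incl ` carrier \<hh> \<subseteq> ?S" using assms(2) incl_lr_plus by blast
  ultimately have "carrier \<U>\<^sub>p \<subseteq> ?S"
    unfolding lr_plus_simps(1) by (rule hull_minimal[rotated])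
  then show ?thesis using assms(1) by blast
qed

section \<open>The ideal of the Lie-Rinehart relations\<close>

abbreviation \<P> where "\<P> \<equiv> lr_ideal K A (kahler K A)"
abbreviation \<V> where "\<V> \<equiv> lr_env K A (kahler K A)"
abbreviation vincl where "vincl \<equiv> lr_env_incl K A (kahler K A)"

definition two_sided where
  "two_sided J \<longleftrightarrow> submodule J K \<U>\<^sub>p \<and>
     (\<forall>x\<in>J. \<forall>y\<in>carrier \<U>\<^sub>p. x \<otimes>\<^bsub>\<U>\<^sub>p\<^esub> y \<in> J \<and> y \<otimes>\<^bsub>\<U>\<^sub>p\<^esub> x \<in> J)"

definition lr_rels where
  "lr_rels = {incl (sact a z) \<ominus>\<^bsub>\<U>\<^sub>p\<^esub> incl (a, \<zero>\<^bsub>\<Omega>\<^esub>) \<otimes>\<^bsub>\<U>\<^sub>p\<^esub> incl z | a z.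
     a \<in> carrier A \<and> z \<in> carrier \<hh>}"

lemma lr_relsI:
  "a \<in> carrier A \<Longrightarrow> z \<in> carrier \<hh> \<Longrightarrow>
     incl (sact a z) \<ominus>\<^bsub>\<U>\<^sub>p\<^esub> incl (a, \<zero>\<^bsub>\<Omega>\<^esub>) \<otimes>\<^bsub>\<U>\<^sub>p\<^esub> incl z \<in> lr_rels"
  unfolding lr_rels_def by blast

lemma lr_ideal_hull: "\<P> = two_sided hull lr_rels"
  unfolding lr_ideal_def Let_def two_sided_def[abs_def] lr_rels_def kahler_simps(2) ..

lemma pair_closed:
  "a \<in> carrier A \<Longrightarrow> X \<in> carrier \<Omega> \<Longrightarrow> (a, X) \<in> carrier \<hh>"
  "a \<in> carrier A \<Longrightarrow> (a, \<zero>\<^bsub>\<Omega>\<^esub>) \<in> carrier \<hh>"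
  "X \<in> carrier \<Omega> \<Longrightarrow> (\<zero>\<^bsub>A\<^esub>, X) \<in> carrier \<hh>"
  using abelian_group.axioms(1)[OF module.axioms(2)[OF kahler_module_module]] abelian_monoid.zero_closed
  by (auto simp: semidirect_simps)

lemma lr_rels_carrier: "lr_rels \<subseteq> carrier \<U>\<^sub>p"
proof -
  interpret Up: nonunital_algebra K \<U>\<^sub>p by (rule lr_plus_algebra)
  show ?thesis
    unfolding lr_rels_def
    by (auto simp: incl_lr_plus semidirect_closed pair_closed(2) Up.mult_closed Up.M.minus_closed)
qed

lemma lr_ideal_two_sided: "two_sided \<P>"
proof -
  interpret Up: nonunital_algebra K \<U>\<^sub>p by (rule lr_plus_algebra)
  have "carrier \<U>\<^sub>p \<in> {t. two_sided t \<and> lr_rels \<subseteq> t}"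
    using Up.carrier_is_submodule lr_rels_carrier by (auto simp: two_sided_def Up.mult_closed)
  then show ?thesis
    unfolding lr_ideal_hull hull_def two_sided_def
    by (intro conjI submodule_Inter[OF Up.module_axioms]) auto
qed

lemma incl_zero: "incl (\<zero>\<^bsub>A\<^esub>, \<zero>\<^bsub>\<Omega>\<^esub>) = \<zero>\<^bsub>\<U>\<^sub>p\<^esub>"
proof -
  interpret U: assoc_algebra K \<U> by (rule H.lie_env_algebra)
  interpret Om: module A \<Omega> by (rule kahler_module_module)
  have z: "(\<zero>\<^bsub>A\<^esub>, \<zero>\<^bsub>\<Omega>\<^esub>) \<in> carrier \<hh>" by (simp add: pair_closed)
  have "incl (\<zero>\<^bsub>A\<^esub>, \<zero>\<^bsub>\<Omega>\<^esub>) = incl (\<zero>\<^bsub>A\<^esub>, \<zero>\<^bsub>\<Omega>\<^esub>) \<oplus>\<^bsub>\<U>\<^esub> incl (\<zero>\<^bsub>A\<^esub>, \<zero>\<^bsub>\<Omega>\<^esub>)"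
    using H.incl_ops(2)[OF z z] by (simp add: semidirect_simps)
  then show ?thesis
    using H.incl_ops(1)[OF z] U.M.add.r_cancel_one'[of "incl (\<zero>\<^bsub>A\<^esub>, \<zero>\<^bsub>\<Omega>\<^esub>)" "incl (\<zero>\<^bsub>A\<^esub>, \<zero>\<^bsub>\<Omega>\<^esub>)"]
    by (simp add: lr_plus_simps)
qed

lemma lr_ideal_quotient_module: "quotient_module K \<U>\<^sub>p \<P>"
  using lr_ideal_two_sided nonunital_algebra.axioms(1)[OF lr_plus_algebra]
  by (intro quotient_module.intro quotient_module_axioms.intro) (auto simp: two_sided_def)

text \<open>\<open>1\<^sub>A'\<close> commutes with every \<open>z'\<close>, since the anchor takes values in derivations, which kill \<open>1\<^sub>A\<close>, and
  \<open>1\<^sub>A' z' - z'\<close> is a generator of the ideal.\<close>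

lemma lr_ideal_quotient_algebra: "quotient_algebra K \<U>\<^sub>p \<P>"
proof -
  interpret Up: nonunital_algebra K \<U>\<^sub>p by (rule lr_plus_algebra)
  interpret Q: quotient_module K \<U>\<^sub>p \<P> by (rule lr_ideal_quotient_module)
  interpret Om: module A \<Omega> by (rule kahler_module_module)
  let ?e = "incl (\<one>\<^bsub>A\<^esub>, \<zero>\<^bsub>\<Omega>\<^esub>)"
  have e: "?e \<in> carrier \<U>\<^sub>p" by (simp add: incl_lr_plus pair_closed)
  have il: "x \<otimes>\<^bsub>\<U>\<^sub>p\<^esub> y \<in> \<P>" and ir: "y \<otimes>\<^bsub>\<U>\<^sub>p\<^esub> x \<in> \<P>" if "x \<in> carrier \<U>\<^sub>p" "y \<in> \<P>" for x y
    using lr_ideal_two_sided that by (auto simp: two_sided_def)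
  have cong: "x \<otimes>\<^bsub>\<U>\<^sub>p\<^esub> u \<ominus>\<^bsub>\<U>\<^sub>p\<^esub> x \<otimes>\<^bsub>\<U>\<^sub>p\<^esub> v \<in> \<P>" "u \<otimes>\<^bsub>\<U>\<^sub>p\<^esub> x \<ominus>\<^bsub>\<U>\<^sub>p\<^esub> v \<otimes>\<^bsub>\<U>\<^sub>p\<^esub> x \<in> \<P>"
    if "x \<in> carrier \<U>\<^sub>p" "u \<in> carrier \<U>\<^sub>p" "v \<in> carrier \<U>\<^sub>p" "u \<ominus>\<^bsub>\<U>\<^sub>p\<^esub> v \<in> \<P>" for x u v
  proof -
    have "x \<otimes>\<^bsub>\<U>\<^sub>p\<^esub> (u \<ominus>\<^bsub>\<U>\<^sub>p\<^esub> v) = x \<otimes>\<^bsub>\<U>\<^sub>p\<^esub> u \<ominus>\<^bsub>\<U>\<^sub>p\<^esub> x \<otimes>\<^bsub>\<U>\<^sub>p\<^esub> v"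
      by (rule additive_zero_minus(3)[OF Up.M.abelian_group_axioms Up.M.abelian_group_axioms])
        (use that in \<open>simp_all add: Up.mult_closed Up.mult_r_distr\<close>)
    moreover have "(u \<ominus>\<^bsub>\<U>\<^sub>p\<^esub> v) \<otimes>\<^bsub>\<U>\<^sub>p\<^esub> x = u \<otimes>\<^bsub>\<U>\<^sub>p\<^esub> x \<ominus>\<^bsub>\<U>\<^sub>p\<^esub> v \<otimes>\<^bsub>\<U>\<^sub>p\<^esub> x"
      by (rule additive_zero_minus(3)[OF Up.M.abelian_group_axioms Up.M.abelian_group_axioms,
            of "\<lambda>u. u \<otimes>\<^bsub>\<U>\<^sub>p\<^esub> x"])
        (use that in \<open>simp_all add: Up.mult_closed Up.mult_l_distr\<close>)
    ultimately show "x \<otimes>\<^bsub>\<U>\<^sub>p\<^esub> u \<ominus>\<^bsub>\<U>\<^sub>p\<^esub> x \<otimes>\<^bsub>\<U>\<^sub>p\<^esub> v \<in> \<P>" "u \<otimes>\<^bsub>\<U>\<^sub>p\<^esub> x \<ominus>\<^bsub>\<U>\<^sub>p\<^esub> v \<otimes>\<^bsub>\<U>\<^sub>p\<^esub> x \<in> \<P>"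
      using il[OF that(1,4)] ir[OF that(1,4)] by simp_all
  qed
  \<comment> \<open>Both sides are treated together, because on a generator the right-hand statement
    follows from the left-hand one by commutation. Stating them as equalities of cosets makes sums
    and scalar multiples immediate.\<close>
  define E where "E u \<longleftrightarrow> \<P> +>\<^bsub>\<U>\<^sub>p\<^esub> (?e \<otimes>\<^bsub>\<U>\<^sub>p\<^esub> u) = \<P> +>\<^bsub>\<U>\<^sub>p\<^esub> u \<and> \<P> +>\<^bsub>\<U>\<^sub>p\<^esub> (u \<otimes>\<^bsub>\<U>\<^sub>p\<^esub> ?e) = \<P> +>\<^bsub>\<U>\<^sub>p\<^esub> u" for u
  have "E u" if "u \<in> carrier \<U>\<^sub>p" for u
    using that
  proof (induction rule: lr_plus_induct)
    case (incl x)
    obtain a X where x: "x = (a, X)" "a \<in> carrier A" "X \<in> carrier \<Omega>"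
      using incl by (cases x) (auto simp: semidirect_simps)
    have "incl x \<otimes>\<^bsub>\<U>\<^sub>p\<^esub> ?e = ?e \<otimes>\<^bsub>\<U>\<^sub>p\<^esub> incl x"
      using H.incl_ops(4)[of x "(\<one>\<^bsub>A\<^esub>, \<zero>\<^bsub>\<Omega>\<^esub>)"] incl e lr_plus_subset incl_lr_plus[OF incl]
        Up.mult_closed[OF e incl_lr_plus[OF incl]] x
        Up.M.r_zero[of "?e \<otimes>\<^bsub>\<U>\<^sub>p\<^esub> incl x"] incl_zero
      by (simp add: semidirect_simps pair_closed kahler_anchor_one kahler_anchor_zero
          kahler_lie_zero lr_plus_simps(2-) M.minus_zero_right)
    moreover have "incl (sact \<one>\<^bsub>A\<^esub> x) \<ominus>\<^bsub>\<U>\<^sub>p\<^esub> ?e \<otimes>\<^bsub>\<U>\<^sub>p\<^esub> incl x \<in> \<P>"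
      unfolding lr_ideal_hull by (rule hull_inc) (intro lr_relsI one_closed incl)
    then have "incl x \<ominus>\<^bsub>\<U>\<^sub>p\<^esub> ?e \<otimes>\<^bsub>\<U>\<^sub>p\<^esub> incl x \<in> \<P>"
      using x by (simp add: semidirect_simps)
    then have "\<P> +>\<^bsub>\<U>\<^sub>p\<^esub> incl x = \<P> +>\<^bsub>\<U>\<^sub>p\<^esub> (?e \<otimes>\<^bsub>\<U>\<^sub>p\<^esub> incl x)"
      using Q.coset_eq_iff e incl incl_lr_plus Up.mult_closed by blast
    ultimately show ?case by (simp add: E_def)
  next
    case zero
    have "?e \<otimes>\<^bsub>\<U>\<^sub>p\<^esub> \<zero>\<^bsub>\<U>\<^sub>p\<^esub> = \<zero>\<^bsub>\<U>\<^sub>p\<^esub>" "\<zero>\<^bsub>\<U>\<^sub>p\<^esub> \<otimes>\<^bsub>\<U>\<^sub>p\<^esub> ?e = \<zero>\<^bsub>\<U>\<^sub>p\<^esub>"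
      using Up.mult_smult_l[of "\<zero>\<^bsub>K\<^esub>" "\<zero>\<^bsub>\<U>\<^sub>p\<^esub>" ?e] Up.mult_smult_r[of "\<zero>\<^bsub>K\<^esub>" ?e "\<zero>\<^bsub>\<U>\<^sub>p\<^esub>"] e
      by (simp_all add: Up.mult_closed)
    then show ?case by (simp add: E_def)
  next
    case (add u v)
    then show ?case
      using e by (simp add: E_def Up.mult_r_distr Up.mult_l_distr Up.mult_closed Q.quot_add[symmetric])
  next
    case (smult c u)
    then show ?case
      using e by (simp add: E_def Up.mult_smult_l Up.mult_smult_r Up.mult_closed Q.quot_smult[symmetric])
  next
    case (mult u v)
    then show ?case
      \<comment> \<open>By associativity \<open>e (u v)\<close> is \<open>(e u) v\<close> and
        \<open>(u v) e\<close> is \<open>u (v e)\<close>, where \<open>e\<close> is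
        \<open>1\<^sub>A'\<close>; \<open>cong\<close> multiplies the known congruence for one
        factor by the other factor.\<close>
      using e cong(2)[of v "?e \<otimes>\<^bsub>\<U>\<^sub>p\<^esub> u" u] cong(1)[of u "v \<otimes>\<^bsub>\<U>\<^sub>p\<^esub> ?e" v]
      by (simp add: E_def Q.coset_eq_iff Up.mult_closed Up.mult_assoc)
  qed
  then show ?thesis
    using e
    by (intro quotient_algebra.intro quotient_algebra_axioms.intro lr_plus_algebra
        lr_ideal_quotient_module il ir)
      (simp_all add: lr_plus_simps(5) E_def Q.coset_eq_iff Up.mult_closed)
qed

section \<open>The enveloping algebra as a target and its generation by the two canonical
  maps\<close>

lemma lr_env_algebra: "assoc_algebra K \<V>"
  unfolding lr_env_def by (rule quotient_algebra.quot_assoc_algebra[OF lr_ideal_quotient_algebra])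

lemma lr_env_hom: "(\<lambda>u. \<P> +>\<^bsub>\<U>\<^sub>p\<^esub> u) \<in> algebra_hom K \<U>\<^sub>p \<V>"
  unfolding lr_env_def by (rule quotient_algebra.coset_hom[OF lr_ideal_quotient_algebra])

lemma lr_env_cases:
  assumes "x \<in> carrier \<V>"
  obtains u where "u \<in> carrier \<U>\<^sub>p" "x = \<P> +>\<^bsub>\<U>\<^sub>p\<^esub> u"
  using assms quotient_module.quot_carrier[OF lr_ideal_quotient_module] unfolding lr_env_def by blast

lemma vincl_ops:
  "x \<in> carrier \<hh> \<Longrightarrow> vincl x \<in> carrier \<V>"
  "\<lbrakk>x \<in> carrier \<hh>; y \<in> carrier \<hh>\<rbrakk> \<Longrightarrow> vincl (x \<oplus>\<^bsub>\<hh>\<^esub> y) = vincl x \<oplus>\<^bsub>\<V>\<^esub> vincl y"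
  "\<lbrakk>c \<in> carrier K; x \<in> carrier \<hh>\<rbrakk> \<Longrightarrow> vincl (c \<odot>\<^bsub>\<hh>\<^esub> x) = c \<odot>\<^bsub>\<V>\<^esub> vincl x"
  "\<lbrakk>x \<in> carrier \<hh>; y \<in> carrier \<hh>\<rbrakk> \<Longrightarrow>
     vincl (lie \<hh> x y) = vincl x \<otimes>\<^bsub>\<V>\<^esub> vincl y \<ominus>\<^bsub>\<V>\<^esub> vincl y \<otimes>\<^bsub>\<V>\<^esub> vincl x"
  "\<lbrakk>a \<in> carrier A; x \<in> carrier \<hh>\<rbrakk> \<Longrightarrow> vincl (sact a x) = vincl (a, \<zero>\<^bsub>\<Omega>\<^esub>) \<otimes>\<^bsub>\<V>\<^esub> vincl x"
  "vincl (\<one>\<^bsub>A\<^esub>, \<zero>\<^bsub>\<Omega>\<^esub>) = \<one>\<^bsub>\<V>\<^esub>"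
proof -
  interpret V: assoc_algebra K \<V> by (rule lr_env_algebra)
  interpret Up: nonunital_algebra K \<U>\<^sub>p by (rule lr_plus_algebra)
  interpret Q: quotient_module K \<U>\<^sub>p \<P> by (rule lr_ideal_quotient_module)
  note hom = algebra_homD[OF lr_env_hom]
  show cl: "vincl x \<in> carrier \<V>" if "x \<in> carrier \<hh>" for x
    unfolding lr_env_incl_def using that by (intro hom incl_lr_plus)
  show "\<lbrakk>x \<in> carrier \<hh>; y \<in> carrier \<hh>\<rbrakk> \<Longrightarrow> vincl (x \<oplus>\<^bsub>\<hh>\<^esub> y) = vincl x \<oplus>\<^bsub>\<V>\<^esub> vincl y"
    "\<lbrakk>c \<in> carrier K; x \<in> carrier \<hh>\<rbrakk> \<Longrightarrow> vincl (c \<odot>\<^bsub>\<hh>\<^esub> x) = c \<odot>\<^bsub>\<V>\<^esub> vincl x"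
    unfolding lr_env_incl_def
    by (simp_all add: H.incl_ops(2,3) lr_plus_simps(2,6)[symmetric] hom incl_lr_plus)
  show "vincl (lie \<hh> x y) = vincl x \<otimes>\<^bsub>\<V>\<^esub> vincl y \<ominus>\<^bsub>\<V>\<^esub> vincl y \<otimes>\<^bsub>\<V>\<^esub> vincl x"
    if xy: "x \<in> carrier \<hh>" "y \<in> carrier \<hh>"
  proof -
    have "incl x \<otimes>\<^bsub>\<U>\<^sub>p\<^esub> incl y = incl y \<otimes>\<^bsub>\<U>\<^sub>p\<^esub> incl x \<oplus>\<^bsub>\<U>\<^sub>p\<^esub> incl (lie \<hh> x y)"
      using H.incl_ops(4)[OF xy] by (simp add: lr_plus_simps(2,3))
    then have "vincl x \<otimes>\<^bsub>\<V>\<^esub> vincl y = vincl y \<otimes>\<^bsub>\<V>\<^esub> vincl x \<oplus>\<^bsub>\<V>\<^esub> vincl (lie \<hh> x y)"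
      unfolding lr_env_incl_def using xy
      by (simp add: hom(2,3)[symmetric] incl_lr_plus semidirect_closed Up.mult_closed)
    then show ?thesis using V.M.eq_minus_iff xy cl semidirect_closed(3)[OF xy] by simp
  qed
  show "vincl (sact a x) = vincl (a, \<zero>\<^bsub>\<Omega>\<^esub>) \<otimes>\<^bsub>\<V>\<^esub> vincl x" if ax: "a \<in> carrier A" "x \<in> carrier \<hh>"
  proof -
    have "incl (sact a x) \<ominus>\<^bsub>\<U>\<^sub>p\<^esub> incl (a, \<zero>\<^bsub>\<Omega>\<^esub>) \<otimes>\<^bsub>\<U>\<^sub>p\<^esub> incl x \<in> \<P>"
      unfolding lr_ideal_hull by (rule hull_inc) (intro lr_relsI ax)
    then have "\<P> +>\<^bsub>\<U>\<^sub>p\<^esub> incl (sact a x) = \<P> +>\<^bsub>\<U>\<^sub>p\<^esub> (incl (a, \<zero>\<^bsub>\<Omega>\<^esub>) \<otimes>\<^bsub>\<U>\<^sub>p\<^esub> incl x)"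
      using ax by (simp add: Q.coset_eq_iff incl_lr_plus semidirect_closed pair_closed Up.mult_closed)
    then show ?thesis
      unfolding lr_env_incl_def using ax by (simp add: hom incl_lr_plus pair_closed)
  qed
  show "vincl (\<one>\<^bsub>A\<^esub>, \<zero>\<^bsub>\<Omega>\<^esub>) = \<one>\<^bsub>\<V>\<^esub>"
    using hom(4) by (simp add: lr_env_incl_def lr_plus_simps(5))
qed

lemma alpha_vincl: "alpha K A a = vincl (a, \<zero>\<^bsub>\<Omega>\<^esub>)"
  by (simp add: alpha_def kahler_simps)

lemma beta_vincl: "beta K A a = vincl (\<zero>\<^bsub>A\<^esub>, \<dd> a)"
  by (simp add: beta_def)

lemma lie_zero [simp]: "x \<in> carrier A \<Longrightarrow> lie A x \<zero>\<^bsub>A\<^esub> = \<zero>\<^bsub>A\<^esub>"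
  using lie_smult_right[of "\<zero>\<^bsub>K\<^esub>" x "\<one>\<^bsub>A\<^esub>"] by simp

text \<open>Every equation is an instance of the rules for \<open>vincl\<close> at pairs with a zero
  component. The action of \<open>A\<close> gives multiplicativity of \<open>alpha\<close> and, with
  the product rule for \<open>\<dd>\<close>, the relation for \<open>beta\<close> of a product. The
  bracket of two differentials gives the one for \<open>beta\<close> of a bracket, and the bracket
  of a differential with a function the one for \<open>alpha\<close> of a bracket.\<close>

lemma lr_env_rep: "poisson_rep K A \<V> (alpha K A) (beta K A)"
proof -
  interpret Om: module A \<Omega> by (rule kahler_module_module)
  note pg = pair_closed d_ops(1)
  have sum: "vincl (a \<oplus>\<^bsub>A\<^esub> b, X \<oplus>\<^bsub>\<Omega>\<^esub> Y) = vincl (a, X) \<oplus>\<^bsub>\<V>\<^esub> vincl (b, Y)"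
    if "a \<in> carrier A" "b \<in> carrier A" "X \<in> carrier \<Omega>" "Y \<in> carrier \<Omega>" for a b X Y
    using vincl_ops(2)[of "(a, X)" "(b, Y)"] that by (simp add: semidirect_simps)
  have smult: "vincl (c \<odot>\<^bsub>A\<^esub> a, (c \<odot>\<^bsub>A\<^esub> \<one>\<^bsub>A\<^esub>) \<odot>\<^bsub>\<Omega>\<^esub> X) = c \<odot>\<^bsub>\<V>\<^esub> vincl (a, X)"
    if "c \<in> carrier K" "a \<in> carrier A" "X \<in> carrier \<Omega>" for c a X
    using vincl_ops(3)[of c "(a, X)"] that by (simp add: semidirect_simps)
  have act: "vincl (a \<otimes>\<^bsub>A\<^esub> b, a \<odot>\<^bsub>\<Omega>\<^esub> X) = vincl (a, \<zero>\<^bsub>\<Omega>\<^esub>) \<otimes>\<^bsub>\<V>\<^esub> vincl (b, X)"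
    if "a \<in> carrier A" "b \<in> carrier A" "X \<in> carrier \<Omega>" for a b X
    using vincl_ops(5)[of a "(b, X)"] that by (simp add: semidirect_simps)
  have br: "vincl (kahler_anchor A X b \<ominus>\<^bsub>A\<^esub> kahler_anchor A Y a, kahler_lie K A X Y) =
      vincl (a, X) \<otimes>\<^bsub>\<V>\<^esub> vincl (b, Y) \<ominus>\<^bsub>\<V>\<^esub> vincl (b, Y) \<otimes>\<^bsub>\<V>\<^esub> vincl (a, X)"
    if "a \<in> carrier A" "b \<in> carrier A" "X \<in> carrier \<Omega>" "Y \<in> carrier \<Omega>" for a b X Y
    using vincl_ops(4)[of "(a, X)" "(b, Y)"] that by (simp add: semidirect_simps)
  show ?thesis
    unfolding alpha_vincl beta_vincl
  proof (intro poisson_rep.intro poisson_rep_axioms.intro poisson_algebra_axioms lr_env_algebra)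
    fix x y assume xy: "x \<in> carrier A" "y \<in> carrier A"
    show "vincl (x \<oplus>\<^bsub>A\<^esub> y, \<zero>\<^bsub>\<Omega>\<^esub>) = vincl (x, \<zero>\<^bsub>\<Omega>\<^esub>) \<oplus>\<^bsub>\<V>\<^esub> vincl (y, \<zero>\<^bsub>\<Omega>\<^esub>)"
      using sum[of x y "\<zero>\<^bsub>\<Omega>\<^esub>" "\<zero>\<^bsub>\<Omega>\<^esub>"] xy by simp
    show "vincl (\<zero>\<^bsub>A\<^esub>, \<dd> (x \<oplus>\<^bsub>A\<^esub> y)) = vincl (\<zero>\<^bsub>A\<^esub>, \<dd> x) \<oplus>\<^bsub>\<V>\<^esub> vincl (\<zero>\<^bsub>A\<^esub>, \<dd> y)"
      using sum[of "\<zero>\<^bsub>A\<^esub>" "\<zero>\<^bsub>A\<^esub>" "\<dd> x" "\<dd> y"] xy by (simp add: d_ops)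
    show "vincl (x \<otimes>\<^bsub>A\<^esub> y, \<zero>\<^bsub>\<Omega>\<^esub>) = vincl (x, \<zero>\<^bsub>\<Omega>\<^esub>) \<otimes>\<^bsub>\<V>\<^esub> vincl (y, \<zero>\<^bsub>\<Omega>\<^esub>)"
      using act[of x y "\<zero>\<^bsub>\<Omega>\<^esub>"] xy by simp
    show "vincl (\<zero>\<^bsub>A\<^esub>, \<dd> (lie A x y)) = vincl (\<zero>\<^bsub>A\<^esub>, \<dd> x) \<otimes>\<^bsub>\<V>\<^esub> vincl (\<zero>\<^bsub>A\<^esub>, \<dd> y)
        \<ominus>\<^bsub>\<V>\<^esub> vincl (\<zero>\<^bsub>A\<^esub>, \<dd> y) \<otimes>\<^bsub>\<V>\<^esub> vincl (\<zero>\<^bsub>A\<^esub>, \<dd> x)"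
      using br[of "\<zero>\<^bsub>A\<^esub>" "\<zero>\<^bsub>A\<^esub>" "\<dd> x" "\<dd> y"] xy
      by (simp add: d_ops(1) kahler_anchor_d kahler_lie_d M.minus_zero_right)
    show "vincl (\<zero>\<^bsub>A\<^esub>, \<dd> (x \<otimes>\<^bsub>A\<^esub> y)) = vincl (y, \<zero>\<^bsub>\<Omega>\<^esub>) \<otimes>\<^bsub>\<V>\<^esub> vincl (\<zero>\<^bsub>A\<^esub>, \<dd> x)
        \<oplus>\<^bsub>\<V>\<^esub> vincl (x, \<zero>\<^bsub>\<Omega>\<^esub>) \<otimes>\<^bsub>\<V>\<^esub> vincl (\<zero>\<^bsub>A\<^esub>, \<dd> y)"
      using sum[of "\<zero>\<^bsub>A\<^esub>" "\<zero>\<^bsub>A\<^esub>" "y \<odot>\<^bsub>\<Omega>\<^esub> \<dd> x" "x \<odot>\<^bsub>\<Omega>\<^esub> \<dd> y"]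
        act[of x "\<zero>\<^bsub>A\<^esub>" "\<dd> y"] act[of y "\<zero>\<^bsub>A\<^esub>" "\<dd> x"] xy
      by (simp add: d_ops(1,4) Om.M.a_comm)
    show "vincl (lie A x y, \<zero>\<^bsub>\<Omega>\<^esub>) = vincl (\<zero>\<^bsub>A\<^esub>, \<dd> x) \<otimes>\<^bsub>\<V>\<^esub> vincl (y, \<zero>\<^bsub>\<Omega>\<^esub>)
        \<ominus>\<^bsub>\<V>\<^esub> vincl (y, \<zero>\<^bsub>\<Omega>\<^esub>) \<otimes>\<^bsub>\<V>\<^esub> vincl (\<zero>\<^bsub>A\<^esub>, \<dd> x)"
      using br[of "\<zero>\<^bsub>A\<^esub>" y "\<dd> x" "\<zero>\<^bsub>\<Omega>\<^esub>"] xy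
      by (simp add: d_ops(1) kahler_anchor_d kahler_anchor_zero kahler_lie_zero M.minus_zero_right)
  next
    fix c x assume cx: "c \<in> carrier K" "x \<in> carrier A"
    show "vincl (c \<odot>\<^bsub>A\<^esub> x, \<zero>\<^bsub>\<Omega>\<^esub>) = c \<odot>\<^bsub>\<V>\<^esub> vincl (x, \<zero>\<^bsub>\<Omega>\<^esub>)"
      using smult[of c x "\<zero>\<^bsub>\<Omega>\<^esub>"] cx by simp
    show "vincl (\<zero>\<^bsub>A\<^esub>, \<dd> (c \<odot>\<^bsub>A\<^esub> x)) = c \<odot>\<^bsub>\<V>\<^esub> vincl (\<zero>\<^bsub>A\<^esub>, \<dd> x)"
      using smult[of c "\<zero>\<^bsub>A\<^esub>" "\<dd> x"] cx by (simp add: d_ops(1,3))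
  qed (simp_all add: vincl_ops pg)
qed

text \<open>\<open>alpha\<close> and \<open>beta\<close> generate: the class of
  \<open>(a, X)\<close> is \<open>alpha a\<close> plus that of \<open>(0, X)\<close>, the form
  \<open>X\<close> is a sum of terms \<open>a db\<close>, and the defining ideal identifies the
  class of \<open>(0, a db)\<close> with the product of \<open>alpha a\<close> and
  \<open>beta b\<close>.\<close>

lemma lr_env_hom_eq:
  assumes C: "assoc_algebra K C"
    and f: "f \<in> algebra_hom K \<V> C" and f': "f' \<in> algebra_hom K \<V> C"
    and eq: "\<And>a. a \<in> carrier A \<Longrightarrow> f (alpha K A a) = f' (alpha K A a)"
      "\<And>a. a \<in> carrier A \<Longrightarrow> f (beta K A a) = f' (beta K A a)"
    and x: "x \<in> carrier \<V>"
  shows "f x = f' x"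
proof -
  interpret V: poisson_rep K A \<V> "alpha K A" "beta K A" by (rule lr_env_rep)
  interpret Om: module A \<Omega> by (rule kahler_module_module)
  interpret F: module A \<F>\<^sub>A by (rule kahler_free_module)
  interpret C: assoc_algebra K C by fact
  note fD = algebra_homD[OF f] and f'D = algebra_homD[OF f']
  have sum: "vincl (a, X) = alpha K A a \<oplus>\<^bsub>\<V>\<^esub> vincl (\<zero>\<^bsub>A\<^esub>, X)"
    if "a \<in> carrier A" "X \<in> carrier \<Omega>" for a X
    using vincl_ops(2)[of "(a, \<zero>\<^bsub>\<Omega>\<^esub>)" "(\<zero>\<^bsub>A\<^esub>, X)"] that
    by (simp add: pair_closed alpha_vincl) (simp add: semidirect_simps)
  have forms: "f (vincl (\<zero>\<^bsub>A\<^esub>, cls u)) = f' (vincl (\<zero>\<^bsub>A\<^esub>, cls u))" if "u \<in> carrier \<F>\<^sub>A" for u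
  proof (rule additive_ext[OF M_cring C.M.abelian_group_axioms _ _ _ _ _ that])
    fix u v assume uv: "u \<in> carrier \<F>\<^sub>A" "v \<in> carrier \<F>\<^sub>A"
    then have add: "vincl (\<zero>\<^bsub>A\<^esub>, cls (u \<oplus>\<^bsub>\<F>\<^sub>A\<^esub> v)) = vincl (\<zero>\<^bsub>A\<^esub>, cls u) \<oplus>\<^bsub>\<V>\<^esub> vincl (\<zero>\<^bsub>A\<^esub>, cls v)"
      using vincl_ops(2)[of "(\<zero>\<^bsub>A\<^esub>, cls u)" "(\<zero>\<^bsub>A\<^esub>, cls v)"]
      by (simp add: pair_closed cls_ops) (simp add: semidirect_simps)
    show "f (vincl (\<zero>\<^bsub>A\<^esub>, cls (u \<oplus>\<^bsub>\<F>\<^sub>A\<^esub> v))) = f (vincl (\<zero>\<^bsub>A\<^esub>, cls u)) \<oplus>\<^bsub>C\<^esub> f (vincl (\<zero>\<^bsub>A\<^esub>, cls v))"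
      "f' (vincl (\<zero>\<^bsub>A\<^esub>, cls (u \<oplus>\<^bsub>\<F>\<^sub>A\<^esub> v))) = f' (vincl (\<zero>\<^bsub>A\<^esub>, cls u)) \<oplus>\<^bsub>C\<^esub> f' (vincl (\<zero>\<^bsub>A\<^esub>, cls v))"
      unfolding add using uv by (simp_all add: fD(2) f'D(2) vincl_ops(1) pair_closed cls_ops(1))
  next
    fix a b assume ab: "a \<in> carrier A" "b \<in> carrier A"
    have "vincl (\<zero>\<^bsub>A\<^esub>, cls (a \<odot>\<^bsub>\<F>\<^sub>A\<^esub> delta A b)) = alpha K A a \<otimes>\<^bsub>\<V>\<^esub> beta K A b"
      using vincl_ops(5)[of a "(\<zero>\<^bsub>A\<^esub>, \<dd> b)"] ab
      by (simp add: pair_closed d_ops alpha_vincl beta_vincl) (simp add: semidirect_simps cls_ops kahler_d_def)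
    then show "f (vincl (\<zero>\<^bsub>A\<^esub>, cls (a \<odot>\<^bsub>\<F>\<^sub>A\<^esub> delta A b))) = f' (vincl (\<zero>\<^bsub>A\<^esub>, cls (a \<odot>\<^bsub>\<F>\<^sub>A\<^esub> delta A b)))"
      using ab by (simp add: fD(3) f'D(3) V.m_cl V.h_cl eq)
  qed (simp_all add: fD(1) f'D(1) vincl_ops(1) pair_closed cls_ops(1))
  interpret Up: nonunital_algebra K \<U>\<^sub>p by (rule lr_plus_algebra)
  note hom = algebra_homD[OF lr_env_hom]
  have f0: "f \<zero>\<^bsub>\<V>\<^esub> = \<zero>\<^bsub>C\<^esub>"
    by (rule additive_zero_minus(1)[OF V.C.M.abelian_group_axioms C.M.abelian_group_axioms])
      (simp_all add: fD)
  have f'0: "f' \<zero>\<^bsub>\<V>\<^esub> = \<zero>\<^bsub>C\<^esub>"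
    by (rule additive_zero_minus(1)[OF V.C.M.abelian_group_axioms C.M.abelian_group_axioms])
      (simp_all add: f'D)
  have v0: "\<P> +>\<^bsub>\<U>\<^sub>p\<^esub> \<zero>\<^bsub>\<U>\<^sub>p\<^esub> = \<zero>\<^bsub>\<V>\<^esub>"
    by (rule additive_zero_minus(1)[OF Up.M.abelian_group_axioms V.C.M.abelian_group_axioms])
      (simp_all add: hom)
  have "f (\<P> +>\<^bsub>\<U>\<^sub>p\<^esub> u) = f' (\<P> +>\<^bsub>\<U>\<^sub>p\<^esub> u)" if "u \<in> carrier \<U>\<^sub>p" for u
    using that
  proof (induction rule: lr_plus_induct)
    case (incl x)
    obtain a u where x: "x = (a, cls u)" "a \<in> carrier A" "u \<in> carrier \<F>\<^sub>A"
      using incl by (cases x) (auto simp: semidirect_simps elim: kahler_module_cases)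
    have "\<P> +>\<^bsub>\<U>\<^sub>p\<^esub> incl x = alpha K A a \<oplus>\<^bsub>\<V>\<^esub> vincl (\<zero>\<^bsub>A\<^esub>, cls u)"
      using sum[of a "cls u"] x cls_ops(1) by (simp add: lr_env_incl_def)
    then show ?case
      using x by (simp add: fD(2) f'D(2) V.m_cl vincl_ops(1) pair_closed cls_ops(1) eq(1) forms)
  qed (simp_all add: hom fD f'D v0 f0 f'0)
  then show ?thesis using x by (auto elim: lr_env_cases)
qed

end

section \<open>From a pair of maps to a homomorphism on the Lie-Rinehart side\<close>

context poisson_rep
begin

lemma h_m_commute: "\<lbrakk>x \<in> carrier A; y \<in> carrier A\<rbrakk> \<Longrightarrow> h x \<otimes>\<^bsub>C\<^esub> m y = m y \<otimes>\<^bsub>C\<^esub> h x \<oplus>\<^bsub>C\<^esub> m (lie A x y)"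
  by (rule C.M.eq_minus_iff[THEN iffD1, OF _ _ _ m_lie]) (simp_all add: m_cl h_cl)

lemma h_h_commute: "\<lbrakk>x \<in> carrier A; y \<in> carrier A\<rbrakk> \<Longrightarrow> h x \<otimes>\<^bsub>C\<^esub> h y = h y \<otimes>\<^bsub>C\<^esub> h x \<oplus>\<^bsub>C\<^esub> h (lie A x y)"
  by (rule C.M.eq_minus_iff[THEN iffD1, OF _ _ _ h_lie]) (simp_all add: h_cl)

lemma m_m_commute: "\<lbrakk>x \<in> carrier A; y \<in> carrier A\<rbrakk> \<Longrightarrow> m x \<otimes>\<^bsub>C\<^esub> m y = m y \<otimes>\<^bsub>C\<^esub> m x"
  by (simp add: m_mult[symmetric] m_comm)

lemma m_minus: "\<lbrakk>x \<in> carrier A; y \<in> carrier A\<rbrakk> \<Longrightarrow> m (x \<ominus>\<^bsub>A\<^esub> y) = m x \<ominus>\<^bsub>C\<^esub> m y"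
  by (rule additive_zero_minus(3)[OF M.abelian_group_axioms C.M.abelian_group_axioms])
    (simp_all add: m_cl m_add)

definition dlift where "dlift u = lift_sum A C (\<lambda>f a. m a \<otimes>\<^bsub>C\<^esub> h f) u"

definition dmap where "dmap X = dlift (kahler_rep X)"

lemma dlift_ops:
  "u \<in> carrier \<F>\<^sub>A \<Longrightarrow> dlift u \<in> carrier C"
  "u \<in> carrier \<F>\<^sub>A \<Longrightarrow> v \<in> carrier \<F>\<^sub>A \<Longrightarrow> dlift (u \<oplus>\<^bsub>\<F>\<^sub>A\<^esub> v) = dlift u \<oplus>\<^bsub>C\<^esub> dlift v"
  "u \<in> carrier \<F>\<^sub>A \<Longrightarrow> v \<in> carrier \<F>\<^sub>A \<Longrightarrow> dlift (u \<ominus>\<^bsub>\<F>\<^sub>A\<^esub> v) = dlift u \<ominus>\<^bsub>C\<^esub> dlift v"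
  "f \<in> carrier A \<Longrightarrow> a \<in> carrier A \<Longrightarrow> dlift (a \<odot>\<^bsub>\<F>\<^sub>A\<^esub> delta A f) = m a \<otimes>\<^bsub>C\<^esub> h f"
  "f \<in> carrier A \<Longrightarrow> dlift (delta A f) = h f"
  "a \<in> carrier A \<Longrightarrow> u \<in> carrier \<F>\<^sub>A \<Longrightarrow> dlift (a \<odot>\<^bsub>\<F>\<^sub>A\<^esub> u) = m a \<otimes>\<^bsub>C\<^esub> dlift u"
proof -
  interpret T: additive_family A "carrier A" C "\<lambda>f a. m a \<otimes>\<^bsub>C\<^esub> h f"
    by (intro additive_family.intro additive_family_axioms.intro M_cring C.M.abelian_group_axioms)
      (simp_all add: m_cl h_cl m_add C.B.l_distr)
  show "u \<in> carrier \<F>\<^sub>A \<Longrightarrow> dlift u \<in> carrier C"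
    "u \<in> carrier \<F>\<^sub>A \<Longrightarrow> v \<in> carrier \<F>\<^sub>A \<Longrightarrow> dlift (u \<oplus>\<^bsub>\<F>\<^sub>A\<^esub> v) = dlift u \<oplus>\<^bsub>C\<^esub> dlift v"
    "u \<in> carrier \<F>\<^sub>A \<Longrightarrow> v \<in> carrier \<F>\<^sub>A \<Longrightarrow> dlift (u \<ominus>\<^bsub>\<F>\<^sub>A\<^esub> v) = dlift u \<ominus>\<^bsub>C\<^esub> dlift v"
    "f \<in> carrier A \<Longrightarrow> a \<in> carrier A \<Longrightarrow> dlift (a \<odot>\<^bsub>\<F>\<^sub>A\<^esub> delta A f) = m a \<otimes>\<^bsub>C\<^esub> h f"
    unfolding dlift_def
    by (rule T.lift_sum_closed T.lift_sum_add T.lift_sum_minus T.lift_sum_single; assumption)+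
  show "f \<in> carrier A \<Longrightarrow> dlift (delta A f) = h f"
    using T.lift_sum_delta[of f] by (simp add: dlift_def m_one h_cl)
  show "a \<in> carrier A \<Longrightarrow> u \<in> carrier \<F>\<^sub>A \<Longrightarrow> dlift (a \<odot>\<^bsub>\<F>\<^sub>A\<^esub> u) = m a \<otimes>\<^bsub>C\<^esub> dlift u"
    unfolding dlift_def by (rule T.lift_sum_smult) (simp_all add: m_cl h_cl m_mult C.B.r_distr C.B.m_assoc)
qed

lemma m_scalar:
  assumes "c \<in> carrier K" "y \<in> carrier C"
  shows "m (c \<odot>\<^bsub>A\<^esub> \<one>\<^bsub>A\<^esub>) \<otimes>\<^bsub>C\<^esub> y = c \<odot>\<^bsub>C\<^esub> y"
  using assms by (simp add: m_smult m_one C.mult_smult_l)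

text \<open>Through \<open>m\<close> the algebra \<open>C\<close> is a left \<open>A\<close>-module,
  and \<open>h_mult\<close> says that \<open>h\<close> is a derivation into it. So this is the
  universal property of differentials, with \<open>h_add\<close> and \<open>h_smult\<close> taking
  care of the linear relations.\<close>

lemma dlift_null:
  assumes "u \<in> \<N>"
  shows "dlift u = \<zero>\<^bsub>C\<^esub>"
proof (rule kahler_sub_null[OF C.M.abelian_group_axioms _ _ _ _ assms])
  interpret F: module A \<F>\<^sub>A by (rule kahler_free_module)
  show "dlift (a \<odot>\<^bsub>\<F>\<^sub>A\<^esub> u) = \<zero>\<^bsub>C\<^esub>" if "a \<in> carrier A" "u \<in> \<N>" "dlift u = \<zero>\<^bsub>C\<^esub>" for a u
    using that submoduleD(1)[OF kahler_free_module kahler_sub_submodule]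
    by (simp add: dlift_ops m_cl subset_iff)
  show "dlift r = \<zero>\<^bsub>C\<^esub>" if "r \<in> kahler_rels K A" for r
    using that
    by (cases rule: kahler_rels_cases)
      (simp_all add: dlift_ops h_add h_smult h_mult m_scalar m_cl h_cl C.M.minus_eq_zero_iff C.M.a_comm)
qed (simp_all add: dlift_ops)

lemma dmap_cls:
  assumes "u \<in> carrier \<F>\<^sub>A"
  shows "dmap (cls u) = dlift u"
  unfolding dmap_def kahler_rep_def
  by (rule quotient_module.additive_lift[OF kahler_quotient C.M.abelian_group_axioms])
    (simp_all add: assms dlift_ops dlift_null)

lemma dmap_ops:
  "X \<in> carrier \<Omega> \<Longrightarrow> dmap X \<in> carrier C"
  "X \<in> carrier \<Omega> \<Longrightarrow> Y \<in> carrier \<Omega> \<Longrightarrow> dmap (X \<oplus>\<^bsub>\<Omega>\<^esub> Y) = dmap X \<oplus>\<^bsub>C\<^esub> dmap Y"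
  "a \<in> carrier A \<Longrightarrow> X \<in> carrier \<Omega> \<Longrightarrow> dmap (a \<odot>\<^bsub>\<Omega>\<^esub> X) = m a \<otimes>\<^bsub>C\<^esub> dmap X"
  "f \<in> carrier A \<Longrightarrow> dmap (\<dd> f) = h f"
proof -
  interpret F: module A \<F>\<^sub>A by (rule kahler_free_module)
  show "X \<in> carrier \<Omega> \<Longrightarrow> dmap X \<in> carrier C"
    "a \<in> carrier A \<Longrightarrow> X \<in> carrier \<Omega> \<Longrightarrow> dmap (a \<odot>\<^bsub>\<Omega>\<^esub> X) = m a \<otimes>\<^bsub>C\<^esub> dmap X"
    by (elim kahler_module_cases; simp add: cls_ops(2,3)[symmetric] dmap_cls dlift_ops)+
  show "X \<in> carrier \<Omega> \<Longrightarrow> Y \<in> carrier \<Omega> \<Longrightarrow> dmap (X \<oplus>\<^bsub>\<Omega>\<^esub> Y) = dmap X \<oplus>\<^bsub>C\<^esub> dmap Y"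
    by (elim kahler_module_cases; simp add: cls_ops(2,3)[symmetric] dmap_cls dlift_ops)+
  show "f \<in> carrier A \<Longrightarrow> dmap (\<dd> f) = h f"
    by (simp add: kahler_d_def dmap_cls dlift_ops)
qed

lemma dmap_minus: "X \<in> carrier \<Omega> \<Longrightarrow> Y \<in> carrier \<Omega> \<Longrightarrow> dmap (X \<ominus>\<^bsub>\<Omega>\<^esub> Y) = dmap X \<ominus>\<^bsub>C\<^esub> dmap Y"
  and dmap_zero: "dmap \<zero>\<^bsub>\<Omega>\<^esub> = \<zero>\<^bsub>C\<^esub>"
  using additive_zero_minus[OF module.axioms(2)[OF kahler_module_module] C.M.abelian_group_axioms, of dmap]
  by (simp_all add: dmap_ops)

text \<open>Moving \<open>m b\<close> to the left past \<open>h f\<close> produces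
  \<open>m {f,b}\<close>; the coefficient \<open>m a\<close> in front turns this into
  \<open>m\<close> of the anchor of \<open>a df\<close> at \<open>b\<close>.\<close>

lemma dmap_anchor:
  assumes X: "X \<in> carrier \<Omega>" and b: "b \<in> carrier A"
  shows "dmap X \<otimes>\<^bsub>C\<^esub> m b = m b \<otimes>\<^bsub>C\<^esub> dmap X \<oplus>\<^bsub>C\<^esub> m (kahler_anchor A X b)"
proof -
  obtain u where u: "u \<in> carrier \<F>\<^sub>A" "X = cls u" using X by (rule kahler_module_cases)
  have "dlift u \<otimes>\<^bsub>C\<^esub> m b = m b \<otimes>\<^bsub>C\<^esub> dlift u \<oplus>\<^bsub>C\<^esub> m (anchor_sum u b)"
  proof (rule additive_ext[OF M_cring C.M.abelian_group_axioms _ _ _ _ _ u(1)])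
    fix a f assume af: "a \<in> carrier A" "f \<in> carrier A"
    have "(m a \<otimes>\<^bsub>C\<^esub> h f) \<otimes>\<^bsub>C\<^esub> m b = (m a \<otimes>\<^bsub>C\<^esub> m b) \<otimes>\<^bsub>C\<^esub> h f \<oplus>\<^bsub>C\<^esub> m a \<otimes>\<^bsub>C\<^esub> m (lie A f b)"
      using af b by (simp add: C.B.m_assoc m_cl h_cl h_m_commute C.B.r_distr)
    then show "dlift (a \<odot>\<^bsub>\<F>\<^sub>A\<^esub> delta A f) \<otimes>\<^bsub>C\<^esub> m b =
        m b \<otimes>\<^bsub>C\<^esub> dlift (a \<odot>\<^bsub>\<F>\<^sub>A\<^esub> delta A f) \<oplus>\<^bsub>C\<^esub> m (anchor_sum (a \<odot>\<^bsub>\<F>\<^sub>A\<^esub> delta A f) b)"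
      using af b by (simp add: dlift_ops anchor_sum_ops m_mult m_m_commute[of a b] C.B.m_assoc m_cl h_cl)
  qed (use b in \<open>simp_all add: dlift_ops anchor_sum_ops m_cl m_add C.B.l_distr C.B.r_distr C.M.a_ac\<close>)
  then show ?thesis using u b by (simp add: dmap_cls kahler_anchor_cls)
qed

lemma dmap_basic_bracket:
  assumes "f \<in> carrier A" "a \<in> carrier A" "e \<in> carrier A" "b \<in> carrier A"
  shows "(m a \<otimes>\<^bsub>C\<^esub> h f) \<otimes>\<^bsub>C\<^esub> (m b \<otimes>\<^bsub>C\<^esub> h e) = (m b \<otimes>\<^bsub>C\<^esub> h e) \<otimes>\<^bsub>C\<^esub> (m a \<otimes>\<^bsub>C\<^esub> h f) \<oplus>\<^bsub>C\<^esub> dmap (basic_bracket f a e b)"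
proof -
  interpret Om: module A \<Omega> by (rule kahler_module_module)
  \<comment> \<open>\<open>?P\<close> is the part common to both products once every
    \<open>m\<close> stands on the left; \<open>?Q\<close>, \<open>?R\<close> and \<open>?S\<close>
    are the images of the three terms of \<open>[a df, b de]\<close>.\<close>
  let ?P = "m (a \<otimes>\<^bsub>A\<^esub> b) \<otimes>\<^bsub>C\<^esub> (h e \<otimes>\<^bsub>C\<^esub> h f)" and ?Q = "m (a \<otimes>\<^bsub>A\<^esub> b) \<otimes>\<^bsub>C\<^esub> h (lie A f e)"
    and ?R = "m (a \<otimes>\<^bsub>A\<^esub> lie A f b) \<otimes>\<^bsub>C\<^esub> h e" and ?S = "m (b \<otimes>\<^bsub>A\<^esub> lie A e a) \<otimes>\<^bsub>C\<^esub> h f"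
  \<comment> \<open>The normal form of such a product: \<open>m y\<close> moves left past
    \<open>h p\<close>, at the cost of the term with \<open>{p,y}\<close>.\<close>
  have expand: "(m x \<otimes>\<^bsub>C\<^esub> h p) \<otimes>\<^bsub>C\<^esub> (m y \<otimes>\<^bsub>C\<^esub> h q) =
      m (x \<otimes>\<^bsub>A\<^esub> y) \<otimes>\<^bsub>C\<^esub> (h p \<otimes>\<^bsub>C\<^esub> h q) \<oplus>\<^bsub>C\<^esub> m (x \<otimes>\<^bsub>A\<^esub> lie A p y) \<otimes>\<^bsub>C\<^esub> h q"
    if "x \<in> carrier A" "p \<in> carrier A" "y \<in> carrier A" "q \<in> carrier A" for x p y q
  proof -
    have "(m x \<otimes>\<^bsub>C\<^esub> h p) \<otimes>\<^bsub>C\<^esub> (m y \<otimes>\<^bsub>C\<^esub> h q) = m x \<otimes>\<^bsub>C\<^esub> ((h p \<otimes>\<^bsub>C\<^esub> m y) \<otimes>\<^bsub>C\<^esub> h q)"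
      using that by (simp add: C.B.m_assoc m_cl h_cl)
    also have "\<dots> = m (x \<otimes>\<^bsub>A\<^esub> y) \<otimes>\<^bsub>C\<^esub> (h p \<otimes>\<^bsub>C\<^esub> h q) \<oplus>\<^bsub>C\<^esub> m (x \<otimes>\<^bsub>A\<^esub> lie A p y) \<otimes>\<^bsub>C\<^esub> h q"
      using that by (simp add: h_m_commute m_mult C.B.m_assoc m_cl h_cl C.B.l_distr C.B.r_distr)
    finally show ?thesis .
  qed
  have cl: "?P \<in> carrier C" "?Q \<in> carrier C" "?R \<in> carrier C" "?S \<in> carrier C"
    using assms by (simp_all add: m_cl h_cl)
  have "dmap (basic_bracket f a e b) = (?Q \<oplus>\<^bsub>C\<^esub> ?R) \<ominus>\<^bsub>C\<^esub> ?S"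
    using assms by (simp add: basic_bracket_def dmap_minus dmap_ops d_ops(1))
  moreover have "(m b \<otimes>\<^bsub>C\<^esub> h e) \<otimes>\<^bsub>C\<^esub> (m a \<otimes>\<^bsub>C\<^esub> h f) = ?P \<oplus>\<^bsub>C\<^esub> ?S"
    using assms by (simp add: expand m_comm[of b a])
  moreover have "(m a \<otimes>\<^bsub>C\<^esub> h f) \<otimes>\<^bsub>C\<^esub> (m b \<otimes>\<^bsub>C\<^esub> h e) = ?P \<oplus>\<^bsub>C\<^esub> (?Q \<oplus>\<^bsub>C\<^esub> ?R)"
    using assms cl by (simp add: expand h_h_commute[of f e] C.B.r_distr m_cl h_cl C.M.a_assoc)
  ultimately show ?thesis
    using C.M.diff_cancel[of ?P "?Q \<oplus>\<^bsub>C\<^esub> ?R" ?S] cl by simp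
qed

lemma dmap_lie:
  assumes X: "X \<in> carrier \<Omega>" and Y: "Y \<in> carrier \<Omega>"
  shows "dmap X \<otimes>\<^bsub>C\<^esub> dmap Y = dmap Y \<otimes>\<^bsub>C\<^esub> dmap X \<oplus>\<^bsub>C\<^esub> dmap (kahler_lie K A X Y)"
proof -
  obtain u where u: "u \<in> carrier \<F>\<^sub>A" "X = cls u" using X by (rule kahler_module_cases)
  obtain v where v: "v \<in> carrier \<F>\<^sub>A" "Y = cls v" using Y by (rule kahler_module_cases)
  have "dlift u \<otimes>\<^bsub>C\<^esub> dlift v = dlift v \<otimes>\<^bsub>C\<^esub> dlift u \<oplus>\<^bsub>C\<^esub> dmap (bracket u v)"
  proof (rule biadditive_ext[OF M_cring C.M.abelian_group_axioms _ _ _ _ _ _ _ u(1) v(1)])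
    fix a f b e assume *: "a \<in> carrier A" "f \<in> carrier A" "b \<in> carrier A" "e \<in> carrier A"
    show "dlift (a \<odot>\<^bsub>\<F>\<^sub>A\<^esub> delta A f) \<otimes>\<^bsub>C\<^esub> dlift (b \<odot>\<^bsub>\<F>\<^sub>A\<^esub> delta A e) =
        dlift (b \<odot>\<^bsub>\<F>\<^sub>A\<^esub> delta A e) \<otimes>\<^bsub>C\<^esub> dlift (a \<odot>\<^bsub>\<F>\<^sub>A\<^esub> delta A f)
        \<oplus>\<^bsub>C\<^esub> dmap (bracket (a \<odot>\<^bsub>\<F>\<^sub>A\<^esub> delta A f) (b \<odot>\<^bsub>\<F>\<^sub>A\<^esub> delta A e))"
      using dmap_basic_bracket[of f a e b] * by (simp only: dlift_ops bracket_single)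
  qed (simp_all add: dlift_ops bracket_closed bracket_add_left bracket_add_right dmap_ops(1,2)
      C.B.l_distr C.B.r_distr C.M.a_ac)
  then show ?thesis using u v by (simp add: dmap_cls kahler_lie_cls)
qed

definition psi where "psi z = m (fst z) \<oplus>\<^bsub>C\<^esub> dmap (snd z)"

lemma psi_lie:
  assumes "x \<in> carrier \<hh>" "y \<in> carrier \<hh>"
  shows "psi x \<otimes>\<^bsub>C\<^esub> psi y = psi y \<otimes>\<^bsub>C\<^esub> psi x \<oplus>\<^bsub>C\<^esub> psi (lie \<hh> x y)"
proof -
  obtain a X b Y where x: "x = (a, X)" "a \<in> carrier A" "X \<in> carrier \<Omega>"
    and y: "y = (b, Y)" "b \<in> carrier A" "Y \<in> carrier \<Omega>"
    using assms by (cases x; cases y) (auto simp: semidirect_simps)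
  note cl = x(2,3) y(2,3) m_cl dmap_ops(1) kahler_anchor_closed kahler_lie_closed
  \<comment> \<open>In either order the product contains \<open>?p\<close>, since values of
    \<open>m\<close> commute. Exchanging a form with a function leaves \<open>?t\<close> or
    \<open>?s\<close>, depending on the order, and exchanging the two forms leaves
    \<open>?l\<close>; the surplus of one order minus that of the other is the image of the
    bracket.\<close>
  let ?s = "m (kahler_anchor A Y a)" and ?t = "m (kahler_anchor A X b)"
    and ?l = "dmap (kahler_lie K A X Y)"
    and ?p = "m a \<otimes>\<^bsub>C\<^esub> m b \<oplus>\<^bsub>C\<^esub> m b \<otimes>\<^bsub>C\<^esub> dmap X \<oplus>\<^bsub>C\<^esub> m a \<otimes>\<^bsub>C\<^esub> dmap Y \<oplus>\<^bsub>C\<^esub> dmap Y \<otimes>\<^bsub>C\<^esub> dmap X"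
  have "psi x \<otimes>\<^bsub>C\<^esub> psi y = ?p \<oplus>\<^bsub>C\<^esub> (?t \<oplus>\<^bsub>C\<^esub> ?l)"
    using cl by (simp add: psi_def x(1) y(1) C.B.l_distr C.B.r_distr dmap_anchor[OF x(3) y(2)]
        dmap_lie[OF x(3) y(3)] C.M.a_ac)
  moreover have "psi y \<otimes>\<^bsub>C\<^esub> psi x = ?p \<oplus>\<^bsub>C\<^esub> ?s"
    using cl by (simp add: psi_def x(1) y(1) C.B.l_distr C.B.r_distr dmap_anchor[OF y(3) x(2)]
        m_m_commute[of b a] C.M.a_ac)
  moreover have "psi (lie \<hh> x y) = (?t \<oplus>\<^bsub>C\<^esub> ?l) \<ominus>\<^bsub>C\<^esub> ?s"
    using cl by (simp add: psi_def x(1) y(1) semidirect_simps m_minus C.M.minus_eq C.M.a_ac)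
  moreover have "?p \<in> carrier C" "?s \<in> carrier C" "?t \<oplus>\<^bsub>C\<^esub> ?l \<in> carrier C"
    using cl by simp_all
  ultimately show ?thesis using C.M.diff_cancel[of ?p "?t \<oplus>\<^bsub>C\<^esub> ?l" ?s] by simp
qed

text \<open>The Lie map \<open>psi\<close> extends to \<open>\<U>\<close> as a unital homomorphism,
  is then regarded on \<open>U\<^sup>+\<close>, and descends to the quotient because it respects the
  action of \<open>A\<close>.\<close>

lemma lr_env_lift:
  "\<exists>f\<in>algebra_hom K \<V> C. \<forall>a\<in>carrier A. f (alpha K A a) = m a \<and> f (beta K A a) = h a"
proof -
  interpret Om: module A \<Omega> by (rule kahler_module_module)
  interpret Up: nonunital_algebra K \<U>\<^sub>p by (rule lr_plus_algebra)
  interpret Q: quotient_algebra K \<U>\<^sub>p \<P> by (rule lr_ideal_quotient_algebra)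
  have psi: "psi (a, X) = m a \<oplus>\<^bsub>C\<^esub> dmap X" for a X by (simp add: psi_def)
  have m0: "m \<zero>\<^bsub>A\<^esub> = \<zero>\<^bsub>C\<^esub>"
    by (rule additive_zero_minus(1)[OF M.abelian_group_axioms C.M.abelian_group_axioms])
      (simp_all add: m_cl m_add)
  have "\<exists>f\<in>algebra_hom K \<U> C. \<forall>x\<in>carrier \<hh>. f (incl x) = psi x"
  proof (rule H.lie_env_lift[OF C.assoc_algebra_axioms _ _ _ psi_lie])
    show "psi x \<in> carrier C" if "x \<in> carrier \<hh>" for x
      using that by (cases x) (simp add: semidirect_simps psi m_cl dmap_ops)
    show "psi (x \<oplus>\<^bsub>\<hh>\<^esub> y) = psi x \<oplus>\<^bsub>C\<^esub> psi y" if "x \<in> carrier \<hh>" "y \<in> carrier \<hh>" for x y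
      using that by (cases x; cases y) (simp add: semidirect_simps psi m_cl m_add dmap_ops C.M.a_ac)
    show "psi (c \<odot>\<^bsub>\<hh>\<^esub> x) = c \<odot>\<^bsub>C\<^esub> psi x" if "c \<in> carrier K" "x \<in> carrier \<hh>" for c x
      using that by (cases x) (simp add: semidirect_simps psi m_cl m_smult dmap_ops C.smult_r_distr
        m_one C.mult_smult_l)
  qed
  then obtain f where f: "f \<in> algebra_hom K \<U> C" and fx: "\<And>x. x \<in> carrier \<hh> \<Longrightarrow> f (incl x) = psi x"
    by blast
  note fD = algebra_homD[OF f]
  have sub: "x \<in> carrier \<U>" if "x \<in> carrier \<U>\<^sub>p" for x using that lr_plus_subset by blast
  \<comment> \<open>This is not inherited from the unital homomorphism on \<open>\<U>\<close>: in
    the smaller structure \<open>one\<close> is \<open>1\<^sub>A'\<close>, and its image is the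
    identity by \<open>m_one\<close>.\<close>
  have "f \<one>\<^bsub>\<U>\<^sub>p\<^esub> = \<one>\<^bsub>C\<^esub>"
    by (simp add: lr_plus_simps(5) fx pair_closed psi m_one dmap_zero)
  then have f': "f \<in> algebra_hom K \<U>\<^sub>p C"
    by (intro algebra_homI) (simp_all add: lr_plus_simps(2,3,6) fD sub)
  note f'D = algebra_homD[OF f']
  have fm: "f (u \<ominus>\<^bsub>\<U>\<^sub>p\<^esub> v) = f u \<ominus>\<^bsub>C\<^esub> f v" if "u \<in> carrier \<U>\<^sub>p" "v \<in> carrier \<U>\<^sub>p" for u v
    by (rule additive_zero_minus(3)[OF Up.M.abelian_group_axioms C.M.abelian_group_axioms])
      (use f'D(1,2) that in auto)
  have f0: "f \<zero>\<^bsub>\<U>\<^sub>p\<^esub> = \<zero>\<^bsub>C\<^esub>"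
    by (rule additive_zero_minus(1)[OF Up.M.abelian_group_axioms C.M.abelian_group_axioms])
      (use f'D(1,2) in auto)
  \<comment> \<open>The kernel inside \<open>U\<^sup>+\<close> is a two-sided ideal, so minimality
    of the hull reduces the vanishing on \<open>\<P>\<close> to the generators.\<close>
  let ?S = "{u \<in> carrier \<U>\<^sub>p. f u = \<zero>\<^bsub>C\<^esub>}"
  have "submodule ?S K \<U>\<^sub>p"
    by (rule submoduleI'[OF Up.module_axioms]) (auto simp: f'D f0)
  then have "two_sided ?S"
    by (auto simp: two_sided_def f'D Up.mult_closed)
  moreover have "lr_rels \<subseteq> ?S"
  proof -
    have "f (incl (sact a z)) = f (incl (a, \<zero>\<^bsub>\<Omega>\<^esub>)) \<otimes>\<^bsub>C\<^esub> f (incl z)"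
      if "a \<in> carrier A" "z \<in> carrier \<hh>" for a z
      using that semidirect_closed(4)[OF that]
      by (cases z) (simp add: fx pair_closed,
        simp add: semidirect_simps psi dmap_zero m_cl dmap_ops m_mult C.B.r_distr)
    then show ?thesis
      using lr_rels_carrier unfolding lr_rels_def
      by (auto simp: fm f'D incl_lr_plus semidirect_closed pair_closed Up.mult_closed C.M.minus_eq_zero_iff)
  qed
  ultimately have "\<P> \<subseteq> ?S"
    unfolding lr_ideal_hull by (rule hull_minimal[rotated])
  then obtain k where k: "k \<in> algebra_hom K \<V> C" "\<And>u. u \<in> carrier \<U>\<^sub>p \<Longrightarrow> k (\<P> +>\<^bsub>\<U>\<^sub>p\<^esub> u) = f u"
    using Q.quot_lift[OF C.assoc_algebra_axioms f'] unfolding lr_env_def by blast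
  have "k (vincl x) = psi x" if "x \<in> carrier \<hh>" for x
    using that by (simp add: lr_env_incl_def k(2) incl_lr_plus fx)
  then show ?thesis
    using k(1) by (intro bexI[of _ k])
      (simp_all add: alpha_vincl beta_vincl pair_closed d_ops(1) psi dmap_zero m0 m_cl h_cl dmap_ops(4))
qed

end

section \<open>The isomorphism and its uniqueness\<close>

theorem proposition5p7:
  fixes K :: "('k, 'm) ring_scheme" and A :: "('k, 'a, 'n) lie_alg_scheme"
  assumes "poisson_algebra K A"
  shows "\<exists>!\<Lambda>. \<Lambda> \<in> algebra_iso K (lr_env K A (kahler K A)) (poisson_env K A)
            \<inter> extensional (carrier (lr_env K A (kahler K A)))
          \<and> (\<forall>a\<in>carrier A. \<Lambda> (alpha K A a) = m_map K A a)
          \<and> (\<forall>a\<in>carrier A. \<Lambda> (beta K A a) = h_map K A a)"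
proof -
  interpret poisson_algebra K A by fact
  let ?V = "lr_env K A (kahler K A)" and ?E = "poisson_env K A"
  interpret V: poisson_rep K A ?V "alpha K A" "beta K A" by (rule lr_env_rep)
  interpret E: poisson_rep K A ?E "m_map K A" "h_map K A" by (rule poisson_env_rep)
  obtain f where f: "f \<in> algebra_hom K ?V ?E" "\<And>a. a \<in> carrier A \<Longrightarrow> f (alpha K A a) = m_map K A a"
      "\<And>a. a \<in> carrier A \<Longrightarrow> f (beta K A a) = h_map K A a"
    using E.lr_env_lift by blast
  obtain k where k: "k \<in> algebra_hom K ?E ?V" "\<And>a. a \<in> carrier A \<Longrightarrow> k (m_map K A a) = alpha K A a"
      "\<And>a. a \<in> carrier A \<Longrightarrow> k (h_map K A a) = beta K A a"
    using poisson_env_lift[OF lr_env_rep] by blast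
  note fD = algebra_homD[OF f(1)] and kD = algebra_homD[OF k(1)]
  have id: "(\<lambda>x. x) \<in> algebra_hom K B B" for B :: "('k, 'b, 'c) module_scheme"
    by (rule algebra_homI) auto
  \<comment> \<open>The composite and the identity are homomorphisms that agree on
    \<open>alpha\<close> and \<open>beta\<close>; the other composite is treated in the same way on
    \<open>m_map\<close> and \<open>h_map\<close>.\<close>
  have kf: "k (f x) = x" if "x \<in> carrier ?V" for x
    by (rule lr_env_hom_eq[OF lr_env_algebra algebra_hom_comp[OF f(1) k(1)] id _ _ that])
      (simp_all add: f k)
  have fk: "f (k y) = y" if "y \<in> carrier ?E" for y
    by (rule poisson_env_hom_eq[OF poisson_env_assoc_algebra algebra_hom_comp[OF k(1) f(1)] id _ _ that])
      (simp_all add: f k)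
  have bij: "bij_betw f (carrier ?V) (carrier ?E)"
    by (rule bij_betwI[where g = k]) (use kf fk fD(1) kD(1) in auto)
  \<comment> \<open>Functions are total, so a unique \<open>\<Lambda>\<close> requires its values
    off the carrier to be fixed; restriction sets them to \<open>undefined\<close>.\<close>
  let ?\<Lambda> = "restrict f (carrier ?V)"
  have r: "?\<Lambda> \<in> algebra_hom K ?V ?E"
    by (rule algebra_homI) (simp_all add: fD V.C.unit_closed)
  have iso: "?\<Lambda> \<in> algebra_iso K ?V ?E"
    using r bij by (simp add: algebra_iso_def algebra_hom_def ring_iso_def)
  show ?thesis
  proof (rule ex1I[of _ ?\<Lambda>])
    show "?\<Lambda> \<in> algebra_iso K ?V ?E \<inter> extensional (carrier ?V)
        \<and> (\<forall>a\<in>carrier A. ?\<Lambda> (alpha K A a) = m_map K A a)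
        \<and> (\<forall>a\<in>carrier A. ?\<Lambda> (beta K A a) = h_map K A a)"
      using iso by (simp add: f V.m_cl V.h_cl)
  next
    fix L assume L: "L \<in> algebra_iso K ?V ?E \<inter> extensional (carrier ?V)
        \<and> (\<forall>a\<in>carrier A. L (alpha K A a) = m_map K A a)
        \<and> (\<forall>a\<in>carrier A. L (beta K A a) = h_map K A a)"
    then have "L \<in> algebra_hom K ?V ?E"
      by (simp add: algebra_iso_def algebra_hom_def ring_iso_def)
    then have "L x = f x" if "x \<in> carrier ?V" for x
      by (rule lr_env_hom_eq[OF poisson_env_assoc_algebra _ f(1) _ _ that]) (use L f in simp_all)
    then show "L = ?\<Lambda>"
      using L by (intro extensionalityI[of L "carrier ?V"]) auto
  qed
qed

end
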